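(* There exists a positive $x \in \mathcal{A}_{\emptyset}$ such that there are no $g,h \in \mathcal{A}_{\emptyset}$, each expressible as a sum of squares, with $g \neq 0$, such that $gx = h$.
   Context: All graphs are finite and simple; $\emptyset$ denotes the graph with no vertices. For graphs $H,G$, $t(H;G)$ is the probability that a uniformly random map $V(H)\to V(G)$ is a homomorphism; $t(\emptyset;G)=1$. A partially labeled graph is a graph in which some vertices carry distinct positive-integer labels. $\mathcal{F}$ is the set of partially labeled graphs up to label-preserving isomorphism, and $\mathcal{F}_L$ those whose label set is exactly the finite set $L\subset\mathbb{N}$. The product $H_1\cdot H_2$ is the disjoint union with equally labeled vertices identified (multiple edges merged). $\mathbb{R}[\mathcal{F}]$ is the algebra of finite formal real linear combinations of elements of $\mathcal{F}$ with this product extended bilinearly, and $\mathbb{R}[\mathcal{F}_L]$ the subalgebra spanned by $\mathcal{F}_L$. For $H\in\mathcal{F}_L$, a graph $G$ and $\phi:L\to V(G)$, $t(H;G,\phi)$ is the probability that the map sending each labeled vertex with label $\ell$ to $\phi(\ell)$ and each unlabeled vertex to an independent uniform random vertex of $G$ is a homomorphism; this is extended linearly. Let $\mathcal{K}$ be the ideal generated by $F-\emptyset$ for $F$ a one-vertex (labeled or unlabeled) graph; $\mathcal{A}=\mathbb{R}[\mathcal{F}]/\mathcal{K}$, $\mathcal{A}_L=\mathbb{R}[\mathcal{F}_L]/(\mathcal{K}\cap\mathbb{R}[\mathcal{F}_L])$. An element $f\in\mathcal{A}_L$ is positive if $t(f;G,\phi)\ge0$ for all graphs $G$ and all $\phi:L\to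 V(G)$. For finite $T\subset\mathbb{N}$, $\llbracket\cdot\rrbracket_T$ is the linear map removing all labels not in $T$; $\llbracket\cdot\rrbracket:=\llbracket\cdot\rrbracket_\emptyset$. An element $y\in\mathcal{A}_\emptyset$ is expressible as a sum of squares if $y=\llbracket\sum_{i=1}^m g_i^2\rrbracket$ for some $g_1,\ldots,g_m\in\mathcal{A}$. *)

theory Defs
  imports Complex_Main "HOL-Library.FuncSet"
begin

text \<open>A partially labeled graph is represented by a finite vertex set of naturals, a set of
  edges (2-element subsets of the vertex set) and a partial labeling with distinct positive
  integer labels. Isomorphism classes are handled by adding isomorphism differences to the
  relations of the quotient below.\<close>

datatype pgraph = PG (verts: "nat set") (edges: "nat set set") (lab: "nat \<Rightarrow> nat option")

definition wfpg :: "pgraph \<Rightarrow> bool" where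
  "wfpg H \<longleftrightarrow> finite (verts H)
     \<and> (\<forall>e\<in>edges H. \<exists>u v. e = {u, v} \<and> u \<noteq> v \<and> u \<in> verts H \<and> v \<in> verts H)
     \<and> (\<forall>v. lab H v \<noteq> None \<longrightarrow> v \<in> verts H)
     \<and> inj_on (lab H) {v. lab H v \<noteq> None}
     \<and> (\<forall>v l. lab H v = Some l \<longrightarrow> l > 0)"

definition labels :: "pgraph \<Rightarrow> nat set" where
  "labels H = {l. \<exists>v\<in>verts H. lab H v = Some l}"

definition pg_iso :: "pgraph \<Rightarrow> pgraph \<Rightarrow> bool" where
  "pg_iso H H' \<longleftrightarrow> (\<exists>\<pi>. bij_betw \<pi> (verts H) (verts H')
      \<and> edges H' = (\<lambda>e. \<pi> ` e) ` edges H
      \<and> (\<forall>v\<in>verts H. lab H' (\<pi> v) = lab H v))"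

text \<open>Product: disjoint union (H1 on even numbers, H2 on odd numbers) with equally labeled
  vertices identified (multiple edges merged, since edges form a set).\<close>
definition pmul_map :: "pgraph \<Rightarrow> pgraph \<Rightarrow> nat \<Rightarrow> nat" where
  "pmul_map H1 H2 v = (if lab H2 v \<noteq> None \<and> (\<exists>u\<in>verts H1. lab H1 u = lab H2 v)
      then 2 * (THE u. u \<in> verts H1 \<and> lab H1 u = lab H2 v) else 2 * v + 1)"

definition pmul :: "pgraph \<Rightarrow> pgraph \<Rightarrow> pgraph" where
  "pmul H1 H2 = PG
     ((\<lambda>u. 2 * u) ` verts H1 \<union> pmul_map H1 H2 ` verts H2)
     ((\<lambda>e. (\<lambda>u. 2 * u) ` e) ` edges H1 \<union> (\<lambda>e. pmul_map H1 H2 ` e) ` edges H2)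
     (\<lambda>w. if even w \<and> w div 2 \<in> verts H1 then lab H1 (w div 2)
          else if odd w \<and> w div 2 \<in> verts H2 \<and> pmul_map H1 H2 (w div 2) = w
               then lab H2 (w div 2) else None)"

definition unl :: "nat set \<Rightarrow> pgraph \<Rightarrow> pgraph" where
  "unl T H = PG (verts H) (edges H)
     (\<lambda>v. case lab H v of None \<Rightarrow> None | Some l \<Rightarrow> if l \<in> T then Some l else None)"

definition empty_pg :: pgraph where
  "empty_pg = PG {} {} (\<lambda>_. None)"

definition one_vertex :: "pgraph \<Rightarrow> bool" where
  "one_vertex F \<longleftrightarrow> wfpg F \<and> card (verts F) = 1"

datatype graph = Gr (gverts: "nat set") (gedges: "nat set set")

definition wfgraph :: "graph \<Rightarrow> bool" where
  "wfgraph G \<longleftrightarrow> finite (gverts G) \<and> gverts G \<noteq> {}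
     \<and> (\<forall>e\<in>gedges G. \<exists>u v. e = {u, v} \<and> u \<noteq> v \<and> u \<in> gverts G \<and> v \<in> gverts G)"

text \<open>t(H;G,phi): probability that mapping labeled vertices via phi and unlabeled vertices
  uniformly at random gives a homomorphism.\<close>
definition tdens :: "pgraph \<Rightarrow> graph \<Rightarrow> (nat \<Rightarrow> nat) \<Rightarrow> real" where
  "tdens H G \<phi> =
     real (card {\<psi> \<in> verts H \<rightarrow>\<^sub>E gverts G.
                 (\<forall>v\<in>verts H. \<forall>l. lab H v = Some l \<longrightarrow> \<psi> v = \<phi> l)
               \<and> (\<forall>e\<in>edges H. \<psi> ` e \<in> gedges G)})
     / real (card (gverts G)) ^ card {v\<in>verts H. lab H v = None}"

type_synonym comb = "pgraph \<Rightarrow> real"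

definition supp :: "comb \<Rightarrow> pgraph set" where
  "supp f = {H. f H \<noteq> 0}"

definition is_comb :: "comb \<Rightarrow> bool" where
  "is_comb f \<longleftrightarrow> finite (supp f) \<and> (\<forall>H\<in>supp f. wfpg H)"

definition ind :: "pgraph \<Rightarrow> comb" where
  "ind H = (\<lambda>K. if K = H then 1 else 0)"

definition czero :: comb where "czero = (\<lambda>_. 0)"

definition cadd :: "comb \<Rightarrow> comb \<Rightarrow> comb" where
  "cadd f g = (\<lambda>K. f K + g K)"

definition cdiff :: "comb \<Rightarrow> comb \<Rightarrow> comb" where
  "cdiff f g = (\<lambda>K. f K - g K)"

definition cscale :: "real \<Rightarrow> comb \<Rightarrow> comb" where
  "cscale r f = (\<lambda>K. r * f K)"

definition cmul :: "comb \<Rightarrow> comb \<Rightarrow> comb" where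
  "cmul f g = (\<lambda>K. \<Sum>p\<in>supp f \<times> supp g.
                  if pmul (fst p) (snd p) = K then f (fst p) * g (snd p) else 0)"

definition cunl :: "nat set \<Rightarrow> comb \<Rightarrow> comb" where
  "cunl T f = (\<lambda>K. \<Sum>H\<in>supp f. if unl T H = K then f H else 0)"

definition csum :: "comb list \<Rightarrow> comb" where
  "csum gs = foldr cadd gs czero"

definition tcomb :: "comb \<Rightarrow> graph \<Rightarrow> (nat \<Rightarrow> nat) \<Rightarrow> real" where
  "tcomb f G \<phi> = (\<Sum>H\<in>supp f. f H * tdens H G \<phi>)"

text \<open>Combinations over representatives, modulo (i) differences of isomorphic graphs (giving
  R[F]) and (ii) the ideal K generated by F - empty for one-vertex F; since R[F] is commutative
  with basis F, K is spanned by H*F - H.\<close>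
inductive_set Krel :: "comb set" where
  zero: "czero \<in> Krel"
| add: "f \<in> Krel \<Longrightarrow> g \<in> Krel \<Longrightarrow> cadd f g \<in> Krel"
| scale: "f \<in> Krel \<Longrightarrow> cscale r f \<in> Krel"
| iso: "wfpg H \<Longrightarrow> wfpg H' \<Longrightarrow> pg_iso H H' \<Longrightarrow> cdiff (ind H) (ind H') \<in> Krel"
| gen: "wfpg H \<Longrightarrow> one_vertex F \<Longrightarrow> cdiff (ind (pmul H F)) (ind H) \<in> Krel"

definition aeq :: "comb \<Rightarrow> comb \<Rightarrow> bool" where
  "aeq f g \<longleftrightarrow> cdiff f g \<in> Krel"

definition inA :: "nat set \<Rightarrow> comb \<Rightarrow> bool" where
  "inA L f \<longleftrightarrow> is_comb f \<and> (\<forall>H\<in>supp f. labels H = L)"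

definition positive :: "nat set \<Rightarrow> comb \<Rightarrow> bool" where
  "positive L f \<longleftrightarrow> (\<forall>G \<phi>. wfgraph G \<longrightarrow> (\<forall>l\<in>L. \<phi> l \<in> gverts G) \<longrightarrow> tcomb f G \<phi> \<ge> 0)"

definition sos :: "comb \<Rightarrow> bool" where
  "sos y \<longleftrightarrow> (\<exists>gs. (\<forall>g\<in>set gs. is_comb g) \<and> aeq y (cunl {} (csum (map (\<lambda>g. cmul g g) gs))))"

end

theory Submission
  imports Defs "HOL-Computational_Algebra.Polynomial"
begin

text \<open>
  The density of an unlabeled graph in the complete graph with \<open>k\<close> vertices is a polynomial in
  \<open>1 / k\<close>. Evaluated at a real \<open>k \<ge> N\<close>, it still is nonnegative on sums of squares using at most
  \<open>N\<close> labels, because the number of injections of a set of \<open>i \<le> N\<close> classes into the vertices is the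
  falling factorial of \<open>k\<close>, which is nonnegative. So a positive element that becomes negative at
  noninteger \<open>k\<close> of arbitrary size has no certificate. A polynomial in one \<open>1 / k\<close> changes sign only
  finitely often, so two independent sizes \<open>a, b\<close> are used, and the witness encodes
  \<open>d\<^sup>2 (d\<^sup>2 - 1)\<^sup>3\<close> for \<open>d = b - a\<close>, which is nonnegative at integers but negative at \<open>d = 1/2\<close>. Here
  \<open>a\<close> and \<open>b\<close> are read off the neighbourhoods of two roots: a neighbourhood of nonadjacency density
  \<open>z\<close> stands for \<open>1 / z\<close>, and the excess of its triangle density over Goodman's bound
  \<open>(1 - z) (1 - 2 z)\<close> controls the distance of \<open>1 / z\<close> from the integers. Finally, the multiplier \<open>g\<close>
  may vanish on all these models. Mixing in a small amount \<open>e\<close> of a graph on which \<open>g\<close> does not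
  vanish keeps the witness negative, while \<open>g\<close> becomes a nonzero polynomial in \<open>e\<close>.
\<close>

section \<open>Weighted averages\<close>

text \<open>The cube in d^2 (d^2 - 1)^3 comes from the correction term. On a general graph the
  numbers 1 / z need not be integers, and the Goodman excess only controls the square of their
  distance to the integers. Such a quadratic penalty can pay for the negative values inside -1 < d <
  1 only if the polynomial vanishes to order at least two at -1, 0 and 1; here the orders are 3, 2,
  3. On uniformly weighted cliques the excess is zero identically in the reciprocal of the size, so
  the penalty leaves the negative value at d = 1/2 untouched. Roots are used because a root in a
  disjoint union of cliques sees its own clique only, whereas unrooted densities mix the two sizes.
  Vertex weights take the place of limits of graphs: a mixture with any proportion e is a finite
  object whose densities are polynomials in 1 / a, 1 / b and e. Identities valid on the grid of
  integer sizes extend to all real arguments, so g x = h becomes a pointwise identity of real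
  functions, and it suffices to refute it at a single point.\<close>

definition wavg :: "'p set \<Rightarrow> ('p \<Rightarrow> real) \<Rightarrow> nat set \<Rightarrow> ((nat \<Rightarrow> 'p) \<Rightarrow> real) \<Rightarrow> (nat \<Rightarrow> 'p) \<Rightarrow> real" where
  "wavg V w I F \<xi> = (\<Sum>\<psi>\<in>I \<rightarrow>\<^sub>E V. (\<Prod>i\<in>I. w (\<psi> i)) * F (override_on \<xi> \<psi> I))"

lemma wavg_empty [simp]: "wavg V w {} F \<xi> = F \<xi>"
  by (simp add: wavg_def)

text \<open>Iterated averaging, one coordinate at a time. The base assignment \<open>\<xi>\<close>
  absorbs each point that has been chosen; this is why \<open>wavg\<close> takes one, and it is
  generalized in the inductions below.\<close>

lemma wavg_insert:
  assumes "finite I" "i \<notin> I"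
  shows "wavg V w (insert i I) F \<xi> = (\<Sum>p\<in>V. w p * wavg V w I F (\<xi>(i := p)))"
proof -
  have ov: "override_on \<xi> (\<psi>(i := p)) (insert i I) = override_on (\<xi>(i := p)) \<psi> I" for \<psi> p
    using assms(2) by (auto simp: override_on_def fun_eq_iff)
  have pr: "(\<Prod>j\<in>I. w (if j = i then p else \<psi> j)) = (\<Prod>j\<in>I. w (\<psi> j))" for \<psi> p
    using assms(2) by (intro prod.cong) auto
  have "wavg V w (insert i I) F \<xi> =
      (\<Sum>x\<in>V \<times> (I \<rightarrow>\<^sub>E V). (\<Prod>j\<in>insert i I. w (((\<lambda>(y, g). g(i := y)) x) j))
         * F (override_on \<xi> ((\<lambda>(y, g). g(i := y)) x) (insert i I)))"
    unfolding wavg_def PiE_insert_eq by (subst sum.reindex[OF inj_combinator[OF assms(2)]]) (simp add: o_def)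
  also have "\<dots> = (\<Sum>(p, \<psi>)\<in>V \<times> (I \<rightarrow>\<^sub>E V). w p * ((\<Prod>j\<in>I. w (\<psi> j)) * F (override_on (\<xi>(i := p)) \<psi> I)))"
    using assms by (intro sum.cong) (auto simp: ov pr mult.assoc)
  also have "\<dots> = (\<Sum>p\<in>V. w p * wavg V w I F (\<xi>(i := p)))"
    by (simp add: sum.cartesian_product[symmetric] wavg_def sum_distrib_left)
  finally show ?thesis .
qed

lemma wavg_singleton [simp]: "wavg V w {i} F \<xi> = (\<Sum>p\<in>V. w p * F (\<xi>(i := p)))"
  by (simp add: wavg_insert)

text \<open>Renaming of coordinates along \<open>\<pi>\<close>. The set \<open>S\<close> may exceed
  \<open>I\<close>, so that coordinates which are not averaged, such as labeled vertices, are
  transported as well.\<close>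

lemma wavg_reindex:
  assumes "finite I" "inj_on \<pi> S" "I \<subseteq> S" "\<forall>v\<in>S. \<xi>' (\<pi> v) = \<xi> v"
    and "\<And>\<xi> \<xi>'. \<forall>v\<in>S. \<xi>' (\<pi> v) = \<xi> v \<Longrightarrow> F' \<xi>' = F \<xi>"
  shows "wavg V w (\<pi> ` I) F' \<xi>' = wavg V w I F \<xi>"
  using assms(1,3,4)
proof (induction I arbitrary: \<xi> \<xi>')
  case empty
  then show ?case using assms(5) by simp
next
  case (insert i I)
  have "\<pi> i \<notin> \<pi> ` I"
    using insert.hyps insert.prems assms(2) by (auto simp: inj_on_def)
  moreover have "wavg V w (\<pi> ` I) F' (\<xi>'(\<pi> i := p)) = wavg V w I F (\<xi>(i := p))" for p
    using insert.prems assms(2) by (intro insert.IH) (auto simp: inj_on_def)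
  ultimately show ?case
    using insert.hyps by (simp add: wavg_insert)
qed

lemma wavg_indep:
  assumes "finite I" "\<forall>v. v \<notin> J \<longrightarrow> \<xi>' v = \<xi> v"
    and "\<And>\<xi> \<xi>'. \<forall>v. v \<notin> J \<longrightarrow> \<xi>' v = \<xi> v \<Longrightarrow> F \<xi>' = F \<xi>"
  shows "wavg V w I F \<xi>' = wavg V w I F \<xi>"
  using assms(1,2)
proof (induction I arbitrary: \<xi> \<xi>')
  case empty
  then show ?case using assms(3) by simp
next
  case (insert i I)
  have "wavg V w I F (\<xi>'(i := p)) = wavg V w I F (\<xi>(i := p))" for p
    using insert.prems by (intro insert.IH) auto
  then show ?case using insert.hyps by (simp add: wavg_insert)
qed

lemma wavg_Un:
  assumes "finite I" "finite J" "I \<inter> J = {}"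
  shows "wavg V w (I \<union> J) F \<xi> = wavg V w I (wavg V w J F) \<xi>"
  using assms by (induction I arbitrary: \<xi>) (auto simp: wavg_insert)

text \<open>A coordinate that \<open>F\<close> does not inspect integrates out to the total weight
  1. This allows label sets to be enlarged to a common finite set and gives density 1 to edgeless
  graphs.\<close>

lemma wavg_superset:
  assumes "finite J" "I \<subseteq> J" "sum w V = 1"
    and "\<And>\<xi> \<xi>'. \<forall>v\<in>I. \<xi>' v = \<xi> v \<Longrightarrow> F \<xi>' = F \<xi>"
  shows "wavg V w J F \<xi> = wavg V w I F \<xi>"
proof -
  have "wavg V w K F \<xi> = F \<xi>" if "finite K" "K \<inter> I = {}" for K \<xi>
    using that
  proof (induction K arbitrary: \<xi>)
    case (insert i K)
    have "F (\<xi>(i := p)) = F \<xi>" for p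
      using insert.prems by (intro assms(4)) auto
    then show ?case
      using insert assms(3) by (simp add: wavg_insert flip: sum_distrib_right)
  qed simp
  then have "wavg V w (J - I) F = F"
    using assms(1) by (auto simp: fun_eq_iff)
  then show ?thesis
    using wavg_Un[of I "J - I" V w F \<xi>] assms(1,2) by (simp add: Un_absorb1 finite_subset)
qed

text \<open>Fubini: once the coordinates outside \<open>I\<close> and \<open>J\<close> are fixed,
  the two factors depend on disjoint blocks of independent points.\<close>

lemma wavg_mult:
  assumes "finite I" "finite J" "I \<inter> J = {}"
    and F: "\<And>\<xi> \<xi>'. \<forall>v. v \<notin> J \<longrightarrow> \<xi>' v = \<xi> v \<Longrightarrow> F \<xi>' = F \<xi>"
    and G: "\<And>\<xi> \<xi>'. \<forall>v. v \<notin> I \<longrightarrow> \<xi>' v = \<xi> v \<Longrightarrow> G \<xi>' = G \<xi>"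
  shows "wavg V w (I \<union> J) (\<lambda>\<xi>. F \<xi> * G \<xi>) \<xi> = wavg V w I F \<xi> * wavg V w J G \<xi>"
proof -
  have 1: "wavg V w J' (\<lambda>\<xi>. F \<xi> * G \<xi>) \<xi> = F \<xi> * wavg V w J' G \<xi>" if "finite J'" "J' \<subseteq> J" for J' \<xi>
    using that
  proof (induction J' arbitrary: \<xi>)
    case (insert j J')
    have "F (\<xi>(j := p)) = F \<xi>" for p
      using insert.prems by (intro F) auto
    then show ?case
      using insert by (simp add: wavg_insert sum_distrib_left algebra_simps)
  qed simp
  have "wavg V w I' (\<lambda>\<xi>. F \<xi> * wavg V w J G \<xi>) \<xi> = wavg V w I' F \<xi> * wavg V w J G \<xi>"
    if "finite I'" "I' \<subseteq> I" for I' \<xi>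
    using that
  proof (induction I' arbitrary: \<xi>)
    case (insert i I')
    have "wavg V w J G (\<xi>(i := p)) = wavg V w J G \<xi>" for p
      using insert.prems assms(2) by (intro wavg_indep[where J = I] G) auto
    then show ?case
      using insert by (simp add: wavg_insert sum_distrib_right mult.assoc)
  qed simp
  moreover have "wavg V w J (\<lambda>\<xi>. F \<xi> * G \<xi>) = (\<lambda>\<xi>. F \<xi> * wavg V w J G \<xi>)"
    using 1[OF assms(2) order_refl] by (simp add: fun_eq_iff)
  ultimately show ?thesis
    using assms(1-3) by (simp add: wavg_Un)
qed

lemma wavg_sum: "wavg V w I (\<lambda>\<xi>. \<Sum>k\<in>K. c k * F k \<xi>) \<xi> = (\<Sum>k\<in>K. c k * wavg V w I (F k) \<xi>)"
  unfolding wavg_def sum_distrib_left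
  by (subst sum.swap) (simp add: mult.left_commute)

text \<open>Points of weight zero can be discarded. This identifies a mixture whose cliques carry no
  weight with the fixed graph alone.\<close>

lemma wavg_embed:
  assumes "finite I" "finite V" "inj_on m V0" "m ` V0 \<subseteq> V"
    and "\<forall>q\<in>V0. w (m q) = w0 q" "\<forall>p\<in>V - m ` V0. w p = 0"
  shows "wavg V w I F (m \<circ> \<eta>) = wavg V0 w0 I (\<lambda>\<eta>. F (m \<circ> \<eta>)) \<eta>"
  using assms(1)
proof (induction I arbitrary: \<eta>)
  case (insert i I)
  have "wavg V w (insert i I) F (m \<circ> \<eta>) = (\<Sum>p\<in>m ` V0. w p * wavg V w I F ((m \<circ> \<eta>)(i := p)))"
    using insert assms by (simp add: wavg_insert) (intro sum.mono_neutral_right, auto)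
  also have "\<dots> = (\<Sum>q\<in>V0. w0 q * wavg V w I F (m \<circ> \<eta>(i := q)))"
    using assms by (simp add: sum.reindex) (simp add: comp_def fun_upd_def if_distrib cong: if_cong)
  also have "\<dots> = wavg V0 w0 (insert i I) (\<lambda>\<eta>. F (m \<circ> \<eta>)) \<eta>"
    unfolding wavg_insert[OF insert.hyps] by (intro sum.cong refl arg_cong2[where f = "(*)"] insert.IH)
  finally show ?case .
qed simp

section \<open>Densities in weighted graphs\<close>

definition unlabeled :: "pgraph \<Rightarrow> nat set" where
  "unlabeled H = {v \<in> verts H. lab H v = None}"

definition is_hom :: "('p \<Rightarrow> 'p \<Rightarrow> bool) \<Rightarrow> pgraph \<Rightarrow> (nat \<Rightarrow> 'p) \<Rightarrow> real" where
  "is_hom E H \<xi> = of_bool (\<forall>u v. {u, v} \<in> edges H \<longrightarrow> E (\<xi> u) (\<xi> v))"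

text \<open>For a well-formed graph the \<open>undefined\<close> values are harmless: they occur at
  unlabeled vertices, which \<open>wdens\<close> overwrites by averaging, and off the vertex set,
  where \<open>is_hom\<close> does not look.\<close>

definition label_ext :: "pgraph \<Rightarrow> (nat \<Rightarrow> 'p) \<Rightarrow> nat \<Rightarrow> 'p" where
  "label_ext H \<phi> v = (case lab H v of Some l \<Rightarrow> \<phi> l | None \<Rightarrow> undefined)"

text \<open>Generalizes \<open>tdens\<close> to real vertex weights. Uniform weights give the
  densities in finite graphs; nonuniform ones are needed for mixtures with a real
  proportion.\<close>

definition wdens :: "'p set \<Rightarrow> ('p \<Rightarrow> real) \<Rightarrow> ('p \<Rightarrow> 'p \<Rightarrow> bool) \<Rightarrow> (nat \<Rightarrow> 'p) \<Rightarrow> pgraph \<Rightarrow> real" where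
  "wdens V w E \<phi> H = wavg V w (unlabeled H) (is_hom E H) (label_ext H \<phi>)"

lemma edge_cases:
  assumes "wfpg H" "e \<in> edges H"
  obtains u v where "e = {u, v}" "u \<noteq> v" "u \<in> verts H" "v \<in> verts H"
proof -
  have "\<forall>e\<in>edges H. \<exists>u v. e = {u, v} \<and> u \<noteq> v \<and> u \<in> verts H \<and> v \<in> verts H"
    using assms(1) by (simp add: wfpg_def)
  then show thesis using assms(2) that by meson
qed

lemma edge_verts:
  assumes "wfpg H" "{u, v} \<in> edges H"
  shows "u \<in> verts H \<and> v \<in> verts H \<and> u \<noteq> v"
proof -
  obtain x y where "{u, v} = {x, y}" "x \<noteq> y" "x \<in> verts H" "y \<in> verts H"
    using edge_cases[OF assms] .
  then show ?thesis by (auto simp: doubleton_eq_iff)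
qed

lemma finite_verts: "wfpg H \<Longrightarrow> finite (verts H)"
  by (simp add: wfpg_def)

lemma finite_unlabeled: "wfpg H \<Longrightarrow> finite (unlabeled H)"
  by (simp add: wfpg_def unlabeled_def)

lemma is_hom_cong:
  assumes "wfpg H" "\<forall>v\<in>verts H. \<xi>' v = \<xi> v"
  shows "is_hom E H \<xi>' = is_hom E H \<xi>"
proof -
  have "E (\<xi>' u) (\<xi>' v) \<longleftrightarrow> E (\<xi> u) (\<xi> v)" if "{u, v} \<in> edges H" for u v
    using edge_verts[OF assms(1) that] assms(2) by simp
  then show ?thesis by (simp add: is_hom_def)
qed

lemma wdens_cong_ext:
  assumes "wfpg H" "\<And>v l. v \<in> verts H \<Longrightarrow> lab H v = Some l \<Longrightarrow> \<xi> v = \<phi> l"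
  shows "wdens V w E \<phi> H = wavg V w (unlabeled H) (is_hom E H) \<xi>"
proof -
  have "wavg V w I (is_hom E H) \<xi>' = wavg V w I (is_hom E H) \<xi>"
    if "finite I" "I \<subseteq> verts H" "\<forall>v\<in>verts H - I. \<xi>' v = \<xi> v" for I \<xi> \<xi>'
    using that
  proof (induction I arbitrary: \<xi> \<xi>')
    case empty
    then show ?case using is_hom_cong[OF assms(1)] by auto
  next
    case (insert i I)
    have "wavg V w I (is_hom E H) (\<xi>'(i := p)) = wavg V w I (is_hom E H) (\<xi>(i := p))" for p
      using insert.prems by (intro insert.IH) auto
    then show ?case using insert.hyps by (simp add: wavg_insert)
  qed
  then show ?thesis
    unfolding wdens_def by (rule)
      (use assms finite_unlabeled[OF assms(1)] in \<open>auto simp: unlabeled_def label_ext_def split: option.splits\<close>)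
qed

lemma wdens_iso:
  assumes "wfpg H" "wfpg H'" "pg_iso H H'"
  shows "wdens V w E \<phi> H' = wdens V w E \<phi> H"
proof -
  obtain \<pi> where \<pi>: "bij_betw \<pi> (verts H) (verts H')" "edges H' = (\<lambda>e. \<pi> ` e) ` edges H"
      "\<forall>v\<in>verts H. lab H' (\<pi> v) = lab H v"
    using assms(3) unfolding pg_iso_def by blast
  have inj: "inj_on \<pi> (verts H)" and im: "\<pi> ` verts H = verts H'"
    using \<pi>(1) by (auto simp: bij_betw_def)
  have U: "unlabeled H' = \<pi> ` unlabeled H"
    unfolding unlabeled_def im[symmetric] using \<pi>(3) by auto
  have edge: "{\<pi> u, \<pi> v} \<in> edges H' \<longleftrightarrow> {u, v} \<in> edges H" if "u \<in> verts H" "v \<in> verts H" for u v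
  proof
    assume "{\<pi> u, \<pi> v} \<in> edges H'"
    then obtain e where e: "e \<in> edges H" "{\<pi> u, \<pi> v} = \<pi> ` e"
      using \<pi>(2) by auto
    obtain x y where xy: "e = {x, y}" "x \<in> verts H" "y \<in> verts H"
      using edge_cases[OF assms(1) e(1)] by metis
    have "\<pi> ` {u, v} = \<pi> ` e" using e(2) by simp
    then have "{u, v} = e"
      using inj_on_image_eq_iff[OF inj, of "{u, v}" e] that xy by blast
    then show "{u, v} \<in> edges H" using e(1) by simp
  next
    assume "{u, v} \<in> edges H"
    then show "{\<pi> u, \<pi> v} \<in> edges H'" 
      unfolding \<pi>(2) using imageI[of "{u, v}" "edges H" "\<lambda>e. \<pi> ` e"] by simp
  qed
  have hom: "is_hom E H' \<xi>' = is_hom E H \<xi>" if "\<forall>v\<in>verts H. \<xi>' (\<pi> v) = \<xi> v" for \<xi> \<xi>'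
  proof -
    have "(\<forall>u v. {u, v} \<in> edges H' \<longrightarrow> E (\<xi>' u) (\<xi>' v)) \<longleftrightarrow>
          (\<forall>u\<in>\<pi> ` verts H. \<forall>v\<in>\<pi> ` verts H. {u, v} \<in> edges H' \<longrightarrow> E (\<xi>' u) (\<xi>' v))"
      unfolding im using edge_verts[OF assms(2)] by auto
    also have "\<dots> \<longleftrightarrow> (\<forall>u\<in>verts H. \<forall>v\<in>verts H. {u, v} \<in> edges H \<longrightarrow> E (\<xi> u) (\<xi> v))"
      using edge that by simp
    also have "\<dots> \<longleftrightarrow> (\<forall>u v. {u, v} \<in> edges H \<longrightarrow> E (\<xi> u) (\<xi> v))"
      using edge_verts[OF assms(1)] by auto
    finally show ?thesis by (simp add: is_hom_def)
  qed
  let ?\<xi> = "\<lambda>v. label_ext H' \<phi> (\<pi> v)"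
  have "wdens V w E \<phi> H' = wavg V w (unlabeled H) (is_hom E H) ?\<xi>"
    unfolding wdens_def U
    by (rule wavg_reindex[where S = "verts H"])
       (use assms(1) inj hom in \<open>auto simp: finite_unlabeled unlabeled_def finite_verts\<close>)
  also have "\<dots> = wdens V w E \<phi> H"
    using \<pi>(3) by (intro wdens_cong_ext[symmetric] assms(1)) (auto simp: label_ext_def)
  finally show ?thesis .
qed

section \<open>Multiplicativity of densities under the gluing product\<close>

lemma pmul_map_labeled:
  assumes "wfpg H1" "u \<in> verts H1" "lab H1 u = lab H2 v" "lab H2 v \<noteq> None"
  shows "pmul_map H1 H2 v = 2 * u"
proof -
  have "(THE u. u \<in> verts H1 \<and> lab H1 u = lab H2 v) = u"
    using assms by (intro the_equality) (auto simp: wfpg_def inj_on_def)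
  then show ?thesis using assms by (auto simp: pmul_map_def)
qed

lemma pmul_map_cases:
  assumes "wfpg H1"
  obtains u where "u \<in> verts H1" "lab H1 u = lab H2 v" "lab H2 v \<noteq> None" "pmul_map H1 H2 v = 2 * u"
  | "lab H2 v = None \<or> (\<forall>u\<in>verts H1. lab H1 u \<noteq> lab H2 v)" "pmul_map H1 H2 v = 2 * v + 1"
proof (cases "lab H2 v \<noteq> None \<and> (\<exists>u\<in>verts H1. lab H1 u = lab H2 v)")
  case True
  then obtain u where "u \<in> verts H1" "lab H1 u = lab H2 v" by blast
  then show thesis using True pmul_map_labeled[OF assms] that(1) by blast
next
  case False
  then have "pmul_map H1 H2 v = 2 * v + 1" unfolding pmul_map_def by (rule if_not_P)
  then show thesis using False by (intro that(2)) auto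
qed

text \<open>Vertices identified with one of the first factor get even images, all others odd ones,
  so a collision would have to occur within one of the two kinds.\<close>

lemma inj_on_pmul_map:
  assumes "wfpg H1" "wfpg H2"
  shows "inj_on (pmul_map H1 H2) (verts H2)"
proof (rule inj_onI)
  fix x y assume xy: "x \<in> verts H2" "y \<in> verts H2" "pmul_map H1 H2 x = pmul_map H1 H2 y"
  have inj: "lab H2 x = lab H2 y \<Longrightarrow> lab H2 x \<noteq> None \<Longrightarrow> x = y"
    using assms(2) by (auto simp: wfpg_def inj_on_def)
  show "x = y"
  proof (cases rule: pmul_map_cases[OF assms(1), of H2 x])
    case (1 u)
    note x = this
    show ?thesis
    proof (cases rule: pmul_map_cases[OF assms(1), of H2 y])
      case (1 u')
      then have "u = u'" using x xy(3) by simp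
      then show ?thesis using x 1 inj by simp
    next
      case 2
      then have "2 * u = 2 * y + 1" using x xy(3) by simp
      then show ?thesis by presburger
    qed
  next
    case 2
    note x = this
    show ?thesis
    proof (cases rule: pmul_map_cases[OF assms(1), of H2 y])
      case (1 u')
      then have "2 * u' = 2 * x + 1" using x xy(3) by simp
      then show ?thesis by presburger
    next
      case 2
      then show ?thesis using x xy(3) by simp
    qed
  qed
qed

lemma lab_pmul_left: "u \<in> verts H1 \<Longrightarrow> lab (pmul H1 H2) (2 * u) = lab H1 u"
  by (simp add: pmul_def)

lemma lab_pmul_right:
  assumes "wfpg H1" "v \<in> verts H2"
  shows "lab (pmul H1 H2) (pmul_map H1 H2 v) = lab H2 v"
proof (cases rule: pmul_map_cases[OF assms(1), of H2 v])
  case (1 u)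
  then show ?thesis by (simp add: lab_pmul_left)
next
  case 2
  show ?thesis using assms(2) unfolding 2(2) by (simp add: pmul_def 2(2))
qed

lemma unlabeled_pmul:
  assumes "wfpg H1" "wfpg H2"
  shows "unlabeled (pmul H1 H2) = (*) 2 ` unlabeled H1 \<union> pmul_map H1 H2 ` unlabeled H2"
proof -
  have "unlabeled (pmul H1 H2) = {w. (\<exists>u\<in>verts H1. w = 2 * u \<and> lab (pmul H1 H2) w = None)
      \<or> (\<exists>v\<in>verts H2. w = pmul_map H1 H2 v \<and> lab (pmul H1 H2) w = None)}"
    by (auto simp: unlabeled_def pmul_def)
  also have "\<dots> = (*) 2 ` unlabeled H1 \<union> pmul_map H1 H2 ` unlabeled H2"
    using lab_pmul_left[of _ H1 H2] lab_pmul_right[OF assms(1), of _ H2] by (auto simp: unlabeled_def)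
  finally show ?thesis .
qed

text \<open>The delicate point is that labels stay distinct: a label present in both factors must
  sit on a single vertex, which is what the fact \<open>mix\<close> says.\<close>

lemma wfpg_pmul:
  assumes "wfpg H1" "wfpg H2"
  shows "wfpg (pmul H1 H2)"
proof -
  let ?P = "pmul H1 H2"
  let ?m = "pmul_map H1 H2"
  have vP: "verts ?P = (*) 2 ` verts H1 \<union> ?m ` verts H2"
    by (simp add: pmul_def)
  have edge: "\<exists>u v. e = {u, v} \<and> u \<noteq> v \<and> u \<in> verts ?P \<and> v \<in> verts ?P" if "e \<in> edges ?P" for e
  proof -
    have "e \<in> (\<lambda>e. (*) 2 ` e) ` edges H1 \<or> e \<in> (\<lambda>e. ?m ` e) ` edges H2"
      using that by (simp add: pmul_def)
    then show ?thesis
    proof (elim disjE imageE)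
      fix e' assume e': "e = (*) 2 ` e'" "e' \<in> edges H1"
      obtain u v where uv: "e' = {u, v}" "u \<noteq> v" "u \<in> verts H1" "v \<in> verts H1"
        using edge_cases[OF assms(1) e'(2)] .
      then show ?thesis unfolding vP e'(1) by (intro exI[of _ "2 * u"] exI[of _ "2 * v"]) simp
    next
      fix e' assume e': "e = ?m ` e'" "e' \<in> edges H2"
      obtain u v where uv: "e' = {u, v}" "u \<noteq> v" "u \<in> verts H2" "v \<in> verts H2"
        using edge_cases[OF assms(2) e'(2)] .
      then have "?m u \<noteq> ?m v"
        using inj_on_pmul_map[OF assms] by (auto simp: inj_on_def)
      then show ?thesis unfolding vP e'(1) using uv by (intro exI[of _ "?m u"] exI[of _ "?m v"]) simp
    qed
  qed
  have dom: "w \<in> verts ?P" if "lab ?P w \<noteq> None" for w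
  proof (cases "even w \<and> w div 2 \<in> verts H1")
    case True
    then have "w = 2 * (w div 2)" by simp
    then show ?thesis using True vP by blast
  next
    case False
    then have "w div 2 \<in> verts H2" "?m (w div 2) = w"
      using that by (auto simp: pmul_def split: if_splits)
    then show ?thesis using vP by force
  qed
  have inj1: "u = u'" if "lab H1 u = lab H1 u'" "lab H1 u \<noteq> None" for u u'
    using that assms(1) by (auto simp: wfpg_def inj_on_def)
  have inj2: "v = v'" if "lab H2 v = lab H2 v'" "lab H2 v \<noteq> None" for v v'
    using that assms(2) by (auto simp: wfpg_def inj_on_def)
  have mix: "2 * u = ?m v" if "lab H1 u = lab H2 v" "lab H1 u \<noteq> None" "u \<in> verts H1" for u v
    using pmul_map_labeled[OF assms(1), of u H2 v] that by simp
  have "inj_on (lab ?P) {w. lab ?P w \<noteq> None}"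
  proof (rule inj_onI)
    fix x y assume xy: "x \<in> {w. lab ?P w \<noteq> None}" "y \<in> {w. lab ?P w \<noteq> None}" "lab ?P x = lab ?P y"
    have cases: "(\<exists>u\<in>verts H1. z = 2 * u \<and> lab ?P z = lab H1 u) \<or> (\<exists>v\<in>verts H2. z = ?m v \<and> lab ?P z = lab H2 v)"
      if "lab ?P z \<noteq> None" for z
      using dom[OF that] lab_pmul_left[of _ H1 H2] lab_pmul_right[OF assms(1), of _ H2]
      unfolding vP by auto
    consider u u' where "x = 2 * u" "y = 2 * u'" "lab ?P x = lab H1 u" "lab ?P y = lab H1 u'"
      | u v where "u \<in> verts H1" "x = 2 * u" "y = ?m v" "lab ?P x = lab H1 u" "lab ?P y = lab H2 v"
      | u v where "u \<in> verts H1" "y = 2 * u" "x = ?m v" "lab ?P y = lab H1 u" "lab ?P x = lab H2 v"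
      | v v' where "x = ?m v" "y = ?m v'" "lab ?P x = lab H2 v" "lab ?P y = lab H2 v'"
      using cases[of x] cases[of y] xy(1,2) by auto
    then show "x = y"
    proof cases
      case 1
      then show ?thesis using inj1[of u u'] xy by simp
    next
      case 2
      then show ?thesis using mix[of u v] xy by simp
    next
      case 3
      then show ?thesis using mix[of u v] xy by simp
    next
      case 4
      then show ?thesis using inj2[of v v'] xy by simp
    qed
  qed
  moreover have "l > 0" if "lab ?P w = Some l" for w l
    using that assms by (auto simp: pmul_def wfpg_def split: if_splits)
  ultimately show ?thesis
    using edge dom assms vP unfolding wfpg_def[of ?P] by (auto simp: finite_verts)
qed

lemma is_hom_pmul:
  assumes "wfpg H1" "wfpg H2"
  shows "is_hom E (pmul H1 H2) \<xi> = is_hom E H1 (\<lambda>u. \<xi> (2 * u)) * is_hom E H2 (\<lambda>v. \<xi> (pmul_map H1 H2 v))"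
proof -
  let ?m = "pmul_map H1 H2"
  have "(\<forall>u v. {u, v} \<in> edges (pmul H1 H2) \<longrightarrow> E (\<xi> u) (\<xi> v)) \<longleftrightarrow>
     (\<forall>u v. {u, v} \<in> edges H1 \<longrightarrow> E (\<xi> (2 * u)) (\<xi> (2 * v))) \<and>
     (\<forall>u v. {u, v} \<in> edges H2 \<longrightarrow> E (\<xi> (?m u)) (\<xi> (?m v)))" (is "?L \<longleftrightarrow> ?R1 \<and> ?R2")
  proof
    assume L: ?L
    have "{2 * u, 2 * v} \<in> edges (pmul H1 H2)" if "{u, v} \<in> edges H1" for u v
      using imageI[OF that, of "\<lambda>e. (*) 2 ` e"] by (simp add: pmul_def)
    moreover have "{?m u, ?m v} \<in> edges (pmul H1 H2)" if "{u, v} \<in> edges H2" for u v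
      using imageI[OF that, of "\<lambda>e. ?m ` e"] by (simp add: pmul_def)
    ultimately show "?R1 \<and> ?R2" using L by blast
  next
    assume R: "?R1 \<and> ?R2"
    show ?L
    proof (intro allI impI)
      fix x y assume "{x, y} \<in> edges (pmul H1 H2)"
      then consider e where "e \<in> edges H1" "{x, y} = (*) 2 ` e" | e where "e \<in> edges H2" "{x, y} = ?m ` e"
        by (auto simp: pmul_def)
      then show "E (\<xi> x) (\<xi> y)"
      proof cases
        case 1
        obtain u v where uv: "e = {u, v}" using edge_cases[OF assms(1) 1(1)] by metis
        then have "{v, u} \<in> edges H1" using 1 by (simp add: insert_commute)
        then show ?thesis using 1 R uv by (auto simp: doubleton_eq_iff)
      next
        case 2
        obtain u v where uv: "e = {u, v}" using edge_cases[OF assms(2) 2(1)] by metis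
        then have "{v, u} \<in> edges H2" using 2 by (simp add: insert_commute)
        then show ?thesis using 2 R uv by (auto simp: doubleton_eq_iff)
      qed
    qed
  qed
  then show ?thesis by (simp add: is_hom_def)
qed

text \<open>With the labeled vertices fixed, the unlabeled vertices of the two factors are sampled
  independently. They form disjoint blocks, since those of the first factor become even numbers and
  those of the second odd ones.\<close>

lemma wdens_pmul:
  assumes "wfpg H1" "wfpg H2"
  shows "wdens V w E \<phi> (pmul H1 H2) = wdens V w E \<phi> H1 * wdens V w E \<phi> H2"
proof -
  let ?m = "pmul_map H1 H2"
  let ?I = "(*) 2 ` unlabeled H1" and ?J = "?m ` unlabeled H2"
  let ?F = "\<lambda>\<xi>. is_hom E H1 (\<lambda>u. \<xi> (2 * u))" and ?G = "\<lambda>\<xi>. is_hom E H2 (\<lambda>v. \<xi> (?m v))"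
  let ?\<xi> = "label_ext (pmul H1 H2) \<phi>"
  have J: "?J = (\<lambda>v. 2 * v + 1) ` unlabeled H2"
    by (intro image_cong) (auto simp: pmul_map_def unlabeled_def)
  have FJ: "2 * u \<notin> ?J" for u
    unfolding J by (auto; presburger)
  have GI: "?m v \<notin> ?I" for v
    using pmul_map_cases[OF assms(1), of H2 v] by cases (auto simp: unlabeled_def, presburger+)
  have "wdens V w E \<phi> (pmul H1 H2) = wavg V w (?I \<union> ?J) (\<lambda>\<xi>. ?F \<xi> * ?G \<xi>) ?\<xi>"
    unfolding wdens_def unlabeled_pmul[OF assms] is_hom_pmul[OF assms, abs_def] ..
  also have "\<dots> = wavg V w ?I ?F ?\<xi> * wavg V w ?J ?G ?\<xi>"
    using assms FJ GI by (intro wavg_mult) (auto simp: finite_unlabeled intro!: arg_cong[where f = "is_hom E _"])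
  also have "wavg V w ?I ?F ?\<xi> = wavg V w (unlabeled H1) (is_hom E H1) (\<lambda>u. ?\<xi> (2 * u))"
    by (rule wavg_reindex[where S = UNIV])
       (use assms in \<open>auto simp: finite_unlabeled inj_on_def intro!: arg_cong[where f = "is_hom E _"]\<close>)
  also have "\<dots> = wdens V w E \<phi> H1"
    using assms by (intro wdens_cong_ext[symmetric]) (auto simp: label_ext_def lab_pmul_left)
  also have "wavg V w ?J ?G ?\<xi> = wavg V w (unlabeled H2) (is_hom E H2) (\<lambda>v. ?\<xi> (?m v))"
    by (rule wavg_reindex[where S = "verts H2"])
       (use assms inj_on_pmul_map[OF assms] in
         \<open>auto simp: finite_unlabeled unlabeled_def finite_verts intro!: is_hom_cong\<close>)
  also have "\<dots> = wdens V w E \<phi> H2"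
    using assms by (intro wdens_cong_ext[symmetric]) (auto simp: label_ext_def lab_pmul_right)
  finally show ?thesis .
qed

lemma wdens_no_edges:
  assumes "wfpg H" "edges H = {}" "sum w V = 1"
  shows "wdens V w E \<phi> H = 1"
proof -
  have "wavg V w (unlabeled H) (is_hom E H) \<xi> = wavg V w {} (is_hom E H) \<xi>" for \<xi>
    by (rule wavg_superset) (use assms in \<open>auto simp: finite_unlabeled is_hom_def\<close>)
  then show ?thesis
    using assms(2) by (simp add: wdens_def is_hom_def)
qed

lemma wdens_one_vertex:
  assumes "one_vertex F" "sum w V = 1"
  shows "wdens V w E \<phi> F = 1"
proof -
  obtain x where x: "wfpg F" "verts F = {x}"
    using assms(1) by (auto simp: one_vertex_def card_1_singleton_iff)
  have "edges F = {}"
    using edge_cases[OF x(1)] x(2) by (metis equals0I singletonD)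
  then show ?thesis using wdens_no_edges x assms(2) by blast
qed

section \<open>Removing labels as averaging over their positions\<close>

lemma lab_unl: "lab (unl T H) v = Some l \<longleftrightarrow> lab H v = Some l \<and> l \<in> T"
  by (auto simp: unl_def split: option.splits)

lemma wfpg_unl:
  assumes "wfpg H"
  shows "wfpg (unl T H)"
proof -
  have "verts (unl T H) = verts H" "edges (unl T H) = edges H"
    by (simp_all add: unl_def)
  moreover have "inj_on (lab (unl T H)) {v. lab (unl T H) v \<noteq> None}"
  proof (rule inj_onI)
    fix x y assume "x \<in> {v. lab (unl T H) v \<noteq> None}" "lab (unl T H) x = lab (unl T H) y"
    then obtain l where "lab H x = Some l" "lab H y = Some l"
      using lab_unl by (metis (mono_tags, lifting) mem_Collect_eq not_Some_eq)
    then show "x = y"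
      using assms by (auto simp: wfpg_def inj_on_def)
  qed
  ultimately show ?thesis
    using assms lab_unl[of T H] unfolding wfpg_def by (metis not_Some_eq)
qed

lemma labels_unl_empty: "labels (unl {} H) = {}"
  by (auto simp: labels_def unl_def split: option.splits)

lemma finite_labels: "wfpg H \<Longrightarrow> finite (labels H)"
proof -
  assume "wfpg H"
  moreover have "labels H \<subseteq> (\<lambda>v. the (lab H v)) ` verts H"
    unfolding labels_def by (auto simp: image_iff) (metis option.sel)
  ultimately show ?thesis
    using finite_surj finite_verts by blast
qed

lemma wdens_cong_labels:
  assumes "wfpg H" "\<forall>l\<in>labels H. \<phi>' l = \<phi> l"
  shows "wdens V w E \<phi>' H = wdens V w E \<phi> H"
  unfolding wdens_def[of V w E \<phi>]
  by (rule wdens_cong_ext) (use assms in \<open>auto simp: label_ext_def labels_def\<close>)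

text \<open>A vertex that loses its label becomes one more random point, so the new density is the
  mean of the old one over the placement of the labels. Admitting any finite \<open>L\<close> above
  \<open>labels H\<close> lets one average serve all terms of a combination.\<close>

lemma wdens_unl:
  assumes "wfpg H" "finite L" "labels H \<subseteq> L" "sum w V = 1"
  shows "wdens V w E \<phi> (unl {} H) = wavg V w L (\<lambda>\<phi>. wdens V w E \<phi> H) \<phi>"
proof -
  let ?B = "{v \<in> verts H. lab H v \<noteq> None}"
  let ?\<pi> = "\<lambda>v. the (lab H v)"
  let ?\<xi> = "\<lambda>v. \<phi> (?\<pi> v)"
  have inj: "inj_on ?\<pi> ?B"
    using assms(1) by (auto simp: wfpg_def inj_on_def)
  have B: "?\<pi> ` ?B = labels H"
    by (force simp: labels_def)
  have U: "unlabeled (unl {} H) = ?B \<union> unlabeled H"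
    by (auto simp: unlabeled_def unl_def split: option.splits)
  have "wavg V w L (\<lambda>\<phi>. wdens V w E \<phi> H) \<phi> = wavg V w (?\<pi> ` ?B) (\<lambda>\<phi>. wdens V w E \<phi> H) \<phi>"
    unfolding B by (rule wavg_superset) (use assms in \<open>auto intro: wdens_cong_labels\<close>)
  \<comment> \<open>Coordinates indexed by labels are exchanged for coordinates indexed by the
    labeled vertices.\<close>
  also have "\<dots> = wavg V w ?B (wavg V w (unlabeled H) (is_hom E H)) ?\<xi>"
    by (rule wavg_reindex[where S = ?B])
      (use assms(1) inj in \<open>auto simp: finite_verts intro!: wdens_cong_ext\<close>)
  also have "\<dots> = wavg V w (?B \<union> unlabeled H) (is_hom E H) ?\<xi>"
    using assms(1) by (intro wavg_Un[symmetric]) (auto simp: finite_verts finite_unlabeled unlabeled_def)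
  also have "\<dots> = wavg V w (unlabeled (unl {} H)) (is_hom E (unl {} H)) ?\<xi>"
  proof -
    have "is_hom E (unl {} H) = is_hom E H"
      by (simp add: is_hom_def[abs_def] unl_def)
    then show ?thesis unfolding U by simp
  qed
  also have "\<dots> = wdens V w E \<phi> (unl {} H)"
    using assms(1) by (intro wdens_cong_ext[symmetric] wfpg_unl) (auto simp: unl_def split: option.splits)
  finally show ?thesis ..
qed

section \<open>Evaluation of formal combinations\<close>

definition wcomb :: "'p set \<Rightarrow> ('p \<Rightarrow> real) \<Rightarrow> ('p \<Rightarrow> 'p \<Rightarrow> bool) \<Rightarrow> (nat \<Rightarrow> 'p) \<Rightarrow> comb \<Rightarrow> real" where
  "wcomb V w E \<phi> f = (\<Sum>H\<in>supp f. f H * wdens V w E \<phi> H)"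

lemma sum_supp_superset:
  fixes h :: "pgraph \<Rightarrow> real"
  assumes "finite S" "supp f \<subseteq> S"
  shows "(\<Sum>H\<in>supp f. f H * h H) = (\<Sum>H\<in>S. f H * h H)"
  by (rule sum.mono_neutral_left) (use assms in \<open>auto simp: supp_def\<close>)

lemma is_comb_czero: "is_comb czero"
  by (simp add: is_comb_def supp_def czero_def)

lemma supp_cadd: "supp (cadd f g) \<subseteq> supp f \<union> supp g"
  by (auto simp: supp_def cadd_def)

lemma supp_cdiff: "supp (cdiff f g) \<subseteq> supp f \<union> supp g"
  by (auto simp: supp_def cdiff_def)

lemma supp_cscale: "supp (cscale r f) \<subseteq> supp f"
  by (auto simp: supp_def cscale_def)

lemma supp_ind: "supp (ind H) = {H}"
  by (auto simp: supp_def ind_def)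

lemma supp_cmul: "supp (cmul f g) \<subseteq> (\<lambda>p. pmul (fst p) (snd p)) ` (supp f \<times> supp g)"
proof
  fix K assume "K \<in> supp (cmul f g)"
  then have "cmul f g K \<noteq> 0" by (simp add: supp_def)
  then obtain p where "p \<in> supp f \<times> supp g" "(if pmul (fst p) (snd p) = K then f (fst p) * g (snd p) else 0) \<noteq> 0"
    unfolding cmul_def by (rule sum.not_neutral_contains_not_neutral)
  then show "K \<in> (\<lambda>p. pmul (fst p) (snd p)) ` (supp f \<times> supp g)"
    by (auto split: if_splits)
qed

lemma supp_cunl: "supp (cunl T f) \<subseteq> unl T ` supp f"
proof
  fix K assume "K \<in> supp (cunl T f)"
  then have "cunl T f K \<noteq> 0" by (simp add: supp_def)
  then obtain H where "H \<in> supp f" "(if unl T H = K then f H else 0) \<noteq> 0"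
    unfolding cunl_def by (rule sum.not_neutral_contains_not_neutral)
  then show "K \<in> unl T ` supp f"
    by (auto split: if_splits)
qed

lemma is_comb_supp:
  assumes "is_comb f" "is_comb g" "supp h \<subseteq> supp f \<union> supp g"
  shows "is_comb h"
proof -
  have "finite (supp h)"
    using assms by (intro finite_subset[OF assms(3)]) (simp add: is_comb_def)
  then show ?thesis using assms by (auto simp: is_comb_def)
qed

lemma is_comb_cadd: "is_comb f \<Longrightarrow> is_comb g \<Longrightarrow> is_comb (cadd f g)"
  by (rule is_comb_supp[OF _ _ supp_cadd])

lemma is_comb_cdiff: "is_comb f \<Longrightarrow> is_comb g \<Longrightarrow> is_comb (cdiff f g)"
  by (rule is_comb_supp[OF _ _ supp_cdiff])

lemma is_comb_cscale: "is_comb f \<Longrightarrow> is_comb (cscale r f)"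
  by (rule is_comb_supp[of f f]) (auto simp: supp_cscale)

lemma is_comb_ind: "wfpg H \<Longrightarrow> is_comb (ind H)"
  by (simp add: is_comb_def supp_ind)

lemma is_comb_cmul:
  assumes "is_comb f" "is_comb g"
  shows "is_comb (cmul f g)"
proof -
  have "finite (supp (cmul f g))"
    by (rule finite_subset[OF supp_cmul]) (use assms in \<open>simp add: is_comb_def\<close>)
  moreover have "wfpg K" if "K \<in> supp (cmul f g)" for K
    using subsetD[OF supp_cmul that] assms by (auto simp: is_comb_def wfpg_pmul)
  ultimately show ?thesis by (simp add: is_comb_def)
qed

lemma is_comb_cunl:
  assumes "is_comb f"
  shows "is_comb (cunl T f)"
proof -
  have "finite (supp (cunl T f))"
    by (rule finite_subset[OF supp_cunl]) (use assms in \<open>simp add: is_comb_def\<close>)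
  moreover have "wfpg K" if "K \<in> supp (cunl T f)" for K
    using subsetD[OF supp_cunl that] assms by (auto simp: is_comb_def wfpg_unl)
  ultimately show ?thesis by (simp add: is_comb_def)
qed

lemma inA_cunl_empty:
  assumes "is_comb f"
  shows "inA {} (cunl {} f)"
  using is_comb_cunl[OF assms] supp_cunl[of "{}" f] labels_unl_empty by (auto simp: inA_def)

lemma is_comb_csum: "\<forall>g\<in>set gs. is_comb g \<Longrightarrow> is_comb (csum gs)"
  by (induction gs) (auto simp: csum_def is_comb_czero is_comb_cadd)

lemma wcomb_czero: "wcomb V w E \<phi> czero = 0"
  by (simp add: wcomb_def supp_def czero_def)

lemma wcomb_cadd:
  assumes "finite (supp f)" "finite (supp g)"
  shows "wcomb V w E \<phi> (cadd f g) = wcomb V w E \<phi> f + wcomb V w E \<phi> g"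
proof -
  note s = sum_supp_superset[where S = "supp f \<union> supp g" and h = "wdens V w E \<phi>"]
  show ?thesis
    unfolding wcomb_def using s[of f] s[of g] s[of "cadd f g"] supp_cadd[of f g] assms
    by (simp add: cadd_def sum.distrib distrib_right)
qed

lemma wcomb_cscale:
  assumes "finite (supp f)"
  shows "wcomb V w E \<phi> (cscale r f) = r * wcomb V w E \<phi> f"
  unfolding wcomb_def using sum_supp_superset[OF assms supp_cscale[of r f], of "wdens V w E \<phi>"]
  by (simp add: cscale_def sum_distrib_left mult.assoc)

lemma cdiff_eq: "cdiff f g = cadd f (cscale (- 1) g)"
  by (simp add: cdiff_def cadd_def cscale_def)

lemma wcomb_cdiff:
  assumes "finite (supp f)" "finite (supp g)"
  shows "wcomb V w E \<phi> (cdiff f g) = wcomb V w E \<phi> f - wcomb V w E \<phi> g"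
  using assms finite_subset[OF supp_cscale, of g] by (simp add: cdiff_eq wcomb_cadd wcomb_cscale)

lemma wcomb_ind: "wcomb V w E \<phi> (ind H) = wdens V w E \<phi> H"
  by (simp add: wcomb_def supp_ind) (simp add: ind_def)

text \<open>Evaluation is well defined on the quotient: isomorphic graphs have equal density, and a
  one-vertex factor has density 1 because the total weight is 1. Finite support is carried along
  since additivity of \<open>wcomb\<close> relies on it.\<close>

lemma wcomb_Krel:
  assumes "f \<in> Krel" "sum w V = 1"
  shows "finite (supp f) \<and> wcomb V w E \<phi> f = 0"
  using assms(1)
proof induction
  case zero
  then show ?case using is_comb_czero by (simp add: wcomb_czero is_comb_def)
next
  case (add f g)
  then show ?case using finite_subset[OF supp_cadd, of f g] by (simp add: wcomb_cadd)
next
  case (scale f r)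
  then show ?case using finite_subset[OF supp_cscale, of f r] by (simp add: wcomb_cscale)
next
  case (iso H H')
  then show ?case
    using finite_subset[OF supp_cdiff, of "ind H" "ind H'"] wdens_iso[of H H' V w E \<phi>]
    by (simp add: wcomb_cdiff supp_ind wcomb_ind)
next
  case (gen H F)
  then have "wfpg F" by (simp add: one_vertex_def)
  then show ?case
    using gen assms(2) finite_subset[OF supp_cdiff, of "ind (pmul H F)" "ind H"]
    by (simp add: wcomb_cdiff supp_ind wcomb_ind wdens_pmul wdens_one_vertex)
qed

lemma wcomb_aeq:
  assumes "aeq f g" "finite (supp f)" "finite (supp g)" "sum w V = 1"
  shows "wcomb V w E \<phi> f = wcomb V w E \<phi> g"
  using wcomb_Krel[of "cdiff f g" w V E \<phi>] assms by (simp add: aeq_def wcomb_cdiff)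

text \<open>At a fixed placement of the labels evaluation is multiplicative, so
  \<open>cmul g g\<close> evaluates to a real square. Different pairs may have the same product
  graph; exchanging the sums collects them.\<close>

lemma wcomb_cmul:
  assumes "is_comb f" "is_comb g"
  shows "wcomb V w E \<phi> (cmul f g) = wcomb V w E \<phi> f * wcomb V w E \<phi> g"
proof -
  let ?t = "wdens V w E \<phi>" and ?P = "supp f \<times> supp g"
  let ?S = "(\<lambda>p. pmul (fst p) (snd p)) ` ?P"
  have fin: "finite ?P" "finite ?S" using assms by (auto simp: is_comb_def)
  have "wcomb V w E \<phi> (cmul f g) = (\<Sum>K\<in>?S. cmul f g K * ?t K)"
    unfolding wcomb_def using fin supp_cmul by (intro sum_supp_superset) auto
  also have "\<dots> = (\<Sum>K\<in>?S. \<Sum>p\<in>?P. if pmul (fst p) (snd p) = K then f (fst p) * g (snd p) * ?t K else 0)"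
    unfolding cmul_def sum_distrib_right by (intro sum.cong) auto
  also have "\<dots> = (\<Sum>p\<in>?P. \<Sum>K\<in>?S. if pmul (fst p) (snd p) = K then f (fst p) * g (snd p) * ?t K else 0)"
    by (rule sum.swap)
  also have "\<dots> = (\<Sum>p\<in>?P. f (fst p) * g (snd p) * ?t (pmul (fst p) (snd p)))"
    using fin by (intro sum.cong) (auto simp: sum.delta)
  also have "\<dots> = (\<Sum>p\<in>?P. (f (fst p) * ?t (fst p)) * (g (snd p) * ?t (snd p)))"
    using assms by (intro sum.cong) (auto simp: is_comb_def wdens_pmul)
  also have "\<dots> = wcomb V w E \<phi> f * wcomb V w E \<phi> g"
    by (simp add: wcomb_def sum_product sum.cartesian_product case_prod_beta)
  finally show ?thesis .
qed

lemma wcomb_csum: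
  assumes "\<forall>g\<in>set gs. is_comb g"
  shows "wcomb V w E \<phi> (csum gs) = (\<Sum>g\<leftarrow>gs. wcomb V w E \<phi> g)"
  using assms
proof (induction gs)
  case (Cons g gs)
  then have "is_comb (csum gs)" "is_comb g" using is_comb_csum by auto
  then show ?case
    using Cons by (simp add: csum_def wcomb_cadd is_comb_def)
qed (simp add: csum_def wcomb_czero)

lemma wcomb_cunl:
  assumes "is_comb f" "finite L" "\<And>H. H \<in> supp f \<Longrightarrow> labels H \<subseteq> L" "sum w V = 1"
  shows "wcomb V w E \<phi> (cunl {} f) = wavg V w L (\<lambda>\<phi>. wcomb V w E \<phi> f) \<phi>"
proof -
  let ?t = "wdens V w E \<phi>" and ?S = "unl {} ` supp f"
  have fin: "finite (supp f)" "finite ?S" using assms by (auto simp: is_comb_def)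
  have "wcomb V w E \<phi> (cunl {} f) = (\<Sum>K\<in>?S. cunl {} f K * ?t K)"
    unfolding wcomb_def using fin supp_cunl by (intro sum_supp_superset) auto
  also have "\<dots> = (\<Sum>K\<in>?S. \<Sum>H\<in>supp f. if unl {} H = K then f H * ?t K else 0)"
    unfolding cunl_def sum_distrib_right by (intro sum.cong) auto
  also have "\<dots> = (\<Sum>H\<in>supp f. \<Sum>K\<in>?S. if unl {} H = K then f H * ?t K else 0)"
    by (rule sum.swap)
  also have "\<dots> = (\<Sum>H\<in>supp f. f H * ?t (unl {} H))"
    using fin by (intro sum.cong) (auto simp: sum.delta)
  also have "\<dots> = (\<Sum>H\<in>supp f. f H * wavg V w L (\<lambda>\<phi>. wdens V w E \<phi> H) \<phi>)"
    using assms by (intro sum.cong arg_cong2[where f = "(*)"] wdens_unl) (auto simp: is_comb_def)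
  also have "\<dots> = wavg V w L (\<lambda>\<phi>. wcomb V w E \<phi> f) \<phi>"
    unfolding wcomb_def by (rule wavg_sum[symmetric])
  finally show ?thesis .
qed

section \<open>Densities in finite graphs as uniform averages\<close>

lemma wavg_count:
  assumes "finite I" "finite V"
  shows "wavg V (\<lambda>_. c) I (\<lambda>\<xi>. of_bool (P \<xi>)) \<xi> = c ^ card I * real (card {\<psi> \<in> I \<rightarrow>\<^sub>E V. P (override_on \<xi> \<psi> I)})"
proof -
  have "finite (I \<rightarrow>\<^sub>E V)" using assms by (simp add: finite_PiE)
  then show ?thesis
    by (simp add: wavg_def sum.If_cases of_bool_def Int_def mult.commute flip: sum_distrib_left)
qed

text \<open>A map respecting the labels is determined by its restriction to the unlabeled vertices.
  Conversely every such restriction extends, because \<open>\<phi>\<close> sends the labels into the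
  graph.\<close>

lemma tdens_eq_wdens:
  assumes "wfpg H" "wfgraph G" "\<And>v l. lab H v = Some l \<Longrightarrow> \<phi> l \<in> gverts G"
  shows "tdens H G \<phi> = wdens (gverts G) (\<lambda>_. 1 / real (card (gverts G))) (\<lambda>x y. {x, y} \<in> gedges G) \<phi> H"
proof -
  let ?V = "gverts G" and ?U = "unlabeled H" and ?E = "\<lambda>x y. {x, y} \<in> gedges G"
  let ?A = "{\<psi> \<in> verts H \<rightarrow>\<^sub>E ?V. (\<forall>v\<in>verts H. \<forall>l. lab H v = Some l \<longrightarrow> \<psi> v = \<phi> l) \<and> (\<forall>e\<in>edges H. \<psi> ` e \<in> gedges G)}"
  let ?hom = "\<lambda>\<xi>. \<forall>u v. {u, v} \<in> edges H \<longrightarrow> ?E (\<xi> u) (\<xi> v)"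
  let ?o = "\<lambda>\<psi>. override_on (label_ext H \<phi>) \<psi> ?U"
  let ?B = "{\<psi> \<in> ?U \<rightarrow>\<^sub>E ?V. ?hom (?o \<psi>)}"
  have fin: "finite ?V" "finite ?U" using assms by (auto simp: wfgraph_def finite_unlabeled)
  have hom: "(\<forall>e\<in>edges H. \<psi> ` e \<in> gedges G) \<longleftrightarrow> ?hom \<psi>" for \<psi> :: "nat \<Rightarrow> nat"
  proof
    assume h: "\<forall>e\<in>edges H. \<psi> ` e \<in> gedges G"
    have "\<psi> ` {u, v} \<in> gedges G" if "{u, v} \<in> edges H" for u v
      using bspec[OF h that] .
    then show "?hom \<psi>" by simp
  next
    assume h: "?hom \<psi>"
    show "\<forall>e\<in>edges H. \<psi> ` e \<in> gedges G"
    proof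
      fix e assume "e \<in> edges H"
      moreover obtain u v where "e = {u, v}" using edge_cases[OF assms(1) \<open>e \<in> edges H\<close>] by metis
      ultimately show "\<psi> ` e \<in> gedges G" using h by simp
    qed
  qed
  have cong: "?hom \<psi> \<longleftrightarrow> ?hom \<psi>'" if "\<forall>v\<in>verts H. \<psi> v = \<psi>' v" for \<psi> \<psi>' :: "nat \<Rightarrow> nat"
    using is_hom_cong[OF assms(1) that, of ?E] by (simp add: is_hom_def of_bool_eq_iff)
  have "bij_betw (\<lambda>\<psi>. restrict \<psi> ?U) ?A ?B"
  proof (rule bij_betw_byWitness[where f' = "\<lambda>\<psi>. restrict (?o \<psi>) (verts H)"])
    have lab_U: "v \<in> ?U \<longleftrightarrow> (\<forall>l. lab H v \<noteq> Some l)" if "v \<in> verts H" for v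
      using that by (auto simp: unlabeled_def)
    have o_eq: "?o (restrict \<psi> ?U) v = \<psi> v" if "\<psi> \<in> ?A" "v \<in> verts H" for \<psi> v
      using that by (cases "lab H v") (auto simp: override_on_def unlabeled_def label_ext_def)
    show "\<forall>\<psi>\<in>?A. restrict (?o (restrict \<psi> ?U)) (verts H) = \<psi>"
      using o_eq by (auto simp: fun_eq_iff PiE_def extensional_def restrict_def)
    show "\<forall>\<psi>\<in>?B. restrict (restrict (?o \<psi>) (verts H)) ?U = \<psi>"
      by (auto simp: fun_eq_iff PiE_def extensional_def restrict_def unlabeled_def override_on_def)
    show "(\<lambda>\<psi>. restrict \<psi> ?U) ` ?A \<subseteq> ?B"
    proof (rule image_subsetI)
      fix \<psi> assume \<psi>: "\<psi> \<in> ?A"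
      then have "?hom \<psi>" using hom by simp
      then have "?hom (?o (restrict \<psi> ?U))" using cong[of \<psi> "?o (restrict \<psi> ?U)"] o_eq[OF \<psi>] by auto
      moreover have "restrict \<psi> ?U \<in> ?U \<rightarrow>\<^sub>E ?V" using \<psi> by (auto simp: unlabeled_def)
      ultimately show "restrict \<psi> ?U \<in> ?B" by simp
    qed
    show "(\<lambda>\<psi>. restrict (?o \<psi>) (verts H)) ` ?B \<subseteq> ?A"
    proof (rule image_subsetI)
      fix \<psi> assume \<psi>: "\<psi> \<in> ?B"
      let ?r = "restrict (?o \<psi>) (verts H)"
      have "?hom ?r" using \<psi> cong[of ?r "?o \<psi>"] by auto
      moreover have "?o \<psi> v \<in> ?V" if "v \<in> verts H" for v
        using that \<psi> assms(3) by (cases "lab H v") (auto simp: override_on_def unlabeled_def label_ext_def)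
      then have "?r \<in> verts H \<rightarrow>\<^sub>E ?V" by auto
      moreover have "\<forall>v\<in>verts H. \<forall>l. lab H v = Some l \<longrightarrow> ?r v = \<phi> l"
        by (auto simp: override_on_def unlabeled_def label_ext_def)
      ultimately show "?r \<in> ?A" using hom by simp
    qed
  qed
  then have "card ?A = card ?B" by (rule bij_betw_same_card)
  then show ?thesis
    unfolding tdens_def wdens_def is_hom_def[abs_def] wavg_count[OF fin(2,1)]
    by (simp add: unlabeled_def power_one_over)
qed

lemma tcomb_eq_wcomb:
  assumes "inA {} f" "wfgraph G"
  shows "tcomb f G \<phi> = wcomb (gverts G) (\<lambda>_. 1 / real (card (gverts G))) (\<lambda>x y. {x, y} \<in> gedges G) \<phi> f"
  unfolding tcomb_def wcomb_def
proof (intro sum.cong refl arg_cong2[where f = "(*)"] tdens_eq_wdens assms(2))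
  fix H v l assume "H \<in> supp f" "lab H v = Some l"
  moreover from this have "wfpg H" "labels H = {}" using assms(1) by (auto simp: inA_def is_comb_def)
  ultimately show "\<phi> l \<in> gverts G" by (auto simp: labels_def wfpg_def)
qed (use assms in \<open>auto simp: inA_def is_comb_def\<close>)

section \<open>Mixtures of two cliques and a fixed graph\<close>

text \<open>Polynomials are kept as functions closed under ring operations. Only slices in one
  variable are turned into actual polynomials, where roots are finite in number and continuity is
  available.\<close>

inductive poly3 :: "(real \<Rightarrow> real \<Rightarrow> real \<Rightarrow> real) \<Rightarrow> bool" where
  const: "poly3 (\<lambda>u v e. c)"
| var1: "poly3 (\<lambda>u v e. u)"
| var2: "poly3 (\<lambda>u v e. v)"
| var3: "poly3 (\<lambda>u v e. e)"
| add: "poly3 P \<Longrightarrow> poly3 Q \<Longrightarrow> poly3 (\<lambda>u v e. P u v e + Q u v e)"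
| mult: "poly3 P \<Longrightarrow> poly3 Q \<Longrightarrow> poly3 (\<lambda>u v e. P u v e * Q u v e)"

lemma poly3_diff: "poly3 P \<Longrightarrow> poly3 Q \<Longrightarrow> poly3 (\<lambda>u v e. P u v e - Q u v e)"
  using poly3.add[of P "\<lambda>u v e. (- 1) * Q u v e"] poly3.mult[OF poly3.const, of Q "- 1"] by simp

lemma poly3_sum: "(\<And>k. k \<in> K \<Longrightarrow> poly3 (P k)) \<Longrightarrow> poly3 (\<lambda>u v e. \<Sum>k\<in>K. P k u v e)"
  by (induction K rule: infinite_finite_induct) (auto intro: poly3.intros)

lemma poly3_slice1: "poly3 Q \<Longrightarrow> \<exists>p. \<forall>u. poly p u = Q u v e"
proof (induction rule: poly3.induct)
  case (const c)
  then show ?case by (intro exI[of _ "[:c:]"]) simp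
next
  case var1
  then show ?case by (intro exI[of _ "[:0, 1:]"]) simp
next
  case var2
  then show ?case by (intro exI[of _ "[:v:]"]) simp
next
  case var3
  then show ?case by (intro exI[of _ "[:e:]"]) simp
next
  case (add P Q)
  then show ?case by (metis poly_add)
next
  case (mult P Q)
  then show ?case by (metis poly_mult)
qed

lemma poly3_slice2: "poly3 Q \<Longrightarrow> \<exists>p. \<forall>v. poly p v = Q u v e"
proof (induction rule: poly3.induct)
  case (const c)
  then show ?case by (intro exI[of _ "[:c:]"]) simp
next
  case var1
  then show ?case by (intro exI[of _ "[:u:]"]) simp
next
  case var2
  then show ?case by (intro exI[of _ "[:0, 1:]"]) simp
next
  case var3
  then show ?case by (intro exI[of _ "[:e:]"]) simp
next
  case (add P Q)
  then show ?case by (metis poly_add)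
next
  case (mult P Q)
  then show ?case by (metis poly_mult)
qed

lemma poly3_slice3: "poly3 Q \<Longrightarrow> \<exists>p. \<forall>e. poly p e = Q u v e"
proof (induction rule: poly3.induct)
  case (const c)
  then show ?case by (intro exI[of _ "[:c:]"]) simp
next
  case var1
  then show ?case by (intro exI[of _ "[:u:]"]) simp
next
  case var2
  then show ?case by (intro exI[of _ "[:v:]"]) simp
next
  case var3
  then show ?case by (intro exI[of _ "[:0, 1:]"]) simp
next
  case (add P Q)
  then show ?case by (metis poly_add)
next
  case (mult P Q)
  then show ?case by (metis poly_mult)
qed

lemma poly_eq_0_if_harmonic_roots:
  fixes p :: "real poly"
  assumes "\<forall>a\<ge>n. poly p (1 / real a) = 0"
  shows "p = 0"
proof (rule ccontr)
  assume "p \<noteq> 0"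
  then have fin: "finite {x. poly p x = 0}" by (rule poly_roots_finite)
  have "inj_on (\<lambda>a. 1 / real a) {Suc n..}"
    by (auto simp: inj_on_def)
  moreover have "(\<lambda>a. 1 / real a) ` {Suc n..} \<subseteq> {x. poly p x = 0}"
    using assms by auto
  ultimately have "finite {Suc n..}"
    using fin finite_imageD finite_subset by blast
  then show False by (simp add: infinite_Ici)
qed

text \<open>Reciprocals of large integers are infinitely many roots, used in \<open>u\<close> for
  each v = 1 / b and then in \<open>v\<close>. The proportion \<open>e\<close> stays fixed, so
  identities at e = 0 or e = 1 alone can be extended too.\<close>

lemma poly3_eq_0_if_grid:
  assumes "poly3 Q" "\<forall>a\<ge>n. \<forall>b\<ge>n. Q (1 / real a) (1 / real b) e = 0"
  shows "Q u v e = 0"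
proof -
  have "Q u (1 / real b) e = 0" if "b \<ge> n" for b
  proof -
    obtain p where p: "\<forall>u. poly p u = Q u (1 / real b) e"
      using poly3_slice1[OF assms(1)] by blast
    then have "p = 0"
      using assms(2) that by (intro poly_eq_0_if_harmonic_roots[of n]) auto
    then show ?thesis using p by (metis poly_0)
  qed
  moreover obtain p where p: "\<forall>v. poly p v = Q u v e"
    using poly3_slice2[OF assms(1)] by blast
  ultimately have "p = 0"
    by (intro poly_eq_0_if_harmonic_roots[of n]) auto
  then show ?thesis using p by (metis poly_0)
qed

definition pt_swap :: "nat \<Rightarrow> nat \<Rightarrow> nat \<Rightarrow> nat \<times> nat \<Rightarrow> nat \<times> nat" where
  "pt_swap s c c' p = (if p = (s, c) then (s, c') else if p = (s, c') then (s, c) else p)"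

lemma pt_swap_involutory: "pt_swap s c c' (pt_swap s c c' p) = p"
  by (auto simp: pt_swap_def)

lemma sum_fresh:
  fixes g :: "nat \<Rightarrow> real"
  assumes "finite C" "\<forall>c\<in>C. c < a" "\<And>c. c < a \<Longrightarrow> c \<notin> C \<Longrightarrow> g c = g f"
  shows "(\<Sum>c<a. g c) = (\<Sum>c\<in>C. g c) + (real a - real (card C)) * g f"
proof -
  have "(\<Sum>c<a. g c) = (\<Sum>c\<in>C. g c) + (\<Sum>c\<in>{..<a} - C. g c)"
    using assms(1,2) by (subst sum.subset_diff[of C]) auto
  also have "(\<Sum>c\<in>{..<a} - C. g c) = (\<Sum>c\<in>{..<a} - C. g f)"
    using assms(3) by (intro sum.cong) auto
  also have "\<dots> = (real a - real (card C)) * g f"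
    using assms(1,2) card_mono[of "{..<a}" C] by (simp add: card_Diff_subset of_nat_diff subset_eq)
  finally show ?thesis .
qed

lemma finite_labels_comb: "is_comb f \<Longrightarrow> finite (\<Union>H\<in>supp f. labels H)"
  by (auto simp: is_comb_def finite_labels)

section \<open>The weighted mixture and functions that are polynomial in its parameters\<close>

locale mixture =
  fixes V0 :: "nat set" and E0 :: "nat \<Rightarrow> nat \<Rightarrow> bool"
  assumes finite_V0: "finite V0" and V0_nonempty: "V0 \<noteq> {}"
begin

definition mixV :: "nat \<Rightarrow> nat \<Rightarrow> (nat \<times> nat) set" where
  "mixV a b = {0} \<times> {..<a} \<union> {1} \<times> {..<b} \<union> {2} \<times> V0"

text \<open>The proportion \<open>e\<close> of the fixed graph may be any real number, so weights
  can be negative: identities are stated for all \<open>e\<close>, and only nonnegativity is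
  restricted to [0, 1].\<close>

definition mixw :: "nat \<Rightarrow> nat \<Rightarrow> real \<Rightarrow> nat \<times> nat \<Rightarrow> real" where
  "mixw a b e p = (if fst p = 0 then (1 - e) / 2 * (1 / real a)
     else if fst p = 1 then (1 - e) / 2 * (1 / real b) else e / real (card V0))"

definition mixE :: "nat \<times> nat \<Rightarrow> nat \<times> nat \<Rightarrow> bool" where
  "mixE p q \<longleftrightarrow> fst p = fst q \<and> (if fst p < 2 then snd p \<noteq> snd q else E0 (snd p) (snd q))"

lemma sum_mixV:
  "(\<Sum>p\<in>mixV a b. f p) = (\<Sum>c<a. f (0, c)) + (\<Sum>c<b. f (1, c)) + (\<Sum>x\<in>V0. f (2, x))"
  for f :: "nat \<times> nat \<Rightarrow> real"
proof -
  have im: "(\<Sum>p\<in>{s} \<times> A. f p) = (\<Sum>c\<in>A. f (s, c))" for s :: nat and A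
  proof -
    have "{s} \<times> A = Pair s ` A" by auto
    then show ?thesis by (simp add: sum.reindex inj_on_def)
  qed
  have "(\<Sum>p\<in>mixV a b. f p) = (\<Sum>p\<in>{0} \<times> {..<a}. f p) + (\<Sum>p\<in>{1} \<times> {..<b}. f p) + (\<Sum>p\<in>{2} \<times> V0. f p)"
    unfolding mixV_def by (subst sum.union_disjoint; (subst sum.union_disjoint)?) (auto simp: finite_V0)
  then show ?thesis by (simp only: im)
qed

lemma sum_mixw: "a \<ge> 1 \<Longrightarrow> b \<ge> 1 \<Longrightarrow> sum (mixw a b e) (mixV a b) = 1"
  using finite_V0 V0_nonempty by (simp add: sum_mixV mixw_def field_simps)

text \<open>The condition on \<open>pt_swap\<close> is what makes this class of functions closed under averaging. The
  predicate \<open>R\<close> is the region of real parameters on which nonnegativity is tracked.\<close>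

definition regular :: "(real \<Rightarrow> real \<Rightarrow> real \<Rightarrow> bool) \<Rightarrow> nat set \<Rightarrow>
    (nat \<Rightarrow> nat \<Rightarrow> real \<Rightarrow> (nat \<Rightarrow> nat \<times> nat) \<Rightarrow> real) \<Rightarrow> bool" where
  "regular R J F \<longleftrightarrow>
     (\<forall>a b e \<xi> \<xi>'. (\<forall>i\<in>J. \<xi>' i = \<xi> i) \<longrightarrow> F a b e \<xi>' = F a b e \<xi>) \<and>
     (\<forall>a b e \<xi> s c c'. (s, c) \<in> mixV a b \<longrightarrow> (s, c') \<in> mixV a b \<longrightarrow> s < 2 \<longrightarrow>
        F a b e (pt_swap s c c' \<circ> \<xi>) = F a b e \<xi>) \<and>
     (\<forall>\<xi>. \<exists>Q n. poly3 Q \<and> (\<forall>u v e. R u v e \<longrightarrow> 0 \<le> Q u v e) \<and>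
        (\<forall>a\<ge>n. \<forall>b\<ge>n. \<forall>e. F a b e \<xi> = Q (1 / real a) (1 / real b) e))"

lemma regularI:
  assumes "\<And>a b e \<xi> \<xi>'. \<forall>i\<in>J. \<xi>' i = \<xi> i \<Longrightarrow> F a b e \<xi>' = F a b e \<xi>"
    and "\<And>a b e \<xi> s c c'. (s, c) \<in> mixV a b \<Longrightarrow> (s, c') \<in> mixV a b \<Longrightarrow> s < 2 \<Longrightarrow>
        F a b e (pt_swap s c c' \<circ> \<xi>) = F a b e \<xi>"
    and "\<And>\<xi>. \<exists>Q n. poly3 Q \<and> (\<forall>u v e. R u v e \<longrightarrow> 0 \<le> Q u v e) \<and>
        (\<forall>a\<ge>n. \<forall>b\<ge>n. \<forall>e. F a b e \<xi> = Q (1 / real a) (1 / real b) e)"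
  shows "regular R J F"
  unfolding regular_def by (intro conjI allI impI) (erule assms(1), erule (2) assms(2), rule assms(3))

lemma regular_dep:
  assumes "regular R J F" "\<forall>i\<in>J. \<xi>' i = \<xi> i"
  shows "F a b e \<xi>' = F a b e \<xi>"
  using conjunct1[OF assms(1)[unfolded regular_def]] assms(2) by simp

lemma regular_swap:
  assumes "regular R J F" "(s, c) \<in> mixV a b" "(s, c') \<in> mixV a b" "s < 2"
  shows "F a b e (pt_swap s c c' \<circ> \<xi>) = F a b e \<xi>"
  using conjunct1[OF conjunct2[OF assms(1)[unfolded regular_def]]] assms(2-4) by simp

lemma regular_poly:
  assumes "regular R J F"
  obtains Q n where "poly3 Q" "\<And>u v e. R u v e \<Longrightarrow> 0 \<le> Q u v e"
    "\<And>a b e. a \<ge> n \<Longrightarrow> b \<ge> n \<Longrightarrow> F a b e \<xi> = Q (1 / real a) (1 / real b) e"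
proof -
  obtain Q n where "poly3 Q" "\<forall>u v e. R u v e \<longrightarrow> 0 \<le> Q u v e"
      "\<forall>a\<ge>n. \<forall>b\<ge>n. \<forall>e. F a b e \<xi> = Q (1 / real a) (1 / real b) e"
    using spec[OF conjunct2[OF conjunct2[OF assms[unfolded regular_def]]], of \<xi>] by (elim exE conjE)
  then show thesis by (intro that[of Q n]) simp_all
qed

lemma regular_mono: "regular R J F \<Longrightarrow> J \<subseteq> J' \<Longrightarrow> regular R J' F"
  by (rule regularI, erule regular_dep, blast, erule (3) regular_swap)
    (metis regular_poly)

lemma regular_mult:
  assumes "regular (\<lambda>_ _ _. False) J F" "regular (\<lambda>_ _ _. False) J G"
  shows "regular (\<lambda>_ _ _. False) J (\<lambda>a b e \<xi>. F a b e \<xi> * G a b e \<xi>)"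
proof (rule regularI, goal_cases)
  case 1
  show ?case by (simp only: regular_dep[OF assms(1) 1] regular_dep[OF assms(2) 1])
next
  case 2
  show ?case by (simp only: regular_swap[OF assms(1) 2] regular_swap[OF assms(2) 2])
next
  case (3 \<xi>)
  obtain P m where P: "poly3 P" "\<And>a b e. a \<ge> m \<Longrightarrow> b \<ge> m \<Longrightarrow> F a b e \<xi> = P (1 / real a) (1 / real b) e"
    using regular_poly[OF assms(1)] by metis
  obtain Q n where Q: "poly3 Q" "\<And>a b e. a \<ge> n \<Longrightarrow> b \<ge> n \<Longrightarrow> G a b e \<xi> = Q (1 / real a) (1 / real b) e"
    using regular_poly[OF assms(2)] by metis
  show ?case
    by (rule exI[of _ "\<lambda>u v e. P u v e * Q u v e"], rule exI[of _ "max m n"])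
       (use P Q in \<open>auto intro: poly3.mult\<close>)
qed

text \<open>The source of nonnegativity for sums of squares. With the empty region the hypothesis
  asserts no sign, and the square of the representing polynomial is nonnegative on any
  region.\<close>

lemma regular_square:
  assumes "regular (\<lambda>_ _ _. False) J F"
  shows "regular R J (\<lambda>a b e \<xi>. F a b e \<xi> * F a b e \<xi>)"
proof (rule regularI, goal_cases)
  case 1
  show ?case by (simp only: regular_dep[OF assms 1])
next
  case 2
  show ?case by (simp only: regular_swap[OF assms 2])
next
  case (3 \<xi>)
  obtain P m where P: "poly3 P" "\<And>a b e. a \<ge> m \<Longrightarrow> b \<ge> m \<Longrightarrow> F a b e \<xi> = P (1 / real a) (1 / real b) e"
    using regular_poly[OF assms(1)] by metis
  show ?case
    by (rule exI[of _ "\<lambda>u v e. P u v e * P u v e"], rule exI[of _ m]) (use P in \<open>auto intro: poly3.mult\<close>)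
qed

lemma regular_zero: "regular R J (\<lambda>a b e \<xi>. 0)"
  by (rule regularI) (auto intro!: exI[of _ "\<lambda>_ _ _. 0"] poly3.const)

lemma regular_const: "regular (\<lambda>_ _ _. False) J (\<lambda>a b e \<xi>. c)"
  by (rule regularI) (auto intro!: exI[of _ "\<lambda>_ _ _. c"] poly3.const)

lemma regular_add:
  assumes "regular R J F" "regular R J G"
  shows "regular R J (\<lambda>a b e \<xi>. F a b e \<xi> + G a b e \<xi>)"
proof (rule regularI, goal_cases)
  case 1
  show ?case by (simp only: regular_dep[OF assms(1) 1] regular_dep[OF assms(2) 1])
next
  case 2
  show ?case by (simp only: regular_swap[OF assms(1) 2] regular_swap[OF assms(2) 2])
next
  case (3 \<xi>)
  obtain P m where P: "poly3 P" "\<And>u v e. R u v e \<Longrightarrow> 0 \<le> P u v e"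
      "\<And>a b e. a \<ge> m \<Longrightarrow> b \<ge> m \<Longrightarrow> F a b e \<xi> = P (1 / real a) (1 / real b) e"
    using regular_poly[OF assms(1)] by metis
  obtain Q n where Q: "poly3 Q" "\<And>u v e. R u v e \<Longrightarrow> 0 \<le> Q u v e"
      "\<And>a b e. a \<ge> n \<Longrightarrow> b \<ge> n \<Longrightarrow> G a b e \<xi> = Q (1 / real a) (1 / real b) e"
    using regular_poly[OF assms(2)] by metis
  show ?case
    by (rule exI[of _ "\<lambda>u v e. P u v e + Q u v e"], rule exI[of _ "max m n"])
       (use P Q in \<open>auto intro: poly3.add\<close>)
qed

lemma regular_sum:
  "finite K \<Longrightarrow> (\<And>k. k \<in> K \<Longrightarrow> regular R J (F k)) \<Longrightarrow> regular R J (\<lambda>a b e \<xi>. \<Sum>k\<in>K. F k a b e \<xi>)"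
  by (induction K rule: finite_induct) (auto intro: regular_zero regular_add)

lemma regular_sum_list:
  "(\<And>k. k \<in> set ks \<Longrightarrow> regular R J (F k)) \<Longrightarrow> regular R J (\<lambda>a b e \<xi>. \<Sum>k\<leftarrow>ks. F k a b e \<xi>)"
  by (induction ks) (auto intro: regular_zero regular_add)

lemma pt_swap_mixV:
  assumes "(s, c) \<in> mixV a b" "(s, c') \<in> mixV a b"
  shows "bij_betw (pt_swap s c c') (mixV a b) (mixV a b)"
  by (rule bij_betw_byWitness[where f' = "pt_swap s c c'"])
     (use assms in \<open>auto simp: pt_swap_involutory pt_swap_def\<close>)

lemma mixw_pt_swap: "mixw a b e (pt_swap s c c' p) = mixw a b e p"
  by (auto simp: mixw_def pt_swap_def)

text \<open>Averaging over one more point splits each clique into the classes already hit and the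
  unused ones; the latter are interchangeable, and their number is the clique size minus a
  constant. This is what makes the average polynomial in the reciprocals of the clique sizes.\<close>

lemma regular_average1:
  assumes reg: "regular R (insert i J) F" and "finite J" "i \<notin> J"
    and R: "\<And>u v e. R u v e \<Longrightarrow> 0 \<le> u \<and> real (card J) * u \<le> 1 \<and> 0 \<le> v \<and> real (card J) * v \<le> 1 \<and> 0 \<le> e \<and> e \<le> 1"
  shows "regular R J (\<lambda>a b e \<xi>. \<Sum>p\<in>mixV a b. mixw a b e p * F a b e (\<xi>(i := p)))"
proof (rule regularI)
  fix a b e and \<xi> \<xi>' :: "nat \<Rightarrow> nat \<times> nat"
  assume "\<forall>i\<in>J. \<xi>' i = \<xi> i"
  then have "F a b e (\<xi>'(i := p)) = F a b e (\<xi>(i := p))" for p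
    by (intro regular_dep[OF reg]) auto
  then show "(\<Sum>p\<in>mixV a b. mixw a b e p * F a b e (\<xi>'(i := p))) = (\<Sum>p\<in>mixV a b. mixw a b e p * F a b e (\<xi>(i := p)))"
    by simp
next
  fix a b e s c c' and \<xi> :: "nat \<Rightarrow> nat \<times> nat"
  assume sc: "(s, c) \<in> mixV a b" "(s, c') \<in> mixV a b" "s < 2"
  let ?\<tau> = "pt_swap s c c'"
  have "(\<Sum>p\<in>mixV a b. mixw a b e p * F a b e ((?\<tau> \<circ> \<xi>)(i := p)))
      = (\<Sum>p\<in>mixV a b. mixw a b e (?\<tau> p) * F a b e ((?\<tau> \<circ> \<xi>)(i := ?\<tau> p)))"
    by (rule sum.reindex_bij_betw[OF pt_swap_mixV[OF sc(1,2)], symmetric])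
  also have "\<dots> = (\<Sum>p\<in>mixV a b. mixw a b e p * F a b e (?\<tau> \<circ> \<xi>(i := p)))"
    by (simp add: mixw_pt_swap fun_upd_comp)
  also have "\<dots> = (\<Sum>p\<in>mixV a b. mixw a b e p * F a b e (\<xi>(i := p)))"
    by (simp add: regular_swap[OF reg sc])
  finally show "(\<Sum>p\<in>mixV a b. mixw a b e p * F a b e ((?\<tau> \<circ> \<xi>)(i := p)))
      = (\<Sum>p\<in>mixV a b. mixw a b e p * F a b e (\<xi>(i := p)))" .
next
  fix \<xi> :: "nat \<Rightarrow> nat \<times> nat"
  define C where "C s = snd ` {p \<in> \<xi> ` J. fst p = s}" for s
  have finC: "finite (C s)" for s
    unfolding C_def using assms(2) by simp
  have inC: "c \<in> C s" if "j \<in> J" "\<xi> j = (s, c)" for s c j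
    unfolding C_def using that imageI[of j J \<xi>] by (intro image_eqI[of _ _ "\<xi> j"]) auto
  have cardC: "card (C s) \<le> card J" for s
  proof -
    have "C s \<subseteq> snd ` \<xi> ` J" by (auto simp: C_def)
    then have "card (C s) \<le> card (snd ` \<xi> ` J)" using assms(2) by (intro card_mono) auto
    also have "\<dots> \<le> card J" using assms(2) by (metis card_image_le finite_imageI order_trans)
    finally show ?thesis .
  qed
  have "\<exists>f. f \<notin> C s" for s
    using finC ex_new_if_finite[OF infinite_UNIV_nat] by blast
  then obtain f where f: "\<And>s. f s \<notin> C s" by metis
  \<comment> \<open>The transposition of \<open>c\<close> and the fresh position fixes every point
    at a coordinate in \<open>J\<close>, since neither position is occupied there.\<close>
  have swap: "F a b e (\<xi>(i := (s, c))) = F a b e (\<xi>(i := (s, f s)))"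
    if "(s, c) \<in> mixV a b" "(s, f s) \<in> mixV a b" "s < 2" "c \<notin> C s" for a b e s c
  proof -
    have "F a b e (\<xi>(i := (s, c))) = F a b e (pt_swap s c (f s) \<circ> \<xi>(i := (s, c)))"
      using regular_swap[OF reg that(1-3)] by simp
    also have "\<dots> = F a b e (\<xi>(i := (s, f s)))"
    proof (rule regular_dep[OF reg], rule ballI)
      fix j assume j: "j \<in> insert i J"
      show "(pt_swap s c (f s) \<circ> \<xi>(i := (s, c))) j = (\<xi>(i := (s, f s))) j"
      proof (cases "j = i")
        case False
        then have "j \<in> J" using j by simp
        then have "\<xi> j \<noteq> (s, c)" "\<xi> j \<noteq> (s, f s)"
          using that(4) f[of s] inC by auto
        then show ?thesis using False by (simp add: pt_swap_def)
      qed (simp add: pt_swap_def)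
    qed
    finally show ?thesis .
  qed
  have "\<forall>p. \<exists>Q n. poly3 Q \<and> (\<forall>u v e. R u v e \<longrightarrow> 0 \<le> Q u v e) \<and>
      (\<forall>a b e. a \<ge> n \<longrightarrow> b \<ge> n \<longrightarrow> F a b e (\<xi>(i := p)) = Q (1 / real a) (1 / real b) e)"
    using regular_poly[OF reg] by metis
  then obtain Q n where Q: "\<And>p. poly3 (Q p)" "\<And>p u v e. R u v e \<Longrightarrow> 0 \<le> Q p u v e"
      "\<And>p a b e. a \<ge> n p \<Longrightarrow> b \<ge> n p \<Longrightarrow> F a b e (\<xi>(i := p)) = Q p (1 / real a) (1 / real b) e"
    by metis
  \<comment> \<open>The factors 1 - card (C s) * u and its analogue in v are falling-factorial
    factors divided by the size. They are nonnegative for real sizes at least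
    \<open>card J\<close>.\<close>
  define P where "P = (\<lambda>u v e. (1 - e) / 2 * ((\<Sum>c\<in>C 0. u * Q (0, c) u v e) + (1 - real (card (C 0)) * u) * Q (0, f 0) u v e)
      + (1 - e) / 2 * ((\<Sum>c\<in>C 1. v * Q (1, c) u v e) + (1 - real (card (C 1)) * v) * Q (1, f 1) u v e)
      + e * (1 / real (card V0)) * (\<Sum>x\<in>V0. Q (2, x) u v e))"
  define X where "X = {0 :: nat} \<times> insert (f 0) (C 0) \<union> {1} \<times> insert (f 1) (C 1) \<union> {2} \<times> V0"
  have finX: "finite X" using finC finite_V0 by (simp add: X_def)
  \<comment> \<open>Sizes from \<open>m\<close> on lie beyond the thresholds of all polynomials
    involved, and both cliques then contain the occupied positions and the fresh ones.\<close>
  define m where "m = Max (insert 1 (n ` X)) + Suc (Max (insert (f 0) (C 0))) + Suc (Max (insert (f 1) (C 1)))"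
  have mX: "n p \<le> m" if "p \<in> X" for p
  proof -
    have "n p \<le> Max (insert 1 (n ` X))" using that finX by (intro Max_ge) auto
    then show ?thesis by (simp add: m_def)
  qed
  have mC: "c < m" if "c \<in> insert (f 0) (C 0) \<union> insert (f 1) (C 1)" for c
  proof -
    have "c \<le> Max (insert (f 0) (C 0)) \<or> c \<le> Max (insert (f 1) (C 1))"
      using that Max_ge[of "insert (f 0) (C 0)" c] Max_ge[of "insert (f 1) (C 1)" c] finC by auto
    then show ?thesis by (auto simp: m_def)
  qed
  have m1: "m \<ge> 1" by (simp add: m_def)
  have "poly3 P"
    unfolding P_def divide_inverse by (intro poly3.add poly3.mult poly3_sum poly3_diff poly3.intros(1-4) Q(1))
  moreover have "0 \<le> P u v e" if r: "R u v e" for u v e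
  proof -
    have "real (card (C s)) * x \<le> 1" if "0 \<le> x" "real (card J) * x \<le> 1" for s x
      using mult_right_mono[of "real (card (C s))" "real (card J)" x] cardC[of s] that by simp
    then show ?thesis
      unfolding P_def using R[OF r] Q(2)[OF r] by (intro add_nonneg_nonneg mult_nonneg_nonneg sum_nonneg) auto
  qed
  moreover have "(\<Sum>p\<in>mixV a b. mixw a b e p * F a b e (\<xi>(i := p))) = P (1 / real a) (1 / real b) e"
    if ab: "a \<ge> m" "b \<ge> m" for a b e
  proof -
    let ?u = "1 / real a" and ?v = "1 / real b"
    have eq: "F a b e (\<xi>(i := p)) = Q p ?u ?v e" if "p \<in> X" for p
      using Q(3) mX[OF that] ab by simp
    have s0: "(\<Sum>c<a. F a b e (\<xi>(i := (0, c)))) =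
        (\<Sum>c\<in>C 0. F a b e (\<xi>(i := (0, c)))) + (real a - real (card (C 0))) * F a b e (\<xi>(i := (0, f 0)))"
      using ab mC by (intro sum_fresh finC swap) (auto simp: mixV_def intro: less_le_trans)
    have s1: "(\<Sum>c<b. F a b e (\<xi>(i := (1, c)))) =
        (\<Sum>c\<in>C 1. F a b e (\<xi>(i := (1, c)))) + (real b - real (card (C 1))) * F a b e (\<xi>(i := (1, f 1)))"
      using ab mC by (intro sum_fresh finC swap) (auto simp: mixV_def intro: less_le_trans)
    have q0: "(\<Sum>c\<in>C 0. F a b e (\<xi>(i := (0, c)))) = (\<Sum>c\<in>C 0. Q (0, c) ?u ?v e)"
      by (intro sum.cong eq refl) (auto simp: X_def)
    have q1: "(\<Sum>c\<in>C 1. F a b e (\<xi>(i := (1, c)))) = (\<Sum>c\<in>C 1. Q (1, c) ?u ?v e)"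
      by (intro sum.cong eq refl) (auto simp: X_def)
    have q2: "(\<Sum>x\<in>V0. F a b e (\<xi>(i := (2, x)))) = (\<Sum>x\<in>V0. Q (2, x) ?u ?v e)"
      by (intro sum.cong eq refl) (auto simp: X_def)
    have q: "F a b e (\<xi>(i := (0, f 0))) = Q (0, f 0) ?u ?v e" "F a b e (\<xi>(i := (1, f 1))) = Q (1, f 1) ?u ?v e"
      by (intro eq; simp add: X_def)+
    have pos: "real a \<noteq> 0" "real b \<noteq> 0" using ab m1 by auto
    have "(\<Sum>p\<in>mixV a b. mixw a b e p * F a b e (\<xi>(i := p))) =
        (1 - e) / 2 * (?u * (\<Sum>c<a. F a b e (\<xi>(i := (0, c))))) + (1 - e) / 2 * (?v * (\<Sum>c<b. F a b e (\<xi>(i := (1, c)))))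
        + e * (1 / real (card V0)) * (\<Sum>x\<in>V0. F a b e (\<xi>(i := (2, x))))"
      by (simp add: sum_mixV mixw_def sum_distrib_left mult.assoc)
    also have "\<dots> = P ?u ?v e"
      unfolding s0 s1 q0 q1 q2 q P_def sum_distrib_left[symmetric] using pos by (simp add: field_simps)
    finally show ?thesis .
  qed
  ultimately show "\<exists>Q n. poly3 Q \<and> (\<forall>u v e. R u v e \<longrightarrow> 0 \<le> Q u v e) \<and>
      (\<forall>a\<ge>n. \<forall>b\<ge>n. \<forall>e. (\<Sum>p\<in>mixV a b. mixw a b e p * F a b e (\<xi>(i := p))) = Q (1 / real a) (1 / real b) e)"
    by blast
qed

text \<open>At every stage of the iteration at most \<open>card (I \<union> J)\<close> points are
  fixed, so one bound on \<open>u\<close> and \<open>v\<close> serves all stages.\<close>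

lemma regular_wavg:
  assumes "finite I" "finite J" "I \<inter> J = {}" "regular R (I \<union> J) F"
    and R: "\<And>u v e. R u v e \<Longrightarrow> 0 \<le> u \<and> real (card (I \<union> J)) * u \<le> 1 \<and> 0 \<le> v \<and> real (card (I \<union> J)) * v \<le> 1 \<and> 0 \<le> e \<and> e \<le> 1"
  shows "regular R J (\<lambda>a b e \<xi>. wavg (mixV a b) (mixw a b e) I (F a b e) \<xi>)"
  using assms
proof (induction I arbitrary: J)
  case empty
  then show ?case by simp
next
  case (insert i I)
  have "regular R (insert i J) (\<lambda>a b e \<xi>. wavg (mixV a b) (mixw a b e) I (F a b e) \<xi>)"
    using insert.prems insert.hyps by (intro insert.IH) (auto simp: insert_commute)
  then have "regular R J (\<lambda>a b e \<xi>. \<Sum>p\<in>mixV a b. mixw a b e p * wavg (mixV a b) (mixw a b e) I (F a b e) (\<xi>(i := p)))"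
  proof (rule regular_average1)
    fix u v e assume r: "R u v e"
    have "card J \<le> card (insert i I \<union> J)"
      using insert.prems(1) insert.hyps(1) by (intro card_mono) auto
    then have "real (card J) * x \<le> real (card (insert i I \<union> J)) * x" if "0 \<le> x" for x
      using that by (intro mult_right_mono) auto
    then show "0 \<le> u \<and> real (card J) * u \<le> 1 \<and> 0 \<le> v \<and> real (card J) * v \<le> 1 \<and> 0 \<le> e \<and> e \<le> 1"
      using insert.prems(4)[OF r] by (meson order_trans)
  qed (use insert.prems in auto)
  then show ?case
    by (simp add: wavg_insert[OF insert.hyps])
qed

lemma regular_is_hom:
  assumes "wfpg H"
  shows "regular R (verts H) (\<lambda>a b e \<xi>. is_hom mixE H \<xi>)"
proof (rule regularI)
  fix s c c' :: nat and \<xi> :: "nat \<Rightarrow> nat \<times> nat"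
  assume "s < 2"
  then have "mixE (pt_swap s c c' p) (pt_swap s c c' q) \<longleftrightarrow> mixE p q" for p q
    by (cases p; cases q) (auto simp: mixE_def pt_swap_def)
  then show "is_hom mixE H (pt_swap s c c' \<circ> \<xi>) = is_hom mixE H \<xi>"
    by (simp add: is_hom_def)
next
  fix \<xi> :: "nat \<Rightarrow> nat \<times> nat"
  show "\<exists>Q n. poly3 Q \<and> (\<forall>u v e. R u v e \<longrightarrow> 0 \<le> Q u v e) \<and>
      (\<forall>a\<ge>n. \<forall>b\<ge>n. \<forall>e::real. is_hom mixE H \<xi> = Q (1 / real a) (1 / real b) e)"
    by (rule exI[of _ "\<lambda>_ _ _. is_hom mixE H \<xi>"]) (auto intro: poly3.const simp: is_hom_def)
qed (use is_hom_cong[OF assms] in auto)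

abbreviation mixdens :: "nat \<Rightarrow> nat \<Rightarrow> real \<Rightarrow> (nat \<Rightarrow> nat \<times> nat) \<Rightarrow> pgraph \<Rightarrow> real" where
  "mixdens a b e \<equiv> wdens (mixV a b) (mixw a b e) mixE"

abbreviation mixcomb :: "nat \<Rightarrow> nat \<Rightarrow> real \<Rightarrow> (nat \<Rightarrow> nat \<times> nat) \<Rightarrow> comb \<Rightarrow> real" where
  "mixcomb a b e \<equiv> wcomb (mixV a b) (mixw a b e) mixE"

lemma regular_mixdens:
  assumes "wfpg H"
  shows "regular (\<lambda>_ _ _. False) (labels H) (\<lambda>a b e \<phi>. mixdens a b e \<phi> H)"
proof -
  let ?B = "verts H - unlabeled H"
  let ?F = "\<lambda>a b e \<xi>. wavg (mixV a b) (mixw a b e) (unlabeled H) (is_hom mixE H) \<xi>"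
  have "unlabeled H \<union> ?B = verts H" by (auto simp: unlabeled_def)
  then have reg: "regular (\<lambda>_ _ _. False) ?B ?F"
    using assms regular_is_hom[OF assms]
    by (intro regular_wavg) (auto simp: finite_verts finite_unlabeled)
  show ?thesis
  proof (rule regularI)
    fix a b e and \<phi> \<phi>' :: "nat \<Rightarrow> nat \<times> nat"
    assume "\<forall>l\<in>labels H. \<phi>' l = \<phi> l"
    then show "mixdens a b e \<phi>' H = mixdens a b e \<phi> H" by (rule wdens_cong_labels[OF assms])
  next
    fix a b e s c c' and \<phi> :: "nat \<Rightarrow> nat \<times> nat"
    assume sc: "(s, c) \<in> mixV a b" "(s, c') \<in> mixV a b" "s < 2"
    have "mixdens a b e (pt_swap s c c' \<circ> \<phi>) H = ?F a b e (pt_swap s c c' \<circ> label_ext H \<phi>)"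
      by (rule wdens_cong_ext[OF assms]) (simp add: label_ext_def)
    also have "\<dots> = mixdens a b e \<phi> H"
      unfolding wdens_def by (rule regular_swap[OF reg sc])
    finally show "mixdens a b e (pt_swap s c c' \<circ> \<phi>) H = mixdens a b e \<phi> H" .
  next
    fix \<phi> :: "nat \<Rightarrow> nat \<times> nat"
    show "\<exists>Q n. poly3 Q \<and> (\<forall>u v e. False \<longrightarrow> 0 \<le> Q u v e) \<and>
      (\<forall>a\<ge>n. \<forall>b\<ge>n. \<forall>e. mixdens a b e \<phi> H = Q (1 / real a) (1 / real b) e)"
      unfolding wdens_def using regular_poly[OF reg, of "label_ext H \<phi>"] by metis
  qed
qed

lemma regular_mixcomb:
  assumes "is_comb f" "\<And>H. H \<in> supp f \<Longrightarrow> labels H \<subseteq> L"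
  shows "regular (\<lambda>_ _ _. False) L (\<lambda>a b e \<phi>. mixcomb a b e \<phi> f)"
  unfolding wcomb_def using assms
  by (intro regular_sum regular_mult regular_const regular_mono[OF regular_mixdens]) (auto simp: is_comb_def)

lemma mixcomb_poly:
  assumes "inA {} f"
  obtains Q n where "poly3 Q" "\<And>a b e. a \<ge> n \<Longrightarrow> b \<ge> n \<Longrightarrow> mixcomb a b e \<phi> f = Q (1 / real a) (1 / real b) e"
proof -
  have "regular (\<lambda>_ _ _. False) {} (\<lambda>a b e \<phi>. mixcomb a b e \<phi> f)"
    using assms by (intro regular_mixcomb) (auto simp: inA_def)
  then show thesis by (rule regular_poly) (rule that)
qed

text \<open>The bound \<open>N\<close> is the number of labels in the certificate: at each placement
  of the labels the integrand is a sum of squares, and averaging over at most \<open>N\<close>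
  points preserves nonnegativity for real sizes at least \<open>N\<close>.\<close>

lemma mixcomb_sos_poly:
  assumes "sos f" "inA {} f"
  obtains Q n and N :: nat where "poly3 Q"
    "\<And>a b e. a \<ge> n \<Longrightarrow> b \<ge> n \<Longrightarrow> mixcomb a b e \<phi> f = Q (1 / real a) (1 / real b) e"
    "\<And>u v e. 0 \<le> u \<Longrightarrow> real N * u \<le> 1 \<Longrightarrow> 0 \<le> v \<Longrightarrow> real N * v \<le> 1 \<Longrightarrow> 0 \<le> e \<Longrightarrow> e \<le> 1 \<Longrightarrow> 0 \<le> Q u v e"
proof -
  obtain gs where gs: "\<forall>g\<in>set gs. is_comb g" "aeq f (cunl {} (csum (map (\<lambda>g. cmul g g) gs)))"
    using assms(1) unfolding sos_def by (elim exE conjE)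
  let ?S = "csum (map (\<lambda>g. cmul g g) gs)"
  have S: "is_comb ?S" using gs(1) by (intro is_comb_csum) (auto intro: is_comb_cmul)
  define L where "L = (\<Union>H\<in>supp ?S. labels H) \<union> (\<Union>g\<in>set gs. \<Union>H\<in>supp g. labels H)"
  have finL: "finite L"
    unfolding L_def using S gs(1) finite_labels_comb by auto
  define R where "R = (\<lambda>u v e. 0 \<le> u \<and> real (card L) * u \<le> 1 \<and> 0 \<le> v \<and> real (card L) * v \<le> 1 \<and> 0 \<le> e \<and> e \<le> (1::real))"
  define F where "F = (\<lambda>a b e \<phi>. \<Sum>g\<leftarrow>gs. mixcomb a b e \<phi> g * mixcomb a b e \<phi> g)"
  have "regular R (L \<union> {}) F"
    unfolding F_def using gs(1) by (intro regular_sum_list regular_square regular_mixcomb) (auto simp: L_def)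
  then have reg: "regular R {} (\<lambda>a b e \<phi>. wavg (mixV a b) (mixw a b e) L (F a b e) \<phi>)"
    using finL by (intro regular_wavg) (auto simp: R_def)
  have eq: "mixcomb a b e \<phi> f = wavg (mixV a b) (mixw a b e) L (F a b e) \<phi>" if ab: "a \<ge> 1" "b \<ge> 1" for a b e
  proof -
    note one = sum_mixw[OF ab, of e]
    have "mixcomb a b e \<phi> f = mixcomb a b e \<phi> (cunl {} ?S)"
      using gs(2) assms(2) is_comb_cunl[OF S] one by (intro wcomb_aeq) (auto simp: inA_def is_comb_def)
    also have "\<dots> = wavg (mixV a b) (mixw a b e) L (\<lambda>\<phi>. mixcomb a b e \<phi> ?S) \<phi>"
      by (rule wcomb_cunl[OF S finL _ one]) (auto simp: L_def)
    also have "(\<lambda>\<phi>. mixcomb a b e \<phi> ?S) = F a b e"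
    proof
      fix \<phi>
      have "mixcomb a b e \<phi> ?S = (\<Sum>g\<leftarrow>map (\<lambda>g. cmul g g) gs. mixcomb a b e \<phi> g)"
        using gs(1) by (intro wcomb_csum) (auto intro: is_comb_cmul)
      also have "\<dots> = F a b e \<phi>"
        unfolding F_def map_map comp_def using gs(1)
        by (intro arg_cong[where f = sum_list] map_cong refl) (auto simp: wcomb_cmul)
      finally show "mixcomb a b e \<phi> ?S = F a b e \<phi>" .
    qed
    finally show ?thesis .
  qed
  obtain Q n where Q: "poly3 Q" "\<And>u v e. R u v e \<Longrightarrow> 0 \<le> Q u v e"
    "\<And>a b e. a \<ge> n \<Longrightarrow> b \<ge> n \<Longrightarrow> wavg (mixV a b) (mixw a b e) L (F a b e) \<phi> = Q (1 / real a) (1 / real b) e"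
    using regular_poly[OF reg] by metis
  show thesis
    \<comment> \<open>Sizes at least 1 make the total weight 1, as passing to the quotient
      requires.\<close>
    by (rule that[of Q "max 1 n" "card L"]) (use Q eq in \<open>auto simp: R_def\<close>)
qed

end

section \<open>Linear independence of densities\<close>

lemma aeq_refl: "aeq f f"
  using Krel.zero by (simp add: aeq_def cdiff_def czero_def)

lemma labels_empty_lab: "wfpg H \<Longrightarrow> labels H = {} \<Longrightarrow> lab H v = None"
  by (cases "lab H v") (auto simp: labels_def wfpg_def)

lemma finite_edges:
  assumes "wfpg H"
  shows "finite (edges H)"
proof (rule finite_subset)
  show "edges H \<subseteq> Pow (verts H)"
  proof
    fix e assume "e \<in> edges H"
    then obtain u v where "e = {u, v}" "u \<in> verts H" "v \<in> verts H"
      using edge_cases[OF assms] by metis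
    then show "e \<in> Pow (verts H)" by simp
  qed
qed (simp add: finite_verts[OF assms])

text \<open>Up to isomorphism \<open>H\<close> is the product of \<open>K\<close> with a single
  unlabeled vertex, so the generator of the ideal and an isomorphism relation together delete the
  vertex.\<close>

lemma Krel_remove_isolated:
  assumes "wfpg H" "labels H = {}" "v \<in> verts H" "\<forall>e\<in>edges H. v \<notin> e"
  defines "K \<equiv> PG (verts H - {v}) (edges H) (\<lambda>_. None)"
  shows "wfpg K" "cdiff (ind H) (ind K) \<in> Krel"
proof -
  have lab: "lab H = (\<lambda>_. None)"
    using labels_empty_lab[OF assms(1,2)] by auto
  show K: "wfpg K"
    unfolding wfpg_def
  proof (intro conjI ballI)
    fix e assume e: "e \<in> edges K"
    then have "e \<in> edges H" by (simp add: K_def)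
    then obtain x y where "e = {x, y}" "x \<noteq> y" "x \<in> verts H" "y \<in> verts H"
      using edge_cases[OF assms(1)] by metis
    moreover have "v \<notin> e" using assms(4) \<open>e \<in> edges H\<close> by blast
    ultimately show "\<exists>u w. e = {u, w} \<and> u \<noteq> w \<and> u \<in> verts K \<and> w \<in> verts K"
      by (intro exI[of _ x] exI[of _ y]) (auto simp: K_def)
  qed (auto simp: K_def finite_verts[OF assms(1)])
  let ?F = "PG {0} {} (\<lambda>_. None)"
  have F: "wfpg ?F" "one_vertex ?F" by (auto simp: one_vertex_def wfpg_def)
  have P: "wfpg (pmul K ?F)" by (rule wfpg_pmul[OF K F(1)])
  \<comment> \<open>The product doubles the vertices of \<open>K\<close> and sends the vertex 0 of
    the second factor to 2 * 0 + 1 = 1.\<close>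
  define \<pi> where "\<pi> w = (if w = 1 then v else w div 2)" for w :: nat
  have vP: "verts (pmul K ?F) = insert 1 ((*) 2 ` (verts H - {v}))"
    by (auto simp: pmul_def K_def pmul_map_def)
  have eP: "edges (pmul K ?F) = (\<lambda>e. (*) 2 ` e) ` edges H"
    by (simp add: pmul_def K_def)
  have p2: "\<pi> (2 * u) = u" for u by (simp add: \<pi>_def)
  have p1: "\<pi> 1 = v" by (simp add: \<pi>_def)
  have "\<pi> ` verts (pmul K ?F) = verts H"
    using assms(3) unfolding vP by (auto simp: p1 p2 image_image simp del: One_nat_def)
  moreover have "inj_on \<pi> (verts (pmul K ?F))"
    unfolding vP by (auto simp: inj_on_def p1 p2 simp del: One_nat_def)
  moreover have "edges H = (\<lambda>e. \<pi> ` e) ` edges (pmul K ?F)"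
    unfolding eP image_image p2 by simp
  moreover have "lab (pmul K ?F) w = None" for w
    by (simp add: pmul_def K_def)
  ultimately have "pg_iso (pmul K ?F) H"
    unfolding pg_iso_def by (intro exI[of _ \<pi>]) (simp add: bij_betw_def lab)
  then have "cdiff (ind (pmul K ?F)) (ind H) \<in> Krel"
    by (rule Krel.iso[OF P assms(1)])
  from Krel.add[OF Krel.scale[OF this, of "- 1"] Krel.gen[OF K F(2)]]
  show "cdiff (ind H) (ind K) \<in> Krel"
    by (simp add: cadd_def cscale_def cdiff_def)
qed

text \<open>A minimal representative is reduced, since merging isomorphic terms or deleting an
  isolated vertex would give a smaller one.\<close>

lemma exists_reduced:
  assumes "inA {} g"
  obtains f where "inA {} f" "aeq g f"
    "\<And>H K. H \<in> supp f \<Longrightarrow> K \<in> supp f \<Longrightarrow> pg_iso H K \<Longrightarrow> H = K"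
    "\<And>H v. H \<in> supp f \<Longrightarrow> v \<in> verts H \<Longrightarrow> \<exists>e\<in>edges H. v \<in> e"
proof -
  \<comment> \<open>The successor charges every term at least 1, so that merging two terms lowers
    the measure even if one of them is the empty graph.\<close>
  define \<mu> where "\<mu> f = (\<Sum>H\<in>supp f. Suc (card (verts H)))" for f :: comb
  obtain f where f: "inA {} f" "aeq g f" and least: "\<And>f'. inA {} f' \<Longrightarrow> aeq g f' \<Longrightarrow> \<mu> f \<le> \<mu> f'"
    using ex_has_least_nat[of "\<lambda>f. inA {} f \<and> aeq g f" g \<mu>] assms aeq_refl by blast
  have fin: "finite (supp f)" and wf: "\<And>H. H \<in> supp f \<Longrightarrow> wfpg H \<and> labels H = {}"
    using f(1) by (auto simp: inA_def is_comb_def)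
  have replace: "\<mu> f \<le> (\<Sum>H\<in>insert K (supp f - {H}). Suc (card (verts H)))"
    if H: "H \<in> supp f" and K: "wfpg K" "labels K = {}" "K \<noteq> H" and rel: "cdiff (ind H) (ind K) \<in> Krel" for H K
  proof -
    \<comment> \<open>The whole coefficient of \<open>H\<close> is moved onto
      \<open>K\<close>.\<close>
    define f' where "f' = cdiff f (cscale (f H) (cdiff (ind H) (ind K)))"
    have s: "supp f' \<subseteq> insert K (supp f - {H})"
      using K(3) by (auto simp: supp_def f'_def cdiff_def cscale_def ind_def split: if_splits)
    have fin': "finite (insert K (supp f - {H}))" using fin by simp
    have "inA {} f'"
      unfolding inA_def is_comb_def using finite_subset[OF s fin'] s wf K by blast
    moreover have "cdiff g f' = cadd (cdiff g f) (cscale (f H) (cdiff (ind H) (ind K)))"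
      by (simp add: f'_def cdiff_def cadd_def cscale_def fun_eq_iff)
    then have "aeq g f'"
      using Krel.add[OF _ Krel.scale[OF rel]] f(2) by (simp add: aeq_def)
    ultimately have "\<mu> f \<le> \<mu> f'" by (rule least)
    also have "\<dots> \<le> (\<Sum>H\<in>insert K (supp f - {H}). Suc (card (verts H)))"
      unfolding \<mu>_def by (rule sum_mono2[OF fin' s]) simp
    finally show ?thesis .
  qed
  have mu: "\<mu> f = Suc (card (verts H)) + (\<Sum>H\<in>supp f - {H}. Suc (card (verts H)))" if "H \<in> supp f" for H
    unfolding \<mu>_def using fin that by (rule sum.remove)
  show thesis
  proof (rule that[OF f])
    fix H K assume HK: "H \<in> supp f" "K \<in> supp f" "pg_iso H K"
    show "H = K"
    proof (rule ccontr)
      assume ne: "H \<noteq> K"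
      have "cdiff (ind H) (ind K) \<in> Krel"
        using HK wf by (intro Krel.iso) auto
      then have "\<mu> f \<le> (\<Sum>H\<in>insert K (supp f - {H}). Suc (card (verts H)))"
        using HK wf ne by (intro replace) auto
      moreover have "insert K (supp f - {H}) = supp f - {H}" using HK ne by auto
      ultimately show False using mu[OF HK(1)] by simp
    qed
  next
    fix H v assume H: "H \<in> supp f" "v \<in> verts H"
    show "\<exists>e\<in>edges H. v \<in> e"
    proof (rule ccontr)
      assume "\<not> (\<exists>e\<in>edges H. v \<in> e)"
      then have iso: "\<forall>e\<in>edges H. v \<notin> e" by blast
      let ?K = "PG (verts H - {v}) (edges H) (\<lambda>_. None)"
      note K = Krel_remove_isolated[OF conjunct1[OF wf[OF H(1)]] conjunct2[OF wf[OF H(1)]] H(2) iso]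
      have "verts ?K \<noteq> verts H" using H(2) by auto
      then have "?K \<noteq> H" by metis
      then have "\<mu> f \<le> (\<Sum>H\<in>insert ?K (supp f - {H}). Suc (card (verts H)))"
        using H(1) K by (intro replace) (auto simp: labels_def)
      also have "\<dots> \<le> Suc (card (verts ?K)) + (\<Sum>H\<in>supp f - {H}. Suc (card (verts H)))"
        using fin by (cases "?K \<in> supp f - {H}") (auto simp: insert_absorb)
      finally have "\<mu> f \<le> Suc (card (verts ?K)) + (\<Sum>H\<in>supp f - {H}. Suc (card (verts H)))" .
      moreover have "card (verts ?K) < card (verts H)"
        using card_Diff1_less[OF finite_verts H(2)] wf[OF H(1)] by simp
      ultimately show False using mu[OF H(1)] by linarith
    qed
  qed
qed

text \<open>The vanishing case of Moebius inversion on the lattice of subsets.\<close>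

lemma subset_sums_zero:
  fixes N :: "'a set \<Rightarrow> real"
  assumes "finite S" "\<And>S'. S' \<subseteq> S \<Longrightarrow> (\<Sum>T\<in>Pow S'. N T) = 0"
  shows "N S = 0"
  using assms
proof (induction S rule: finite_psubset_induct)
  case (psubset S)
  have "N T = 0" if "T \<subset> S" for T
    using that psubset.prems by (intro psubset.IH) auto
  then have "(\<Sum>T\<in>Pow S - {S}. N T) = 0"
    by (intro sum.neutral) auto
  moreover have "(\<Sum>T\<in>Pow S. N T) = N S + (\<Sum>T\<in>Pow S - {S}. N T)"
    using psubset.hyps by (intro sum.remove) auto
  ultimately show ?case using psubset.prems[of S] by simp
qed

text \<open>In a reduced representative of \<open>g\<close> an extremal graph \<open>H\<close> is
  the only term with a homomorphism onto all vertices of \<open>H\<close>. Densities in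
  \<open>H\<close> restricted to vertex sets \<open>S\<close> sum the contributions of maps with
  image inside \<open>S\<close>, so if all of them vanished, inversion would make the contribution
  of surjective maps vanish too.\<close>

lemma nonzero_density:
  assumes "inA {} g" "\<not> aeq g czero"
  obtains V0 :: "nat set" and E0 where "finite V0" "V0 \<noteq> {}" "\<And>x y. E0 x y \<Longrightarrow> E0 y x"
    "\<And>\<phi>. wcomb V0 (\<lambda>_. 1 / real (card V0)) E0 \<phi> g \<noteq> 0"
proof -
  obtain f where f: "inA {} f" "aeq g f"
    and noniso: "\<And>H K. H \<in> supp f \<Longrightarrow> K \<in> supp f \<Longrightarrow> pg_iso H K \<Longrightarrow> H = K"
    and noisol: "\<And>H v. H \<in> supp f \<Longrightarrow> v \<in> verts H \<Longrightarrow> \<exists>e\<in>edges H. v \<in> e"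
    using exists_reduced[OF assms(1)] by blast
  have fin: "finite (supp f)" and wf: "\<And>H. H \<in> supp f \<Longrightarrow> wfpg H \<and> labels H = {}"
    using f(1) by (auto simp: inA_def is_comb_def)
  have "supp f \<noteq> {}"
  proof
    assume "supp f = {}"
    then have "f = czero" by (auto simp: supp_def czero_def)
    then show False using f(2) assms(2) by simp
  qed
  then have "Max ((\<lambda>K. card (verts K)) ` supp f) \<in> (\<lambda>K. card (verts K)) ` supp f"
    using fin by (intro Max_in) auto
  then obtain H1 where H1: "H1 \<in> supp f" "card (verts H1) = Max ((\<lambda>K. card (verts K)) ` supp f)"
    by auto
  have H1_max: "card (verts K) \<le> card (verts H1)" if "K \<in> supp f" for K
    unfolding H1(2) using fin that by (intro Max_ge) auto
  \<comment> \<open>Among the terms with the most vertices \<open>H\<close> has the fewest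
    edges.\<close>
  obtain H where H: "H \<in> supp f" "card (verts H) = card (verts H1)"
    "\<And>K. K \<in> supp f \<Longrightarrow> card (verts K) = card (verts H1) \<Longrightarrow> card (edges H) \<le> card (edges K)"
    using ex_has_least_nat[of "\<lambda>K. K \<in> supp f \<and> card (verts K) = card (verts H1)" H1 "\<lambda>K. card (edges K)"] H1(1) by auto
  have wfH: "wfpg H" using wf H(1) by blast
  \<comment> \<open>The extra point keeps the model nonempty when \<open>H\<close> is the empty
    graph.\<close>
  define V where "V = insert 0 (verts H)"
  have finV: "finite V" "V \<noteq> {}" using finite_verts[OF wfH] by (auto simp: V_def)
  define c where "c = 1 / real (card V)"
  have c: "c > 0" using finV by (simp add: c_def card_gt_0_iff)
  \<comment> \<open>Points outside \<open>S\<close> become isolated instead of being deleted, so the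
    normalization \<open>c\<close> is the same for all \<open>S\<close>.\<close>
  define E where "E S x y \<longleftrightarrow> {x, y} \<in> edges H \<and> x \<in> S \<and> y \<in> S" for S x y
  define hom where "hom K \<psi> \<longleftrightarrow> (\<forall>u v. {u, v} \<in> edges K \<longrightarrow> {\<psi> u, \<psi> v} \<in> edges H)" for K and \<psi> :: "nat \<Rightarrow> nat"
  define M where "M K T = {\<psi> \<in> verts K \<rightarrow>\<^sub>E V. hom K \<psi> \<and> \<psi> ` verts K = T}" for K T
  define N where "N T = (\<Sum>K\<in>supp f. f K * (c ^ card (verts K) * real (card (M K T))))" for T
  have dens: "wdens V (\<lambda>_. c) (E S) \<phi> K = c ^ card (verts K) * (\<Sum>T\<in>Pow S. real (card (M K T)))"
    if K: "K \<in> supp f" and S: "S \<subseteq> verts H" for K S \<phi>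
  proof -
    have wfK: "wfpg K" using wf K by blast
    have U: "unlabeled K = verts K"
      using wf[OF K] labels_empty_lab[of K] by (auto simp: unlabeled_def)
    have finM: "finite (M K T)" for T
      unfolding M_def using finV finite_verts[OF wfK] by (auto simp: finite_PiE)
    have "(\<forall>u v. {u, v} \<in> edges K \<longrightarrow> E S (override_on \<xi> \<psi> (verts K) u) (override_on \<xi> \<psi> (verts K) v)) \<longleftrightarrow>
        hom K \<psi> \<and> \<psi> ` verts K \<subseteq> S" for \<xi> \<psi>
    proof
      assume h: "\<forall>u v. {u, v} \<in> edges K \<longrightarrow> E S (override_on \<xi> \<psi> (verts K) u) (override_on \<xi> \<psi> (verts K) v)"
      have h': "E S (\<psi> u) (\<psi> v)" if "{u, v} \<in> edges K" for u v
        using h[rule_format, OF that] edge_verts[OF wfK that] by simp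
      have "\<psi> v \<in> S" if v: "v \<in> verts K" for v
      proof -
        \<comment> \<open>The absence of isolated vertices forces the image of every vertex into
          \<open>S\<close>.\<close>
        obtain e where e: "e \<in> edges K" "v \<in> e" using noisol[OF K v] by blast
        then obtain x y where xy: "e = {x, y}" using edge_cases[OF wfK e(1)] by metis
        then have "E S (\<psi> x) (\<psi> y)" using h' e by simp
        then show ?thesis using e xy by (auto simp: E_def)
      qed
      then show "hom K \<psi> \<and> \<psi> ` verts K \<subseteq> S"
        using h' by (auto simp: hom_def E_def)
    next
      assume h: "hom K \<psi> \<and> \<psi> ` verts K \<subseteq> S"
      show "\<forall>u v. {u, v} \<in> edges K \<longrightarrow> E S (override_on \<xi> \<psi> (verts K) u) (override_on \<xi> \<psi> (verts K) v)"
      proof (intro allI impI)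
        fix u v assume uv: "{u, v} \<in> edges K"
        then show "E S (override_on \<xi> \<psi> (verts K) u) (override_on \<xi> \<psi> (verts K) v)"
          using h edge_verts[OF wfK uv] by (simp add: E_def hom_def image_subset_iff)
      qed
    qed
    then have "wdens V (\<lambda>_. c) (E S) \<phi> K = c ^ card (verts K) *
        real (card {\<psi> \<in> verts K \<rightarrow>\<^sub>E V. hom K \<psi> \<and> \<psi> ` verts K \<subseteq> S})"
      unfolding wdens_def is_hom_def[abs_def] U wavg_count[OF finite_verts[OF wfK] finV(1)] by simp
    also have "{\<psi> \<in> verts K \<rightarrow>\<^sub>E V. hom K \<psi> \<and> \<psi> ` verts K \<subseteq> S} = (\<Union>T\<in>Pow S. M K T)"
      by (auto simp: M_def)
    also have "card \<dots> = (\<Sum>T\<in>Pow S. card (M K T))"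
      using finM finite_subset[OF S finite_verts[OF wfH]]
      by (intro card_UN_disjoint) (auto simp: M_def)
    finally show ?thesis by simp
  qed
  have total: "wcomb V (\<lambda>_. c) (E S) \<phi> f = (\<Sum>T\<in>Pow S. N T)" if "S \<subseteq> verts H" for S \<phi>
  proof -
    have "wcomb V (\<lambda>_. c) (E S) \<phi> f = (\<Sum>K\<in>supp f. \<Sum>T\<in>Pow S. f K * (c ^ card (verts K) * real (card (M K T))))"
      unfolding wcomb_def by (intro sum.cong refl) (simp add: dens[OF _ that] sum_distrib_left)
    also have "\<dots> = (\<Sum>T\<in>Pow S. N T)"
      unfolding N_def by (rule sum.swap)
    finally show ?thesis .
  qed
  \<comment> \<open>A surjection from \<open>K\<close> must be bijective because \<open>H\<close>
    has the most vertices, and bijective on edges because \<open>H\<close> has the fewest edges; so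
    \<open>K\<close> and \<open>H\<close> are isomorphic.\<close>
  have empty: "M K (verts H) = {}" if K: "K \<in> supp f" "K \<noteq> H" for K
  proof (rule ccontr)
    assume "M K (verts H) \<noteq> {}"
    then obtain \<psi> where \<psi>: "hom K \<psi>" "\<psi> ` verts K = verts H" by (auto simp: M_def)
    have wfK: "wfpg K" "labels K = {}" using wf K by blast+
    have "card (verts H) \<le> card (verts K)"
      using \<psi>(2) card_image_le[OF finite_verts[OF wfK(1)], of \<psi>] by simp
    then have cK: "card (verts K) = card (verts H1)" using H1_max[OF K(1)] H(2) by simp
    then have inj: "inj_on \<psi> (verts K)"
      using \<psi>(2) H(2) finite_verts[OF wfK(1)] by (intro eq_card_imp_inj_on) simp_all
    have sub: "(\<lambda>e. \<psi> ` e) ` edges K \<subseteq> edges H"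
    proof (rule image_subsetI)
      fix e assume e: "e \<in> edges K"
      obtain x y where "e = {x, y}" using edge_cases[OF wfK(1) e] by metis
      then show "\<psi> ` e \<in> edges H" using \<psi>(1) e by (simp add: hom_def)
    qed
    have eK: "e \<subseteq> verts K" if e: "e \<in> edges K" for e
    proof -
      obtain x y where "e = {x, y}" "x \<in> verts K" "y \<in> verts K" using edge_cases[OF wfK(1) e] by metis
      then show ?thesis by simp
    qed
    have "inj_on (\<lambda>e. \<psi> ` e) (edges K)"
    proof (rule inj_onI)
      fix e e' assume "e \<in> edges K" "e' \<in> edges K" "\<psi> ` e = \<psi> ` e'"
      then show "e = e'" using inj_on_image_eq_iff[OF inj, of e e'] eK by simp
    qed
    then have "card ((\<lambda>e. \<psi> ` e) ` edges K) = card (edges K)" by (rule card_image)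
    then have "(\<lambda>e. \<psi> ` e) ` edges K = edges H"
      using H(3)[OF K(1) cK] sub finite_edges[OF wfH] by (intro card_seteq) auto
    then have "pg_iso K H"
      unfolding pg_iso_def using inj \<psi>(2) wf[OF H(1)] labels_empty_lab[OF wfK] labels_empty_lab[of H]
      by (intro exI[of _ \<psi>]) (simp add: bij_betw_def)
    then show False using noniso[OF K(1) H(1)] K(2) by simp
  qed
  have "restrict id (verts H) \<in> M H (verts H)"
  proof -
    have "{restrict id (verts H) u, restrict id (verts H) v} = {u, v}" if "{u, v} \<in> edges H" for u v
      using edge_verts[OF wfH that] by simp
    then show ?thesis by (auto simp: M_def hom_def V_def)
  qed
  moreover have "finite (M H (verts H))"
    unfolding M_def using finV finite_verts[OF wfH] by (auto simp: finite_PiE)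
  ultimately have "card (M H (verts H)) \<noteq> 0" by auto
  moreover have "f H \<noteq> 0" using H(1) by (simp add: supp_def)
  moreover have "N (verts H) = f H * (c ^ card (verts H) * real (card (M H (verts H))))"
    unfolding N_def using fin H(1) empty by (subst sum.remove[of _ H]) auto
  ultimately have "N (verts H) \<noteq> 0" using c by simp
  then obtain S where S: "S \<subseteq> verts H" "(\<Sum>T\<in>Pow S. N T) \<noteq> 0"
    using subset_sums_zero[OF finite_verts[OF wfH], of N] by blast
  show thesis
  proof (rule that[OF finV, of "E S"])
    show "E S y x" if "E S x y" for x y
      using that by (simp add: E_def insert_commute)
  next
    fix \<phi>
    have "sum (\<lambda>_. c) V = 1" using finV by (simp add: c_def)
    then have "wcomb V (\<lambda>_. c) (E S) \<phi> g = wcomb V (\<lambda>_. c) (E S) \<phi> f"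
      using f assms(1) by (intro wcomb_aeq) (auto simp: inA_def is_comb_def)
    then show "wcomb V (\<lambda>_. 1 / real (card V)) (E S) \<phi> g \<noteq> 0"
      using total[OF S(1)] S(2) by (simp add: c_def)
  qed
qed

section \<open>A gap in Goodman's inequality\<close>

text \<open>Separate weight functions in each slot make the forms multilinear, so that they can be
  expanded along a perturbation of the weights.\<close>

definition edge_form :: "'p set \<Rightarrow> ('p \<Rightarrow> 'p \<Rightarrow> bool) \<Rightarrow> ('p \<Rightarrow> real) \<Rightarrow> ('p \<Rightarrow> real) \<Rightarrow> real" where
  "edge_form V E f g = (\<Sum>p\<in>V. f p * (\<Sum>q\<in>V. g q * of_bool (E p q)))"

definition tri_form :: "'p set \<Rightarrow> ('p \<Rightarrow> 'p \<Rightarrow> bool) \<Rightarrow> ('p \<Rightarrow> real) \<Rightarrow> ('p \<Rightarrow> real) \<Rightarrow> ('p \<Rightarrow> real) \<Rightarrow> real" where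
  "tri_form V E f g h =
     (\<Sum>p\<in>V. f p * (\<Sum>q\<in>V. g q * of_bool (E p q) * (\<Sum>r\<in>V. h r * of_bool (E q r \<and> E p r))))"

lemma edge_form_swap:
  assumes "\<And>p q. E p q \<longleftrightarrow> E q p"
  shows "edge_form V E f g = edge_form V E g f"
  unfolding edge_form_def sum_distrib_left
  by (subst sum.swap) (intro sum.cong refl, subst assms, simp)

lemma edge_form_add1: "edge_form V E (\<lambda>p. f p + t * g p) h = edge_form V E f h + t * edge_form V E g h"
  by (simp add: edge_form_def distrib_right sum.distrib sum_distrib_left mult.assoc)

lemma tri_form_eq:
  "tri_form V E f g h = (\<Sum>p\<in>V. \<Sum>q\<in>V. \<Sum>r\<in>V. f p * g q * h r * (of_bool (E p q) * of_bool (E q r) * of_bool (E p r)))"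
  by (simp add: tri_form_def sum_distrib_left of_bool_conj mult_ac)

lemma tri_form_swap12:
  assumes "\<And>p q. E p q \<longleftrightarrow> E q p"
  shows "tri_form V E f g h = tri_form V E g f h"
  unfolding tri_form_eq using assms
  by (subst sum.swap) (intro sum.cong refl, simp add: mult_ac)

lemma tri_form_swap23:
  assumes "\<And>p q. E p q \<longleftrightarrow> E q p"
  shows "tri_form V E f g h = tri_form V E f h g"
  unfolding tri_form_eq
proof (rule sum.cong[OF refl])
  fix p
  show "(\<Sum>q\<in>V. \<Sum>r\<in>V. f p * g q * h r * (of_bool (E p q) * of_bool (E q r) * of_bool (E p r)))
      = (\<Sum>q\<in>V. \<Sum>r\<in>V. f p * h q * g r * (of_bool (E p q) * of_bool (E q r) * of_bool (E p r)))"
    using assms by (subst sum.swap) (intro sum.cong refl, simp add: mult_ac)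
qed

lemma tri_form_add1: "tri_form V E (\<lambda>p. f p + t * g p) h k = tri_form V E f h k + t * tri_form V E g h k"
  by (simp add: tri_form_def distrib_right sum.distrib sum_distrib_left mult.assoc)

text \<open>The direction \<open>d\<close> lives on an independent set, hence terms containing it
  twice vanish. In the triangle form below the terms of degree 2 and 3 in \<open>t\<close> vanish
  for the same reason.\<close>

lemma edge_form_shift:
  assumes "\<And>p q. E p q \<longleftrightarrow> E q p" "\<And>p q. d p \<noteq> 0 \<Longrightarrow> d q \<noteq> 0 \<Longrightarrow> \<not> E p q"
  shows "edge_form V E (\<lambda>p. y p + t * d p) (\<lambda>p. y p + t * d p) = edge_form V E y y + 2 * t * edge_form V E y d"
proof -
  have "d p * (d q * of_bool (E p q)) = 0" for p q using assms(2)[of p q] by auto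
  then have "edge_form V E d d = 0"
    unfolding edge_form_def sum_distrib_left by (simp only: sum.neutral_const)
  moreover note swap = edge_form_swap[where E = E and V = V, OF assms(1)]
  have "edge_form V E h (\<lambda>p. y p + t * d p) = edge_form V E h y + t * edge_form V E h d" for h
    using edge_form_add1[of V E y t d h] swap[of h] by simp
  ultimately show ?thesis
    using swap[of d y] by (simp add: edge_form_add1)
qed

lemma tri_form_shift:
  assumes "\<And>p q. E p q \<longleftrightarrow> E q p" "\<And>p q. d p \<noteq> 0 \<Longrightarrow> d q \<noteq> 0 \<Longrightarrow> \<not> E p q"
  shows "tri_form V E (\<lambda>p. y p + t * d p) (\<lambda>p. y p + t * d p) (\<lambda>p. y p + t * d p)
    = tri_form V E y y y + 3 * t * tri_form V E y y d"
proof -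
  note s12 = tri_form_swap12[where E = E and V = V, OF assms(1)]
    and s23 = tri_form_swap23[where E = E and V = V, OF assms(1)]
  have add2: "tri_form V E h (\<lambda>p. f p + t * g p) k = tri_form V E h f k + t * tri_form V E h g k" for f g h k
    using tri_form_add1[of V E f t g h k] s12[of h] by simp
  have add3: "tri_form V E h k (\<lambda>p. f p + t * g p) = tri_form V E h k f + t * tri_form V E h k g" for f g h k
    using add2[of h f g k] s23[of h k] by simp
  have zero: "tri_form V E d d h = 0" for h
  proof -
    have "d p * d q * h r * (of_bool (E p q) * of_bool (E q r) * of_bool (E p r)) = 0" for p q r
      using assms(2)[of p q] by auto
    then show ?thesis unfolding tri_form_eq by (simp only: sum.neutral_const)
  qed
  have zero': "tri_form V E d h d = 0" "tri_form V E h d d = 0" for h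
    using zero[of h] s12[of h d d] s23[of d h d] by auto
  have perm: "tri_form V E y d y = tri_form V E y y d" "tri_form V E d y y = tri_form V E y y d"
    using s12[of d y y] s23[of y d y] by auto
  show ?thesis
    by (simp only: tri_form_add1 add2 add3 zero zero' perm) (simp add: algebra_simps)
qed

text \<open>The functional is affine along a transfer of weight between two nonadjacent vertices, so one
  of the two full transfers does not increase it.\<close>

lemma clique_reduction:
  assumes "finite V" and sym: "\<And>p q. E p q \<longleftrightarrow> E q p" and irrefl: "\<And>p. \<not> E p p"
    and "\<And>p. p \<in> V \<Longrightarrow> 0 \<le> y p" "sum y V = 1"
  shows "\<exists>y'. (\<forall>p\<in>V. 0 \<le> y' p) \<and> sum y' V = 1 \<and>
     (\<forall>p\<in>V. \<forall>q\<in>V. y' p \<noteq> 0 \<longrightarrow> y' q \<noteq> 0 \<longrightarrow> p \<noteq> q \<longrightarrow> E p q) \<and>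
     tri_form V E y' y' y' - k * edge_form V E y' y' \<le> tri_form V E y y y - k * edge_form V E y y"
  using assms(4,5)
proof (induction "card {p \<in> V. y p \<noteq> 0}" arbitrary: y rule: less_induct)
  case less
  show ?case
  proof (cases "\<forall>p\<in>V. \<forall>q\<in>V. y p \<noteq> 0 \<longrightarrow> y q \<noteq> 0 \<longrightarrow> p \<noteq> q \<longrightarrow> E p q")
    case True
    then show ?thesis using less.prems by (intro exI[of _ y]) auto
  next
    case False
    then obtain x x' where x: "x \<in> V" "x' \<in> V" "y x \<noteq> 0" "y x' \<noteq> 0" "x \<noteq> x'" "\<not> E x x'" by blast
    define d :: "'a \<Rightarrow> real" where "d p = of_bool (p = x) - of_bool (p = x')" for p
    have dE: "\<not> E p q" if "d p \<noteq> 0" "d q \<noteq> 0" for p q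
      using that x(6) irrefl sym by (auto simp: d_def of_bool_def split: if_splits)
    have sum_d: "sum d V = 0"
      using x(1,2) assms(1) by (simp add: d_def[abs_def] sum_subtractf of_bool_def)
    \<comment> \<open>The slope of the functional in the direction \<open>d\<close>. The next line
      takes the longest step that does not increase it: the weight of x' goes to x, or conversely,
      which empties one vertex and keeps the total.\<close>
    define s where "s = 3 * tri_form V E y y d - k * (2 * edge_form V E y d)"
    define t where "t = (if s \<le> 0 then y x' else - y x)"
    let ?y = "\<lambda>p. y p + t * d p"
    have ts: "t * s \<le> 0"
      using less.prems(1)[OF x(1)] less.prems(1)[OF x(2)] by (auto simp: t_def mult_nonneg_nonpos)
    have nonneg: "0 \<le> ?y p" if "p \<in> V" for p
      using less.prems(1)[OF that] less.prems(1)[OF x(1)] less.prems(1)[OF x(2)] x(5) by (auto simp: d_def t_def)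
    have supp: "{p \<in> V. ?y p \<noteq> 0} \<subset> {p \<in> V. y p \<noteq> 0}"
      using x by (auto simp: d_def t_def split: if_splits)
    have "card {p \<in> V. ?y p \<noteq> 0} < card {p \<in> V. y p \<noteq> 0}"
      by (rule psubset_card_mono[OF _ supp]) (simp add: assms(1))
    moreover have "sum ?y V = 1"
      using less.prems(2) sum_d by (simp add: sum.distrib flip: sum_distrib_left)
    ultimately obtain y' where y': "\<forall>p\<in>V. 0 \<le> y' p" "sum y' V = 1"
       "\<forall>p\<in>V. \<forall>q\<in>V. y' p \<noteq> 0 \<longrightarrow> y' q \<noteq> 0 \<longrightarrow> p \<noteq> q \<longrightarrow> E p q"
       "tri_form V E y' y' y' - k * edge_form V E y' y' \<le> tri_form V E ?y ?y ?y - k * edge_form V E ?y ?y"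
      using less.hyps[of ?y] nonneg by blast
    have "tri_form V E ?y ?y ?y - k * edge_form V E ?y ?y = tri_form V E y y y - k * edge_form V E y y + t * s"
      using tri_form_shift[where E = E and d = d and V = V and y = y and t = t, OF sym dE]
        edge_form_shift[where E = E and d = d and V = V and y = y and t = t, OF sym dE]
      by (simp add: s_def algebra_simps)
    then show ?thesis using y' ts by (intro exI[of _ y']) auto
  qed
qed

text \<open>Independent points of a clique fail to be adjacent only when they coincide; the formulas
  are inclusion-exclusion over the coincidences of two or three points.\<close>

lemma clique_forms:
  fixes y :: "'p \<Rightarrow> real"
  assumes "finite V" and irrefl: "\<And>p. \<not> E p p" and "sum y V = 1"
    and clique: "\<forall>p\<in>V. \<forall>q\<in>V. y p \<noteq> 0 \<longrightarrow> y q \<noteq> 0 \<longrightarrow> p \<noteq> q \<longrightarrow> E p q"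
  shows "edge_form V E y y = 1 - (\<Sum>p\<in>V. y p ^ 2)"
    and "tri_form V E y y y = 1 - 3 * (\<Sum>p\<in>V. y p ^ 2) + 2 * (\<Sum>p\<in>V. y p ^ 3)"
proof -
  have adj: "y p * (y q * of_bool (E p q)) = y p * (y q - (if q = p then y p else 0))" if "p \<in> V" "q \<in> V" for p q
    using that clique irrefl by auto
  have "edge_form V E y y = (\<Sum>p\<in>V. \<Sum>q\<in>V. y p * (y q - (if q = p then y p else 0)))"
    unfolding edge_form_def sum_distrib_left by (intro sum.cong refl adj)
  also have "\<dots> = (\<Sum>p\<in>V. y p * (1 - y p))"
    using assms(1,3) by (intro sum.cong refl) (simp add: sum_subtractf flip: sum_distrib_left)
  also have "\<dots> = 1 - (\<Sum>p\<in>V. y p ^ 2)"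
    using assms(3) by (simp add: right_diff_distrib sum_subtractf power2_eq_square)
  finally show "edge_form V E y y = 1 - (\<Sum>p\<in>V. y p ^ 2)" .
  have inner: "y p * (y q * of_bool (E p q) * (\<Sum>r\<in>V. y r * of_bool (E q r \<and> E p r))) =
      y p * ((y q - (if q = p then y p else 0)) * (1 - y p - y q))" if pq: "p \<in> V" "q \<in> V" for p q
  proof (cases "q = p \<or> y p = 0 \<or> y q = 0")
    case True
    then show ?thesis using irrefl by auto
  next
    case False
    have "(\<Sum>r\<in>V. y r * of_bool (E q r \<and> E p r)) = (\<Sum>r\<in>V. y r - (if r = p then y p else 0) - (if r = q then y q else 0))"
      using False pq clique irrefl by (intro sum.cong refl) auto
    also have "\<dots> = 1 - y p - y q"
      using assms(1,3) pq by (simp add: sum_subtractf)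
    finally show ?thesis using False pq clique by auto
  qed
  have "tri_form V E y y y = (\<Sum>p\<in>V. \<Sum>q\<in>V. y p * ((y q - (if q = p then y p else 0)) * (1 - y p - y q)))"
    unfolding tri_form_def sum_distrib_left[of "y _"] by (intro sum.cong refl inner)
  also have "\<dots> = (\<Sum>p\<in>V. y p * ((1 - y p) - (\<Sum>q\<in>V. y q ^ 2) - y p * (1 - 2 * y p)))"
  proof (intro sum.cong refl)
    fix p assume p: "p \<in> V"
    have "(\<Sum>q\<in>V. y p * ((y q - (if q = p then y p else 0)) * (1 - y p - y q))) =
        y p * (\<Sum>q\<in>V. y q * (1 - y p) - y q ^ 2 - (if q = p then y p * (1 - 2 * y p) else 0))"
      unfolding sum_distrib_left by (intro sum.cong refl) (auto simp: algebra_simps power2_eq_square)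
    also have "\<dots> = y p * ((1 - y p) - (\<Sum>q\<in>V. y q ^ 2) - y p * (1 - 2 * y p))"
      using assms(1,3) p by (simp add: sum_subtractf flip: sum_distrib_right)
    finally show "(\<Sum>q\<in>V. y p * ((y q - (if q = p then y p else 0)) * (1 - y p - y q))) = \<dots>" .
  qed
  also have "\<dots> = (\<Sum>p\<in>V. y p - (\<Sum>q\<in>V. y q ^ 2) * y p - 2 * y p ^ 2 + 2 * y p ^ 3)"
    by (intro sum.cong refl) (simp add: algebra_simps power2_eq_square power3_eq_cube)
  also have "\<dots> = 1 - (\<Sum>q\<in>V. y q ^ 2) * 1 - 2 * (\<Sum>p\<in>V. y p ^ 2) + 2 * (\<Sum>p\<in>V. y p ^ 3)"
    using assms(3) by (simp add: sum.distrib sum_subtractf flip: sum_distrib_left)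
  finally show "tri_form V E y y y = 1 - 3 * (\<Sum>p\<in>V. y p ^ 2) + 2 * (\<Sum>p\<in>V. y p ^ 3)" by simp
qed

text \<open>If the weights concentrate near \<open>l\<close>, then about \<open>1 / l\<close> of them do, and the witness \<open>k\<close>
  counts those exceeding \<open>l / 2\<close>.\<close>

lemma weights_near_reciprocal:
  fixes y :: "'p \<Rightarrow> real"
  assumes "finite V" "\<And>p. p \<in> V \<Longrightarrow> 0 \<le> y p" "sum y V = 1" "0 < l"
  shows "\<exists>k::nat. l ^ 2 * (1 - real k * l) ^ 2 \<le> 8 * (\<Sum>p\<in>V. y p * (y p - l) ^ 2)"
proof -
  define B where "B = {p \<in> V. y p > l / 2}"
  define C where "C = V - B"
  have BC: "finite B" "finite C" "V = B \<union> C" "B \<inter> C = {}"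
    using assms(1) by (auto simp: B_def C_def)
  have split: "sum f V = sum f B + sum f C" for f :: "'p \<Rightarrow> real"
    unfolding BC(3) using BC by (intro sum.union_disjoint)
  define sC where "sC = sum y C"
  define dB where "dB = (\<Sum>p\<in>B. y p - l)"
  have C_pos: "0 \<le> sC" unfolding sC_def using assms(2) BC by (intro sum_nonneg) auto
  have B_pos: "0 \<le> sum y B" using assms(2) BC by (intro sum_nonneg) auto
  have "sC \<le> 1" using split[of y] assms(3) B_pos by (simp add: sC_def)
  then have "sC ^ 2 \<le> sC" using C_pos by (simp add: power2_eq_square mult_left_le)
  \<comment> \<open>Off \<open>B\<close> each weight is at most l / 2, hence at distance at least l
    / 2 from \<open>l\<close>.\<close>
  moreover have "l ^ 2 * sC \<le> 4 * (\<Sum>p\<in>C. y p * (y p - l) ^ 2)"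
  proof -
    have "l ^ 2 * y p \<le> 4 * (y p * (y p - l) ^ 2)" if "p \<in> C" for p
    proof -
      have "0 \<le> y p" "y p \<le> l / 2" using that assms(2) by (auto simp: B_def C_def)
      then have "(l / 2) ^ 2 \<le> (l - y p) ^ 2" using assms(4) by (intro power_mono) auto
      then have "l ^ 2 \<le> 4 * (y p - l) ^ 2" by (simp add: power2_commute power_divide)
      then show ?thesis using \<open>0 \<le> y p\<close> by (metis mult.commute mult.left_commute mult_left_mono)
    qed
    then show ?thesis unfolding sC_def sum_distrib_left by (intro sum_mono)
  qed
  ultimately have c: "l ^ 2 * sC ^ 2 \<le> 4 * (\<Sum>p\<in>C. y p * (y p - l) ^ 2)"
    using mult_left_mono[of "sC ^ 2" sC "l ^ 2"] by simp
  have "real (card B) * (l / 2) = (\<Sum>p\<in>B. l / 2)" by simp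
  also have "\<dots> \<le> sum y B" by (intro sum_mono) (simp add: B_def)
  also have "\<dots> \<le> 1" using split[of y] assms(3) C_pos by (simp add: sC_def)
  finally have cardB: "real (card B) * l \<le> 2" by simp
  \<comment> \<open>Cauchy-Schwarz, read off from the double sum of squared differences.\<close>
  have "dB ^ 2 \<le> real (card B) * (\<Sum>p\<in>B. (y p - l) ^ 2)"
  proof -
    have "0 \<le> (\<Sum>p\<in>B. \<Sum>q\<in>B. ((y p - l) - (y q - l)) ^ 2)" by (intro sum_nonneg) simp
    also have "\<dots> = (\<Sum>p\<in>B. \<Sum>q\<in>B. (y p - l) ^ 2 + (y q - l) ^ 2 - 2 * ((y p - l) * (y q - l)))"
      by (intro sum.cong refl) (simp add: power2_eq_square algebra_simps)
    also have "\<dots> = 2 * (real (card B) * (\<Sum>p\<in>B. (y p - l) ^ 2)) - 2 * (dB * dB)"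
      unfolding dB_def sum_product by (simp add: sum.distrib sum_subtractf flip: sum_distrib_left)
    finally show ?thesis by (simp add: power2_eq_square)
  qed
  then have "l ^ 2 * dB ^ 2 \<le> (real (card B) * l) * (l * (\<Sum>p\<in>B. (y p - l) ^ 2))"
    using mult_left_mono[of "dB ^ 2" "real (card B) * (\<Sum>p\<in>B. (y p - l) ^ 2)" "l ^ 2"]
    by (simp add: power2_eq_square[of l] mult_ac)
  also have "\<dots> \<le> 2 * (l * (\<Sum>p\<in>B. (y p - l) ^ 2))"
    using cardB assms(4) by (intro mult_right_mono mult_nonneg_nonneg sum_nonneg) auto
  also have "l * (\<Sum>p\<in>B. (y p - l) ^ 2) \<le> 2 * (\<Sum>p\<in>B. y p * (y p - l) ^ 2)"
    unfolding sum_distrib_left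
  proof (intro sum_mono)
    fix p assume "p \<in> B"
    then have "l \<le> 2 * y p" by (simp add: B_def)
    then have "l * (y p - l) ^ 2 \<le> (2 * y p) * (y p - l) ^ 2" by (intro mult_right_mono) auto
    then show "l * (y p - l) ^ 2 \<le> 2 * (y p * (y p - l) ^ 2)" by simp
  qed
  finally have b: "l ^ 2 * dB ^ 2 \<le> 4 * (\<Sum>p\<in>B. y p * (y p - l) ^ 2)" by simp
  have "1 - real (card B) * l = sC + dB"
    using split[of y] assms(3) by (simp add: sC_def dB_def sum_subtractf)
  then have "(1 - real (card B) * l) ^ 2 \<le> 2 * sC ^ 2 + 2 * dB ^ 2"
    using sum_squares_bound[of sC dB] by (simp add: power2_sum)
  then have "l ^ 2 * (1 - real (card B) * l) ^ 2 \<le> 2 * (l ^ 2 * sC ^ 2) + 2 * (l ^ 2 * dB ^ 2)"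
    using mult_left_mono[of _ _ "l ^ 2"] by (fastforce simp: distrib_left)
  then show ?thesis
    using b c split[of "\<lambda>p. y p * (y p - l) ^ 2"] by (intro exI[of _ "card B"]) simp
qed

text \<open>As a function of the edge density s = 1 - z Goodman's bound is s (2 s - 1), with
  derivative 4 s - 1 = 3 - 4 z. Subtracting this tangent slope makes the reduction to a clique
  harmless even though it changes the edge density, and on a clique the excess over the tangent line
  is exactly twice the weighted variance about \<open>z\<close>.\<close>

lemma goodman_gap:
  fixes y :: "'p \<Rightarrow> real"
  assumes "finite V" "\<And>p q. E p q \<longleftrightarrow> E q p" "\<And>p. \<not> E p p"
    and "\<And>p. p \<in> V \<Longrightarrow> 0 \<le> y p" "sum y V = 1"
  defines "z \<equiv> 1 - edge_form V E y y"
  assumes "0 < z"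
  shows "\<exists>k::nat. z ^ 2 * (1 - real k * z) ^ 2 \<le> 4 * (tri_form V E y y y - (1 - z) * (1 - 2 * z))"
proof -
  obtain y' where y': "\<forall>p\<in>V. 0 \<le> y' p" "sum y' V = 1"
      "\<forall>p\<in>V. \<forall>q\<in>V. y' p \<noteq> 0 \<longrightarrow> y' q \<noteq> 0 \<longrightarrow> p \<noteq> q \<longrightarrow> E p q"
      "tri_form V E y' y' y' - (3 - 4 * z) * edge_form V E y' y' \<le> tri_form V E y y y - (3 - 4 * z) * edge_form V E y y"
    using clique_reduction[where E = E and V = V and y = y and k = "3 - 4 * z", OF assms(1-5)] by blast
  obtain k :: nat where k: "z ^ 2 * (1 - real k * z) ^ 2 \<le> 8 * (\<Sum>p\<in>V. y' p * (y' p - z) ^ 2)"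
    using weights_near_reciprocal[where y = y' and l = z, OF assms(1) _ y'(2) assms(7)] y'(1) by blast
  have "(\<Sum>p\<in>V. y' p * (y' p - z) ^ 2) = (\<Sum>p\<in>V. y' p ^ 3 - 2 * z * y' p ^ 2 + z ^ 2 * y' p)"
    by (intro sum.cong refl) (simp add: power2_eq_square power3_eq_cube algebra_simps)
  also have "\<dots> = (\<Sum>p\<in>V. y' p ^ 3) - 2 * z * (\<Sum>p\<in>V. y' p ^ 2) + z ^ 2"
    using y'(2) by (simp add: sum.distrib sum_subtractf flip: sum_distrib_left)
  finally have eq: "(\<Sum>p\<in>V. y' p * (y' p - z) ^ 2) = (\<Sum>p\<in>V. y' p ^ 3) - 2 * z * (\<Sum>p\<in>V. y' p ^ 2) + z ^ 2" .
  have "2 * (\<Sum>p\<in>V. y' p * (y' p - z) ^ 2) =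
      tri_form V E y' y' y' - (3 - 4 * z) * edge_form V E y' y' + (2 - 4 * z + 2 * z ^ 2)"
    unfolding eq clique_forms[where E = E and V = V and y = y', OF assms(1,3) y'(2,3)] by (simp add: algebra_simps)
  also have "\<dots> \<le> tri_form V E y y y - (3 - 4 * z) * (1 - z) + (2 - 4 * z + 2 * z ^ 2)"
    using y'(4) by (simp add: z_def)
  also have "\<dots> = tri_form V E y y y - (1 - z) * (1 - 2 * z)"
    by (simp add: algebra_simps power2_eq_square)
  finally have "8 * (\<Sum>p\<in>V. y' p * (y' p - z) ^ 2) \<le> 4 * (tri_form V E y y y - (1 - z) * (1 - 2 * z))"
    by (auto dest: mult_left_mono[of _ _ 4])
  then show ?thesis using k order_trans by blast
qed

section \<open>The witness\<close>

definition rooted_K2 :: "nat \<Rightarrow> comb" where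
  "rooted_K2 l = ind (PG {0, 1} {{0, 1}} (\<lambda>v. if v = 0 then Some l else None))"

definition rooted_K3 :: "nat \<Rightarrow> comb" where
  "rooted_K3 l = ind (PG {0, 1, 2} {{0, 1}, {0, 2}, {1, 2}} (\<lambda>v. if v = 0 then Some l else None))"

definition rooted_K4 :: "nat \<Rightarrow> comb" where
  "rooted_K4 l = ind (PG {0, 1, 2, 3} {{0, 1}, {0, 2}, {0, 3}, {1, 2}, {1, 3}, {2, 3}}
     (\<lambda>v. if v = 0 then Some l else None))"

definition csq :: "comb \<Rightarrow> comb" where "csq f = cmul f f"

definition nonadj_comb :: "nat \<Rightarrow> comb" where
  "nonadj_comb l = cdiff (csq (rooted_K2 l)) (rooted_K3 l)"

text \<open>Represents T A - 2 e^2 + e A^2, which is A^4 times the excess of the triangle density T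
  / A^3 over (1 - z) (1 - 2 z), where 1 - z = e / A^2.\<close>

definition goodman_comb :: "nat \<Rightarrow> comb" where
  "goodman_comb l = cadd (cdiff (cmul (rooted_K4 l) (rooted_K2 l)) (cscale 2 (csq (rooted_K3 l))))
     (cmul (rooted_K3 l) (csq (rooted_K2 l)))"

text \<open>With F = A^2 - e at each root this is D = F1 A2^2 - F2 A1^2 = F1 F2 d. The next
  combination is D^2 - (F1 F2)^2 = (F1 F2)^2 (d^2 - 1).\<close>

definition diff_comb :: comb where
  "diff_comb = cdiff (cmul (nonadj_comb 1) (csq (rooted_K2 2))) (cmul (nonadj_comb 2) (csq (rooted_K2 1)))"

definition gap_comb :: comb where
  "gap_comb = cdiff (csq diff_comb) (csq (cmul (nonadj_comb 1) (nonadj_comb 2)))"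

text \<open>For the root with label \<open>l\<close> let \<open>A, e, T\<close> be the total, edge and triangle weight of its
  neighbourhood, and \<open>F = A\<^sup>2 - e\<close>, so that \<open>z = F / A\<^sup>2\<close>. Up to the factor \<open>(F1 F2)\<^sup>8\<close>, which clears
  denominators, the element below is \<open>d\<^sup>2 (d\<^sup>2 - 1)\<^sup>3 + 32 (s1 / z1\<^sup>4 + s2 / z2\<^sup>4)\<close>, where
  \<open>d = 1 / z2 - 1 / z1\<close> and \<open>s\<close> is the excess of the triangle density over Goodman's bound.\<close>

definition rooted_witness :: comb where
  "rooted_witness = cadd (cmul (csq diff_comb) (cmul gap_comb (csq gap_comb)))
     (cscale 32 (cmul (csq (csq (cmul (nonadj_comb 1) (nonadj_comb 2))))
       (cadd (cmul (goodman_comb 1) (cmul (csq (csq (rooted_K2 1))) (csq (csq (nonadj_comb 2)))))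
             (cmul (goodman_comb 2) (cmul (csq (csq (rooted_K2 2))) (csq (csq (nonadj_comb 1))))))))"

definition witness :: comb where "witness = cunl {} rooted_witness"

definition witness_poly :: "real \<Rightarrow> real \<Rightarrow> real \<Rightarrow> real \<Rightarrow> real \<Rightarrow> real \<Rightarrow> real" where
  "witness_poly A1 e1 T1 A2 e2 T2 =
    (let F1 = A1 ^ 2 - e1; F2 = A2 ^ 2 - e2;
         S1 = T1 * A1 - 2 * e1 ^ 2 + e1 * A1 ^ 2; S2 = T2 * A2 - 2 * e2 ^ 2 + e2 * A2 ^ 2;
         D = F1 * A2 ^ 2 - F2 * A1 ^ 2
     in D ^ 2 * (D ^ 2 - (F1 * F2) ^ 2) ^ 3
        + 32 * ((F1 * F2) ^ 4 * (S1 * (A1 ^ 4 * F2 ^ 4) + S2 * (A2 ^ 4 * F1 ^ 4))))"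

section \<open>Evaluation of the witness in a weighted graph\<close>

lemma wfpg_rootedI:
  assumes "finite V" "0 \<in> V" "0 < l" "\<forall>e\<in>X. \<exists>u\<in>V. \<exists>v\<in>V. u \<noteq> v \<and> e = {u, v}"
  shows "wfpg (PG V X (\<lambda>v. if v = 0 then Some l else None))"
proof -
  have "\<forall>e\<in>X. \<exists>u v. e = {u, v} \<and> u \<noteq> v \<and> u \<in> V \<and> v \<in> V"
  proof
    fix e assume "e \<in> X"
    then obtain u v where "u \<in> V" "v \<in> V" "u \<noteq> v" "e = {u, v}" using assms(4) by meson
    then show "\<exists>u v. e = {u, v} \<and> u \<noteq> v \<and> u \<in> V \<and> v \<in> V" by (intro exI conjI)
  qed
  then show ?thesis
    unfolding wfpg_def using assms(1-3) by (auto simp: inj_on_def split: if_splits)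
qed

lemma wfpg_rooted:
  "0 < l \<Longrightarrow> wfpg (PG {0, 1} {{0, 1}} (\<lambda>v. if v = 0 then Some l else None))"
  "0 < l \<Longrightarrow> wfpg (PG {0, 1, 2} {{0, 1}, {0, 2}, {1, 2}} (\<lambda>v. if v = 0 then Some l else None))"
  "0 < l \<Longrightarrow> wfpg (PG {0, 1, 2, 3} {{0, 1}, {0, 2}, {0, 3}, {1, 2}, {1, 3}, {2, 3}}
     (\<lambda>v. if v = 0 then Some l else None))"
  by (rule wfpg_rootedI; simp add: doubleton_eq_iff)+

lemma is_comb_rooted [simp]:
  assumes "0 < l"
  shows "is_comb (rooted_K2 l)" "is_comb (rooted_K3 l)" "is_comb (rooted_K4 l)"
  using wfpg_rooted[OF assms] by (simp_all only: rooted_K2_def rooted_K3_def rooted_K4_def is_comb_ind)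

lemma is_comb_csq: "is_comb f \<Longrightarrow> is_comb (csq f)"
  by (simp add: csq_def is_comb_cmul)

lemmas is_comb_ops = is_comb_cadd is_comb_cdiff is_comb_cscale is_comb_cmul is_comb_csq

lemma is_comb_nonadj: "0 < l \<Longrightarrow> is_comb (nonadj_comb l)"
  by (simp add: nonadj_comb_def is_comb_ops)

lemma is_comb_goodman: "0 < l \<Longrightarrow> is_comb (goodman_comb l)"
  by (simp add: goodman_comb_def is_comb_ops)

lemma is_comb_diff: "is_comb diff_comb"
  by (simp add: diff_comb_def is_comb_ops is_comb_nonadj)

lemma is_comb_gap: "is_comb gap_comb"
  by (simp add: gap_comb_def is_comb_ops is_comb_nonadj is_comb_diff)

lemma is_comb_rooted_witness: "is_comb rooted_witness"
  by (simp add: rooted_witness_def is_comb_ops is_comb_nonadj is_comb_diff is_comb_gap is_comb_goodman)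

lemma wcomb_ops:
  "is_comb f \<Longrightarrow> is_comb g \<Longrightarrow> wcomb V w E \<phi> (cadd f g) = wcomb V w E \<phi> f + wcomb V w E \<phi> g"
  "is_comb f \<Longrightarrow> is_comb g \<Longrightarrow> wcomb V w E \<phi> (cdiff f g) = wcomb V w E \<phi> f - wcomb V w E \<phi> g"
  "is_comb f \<Longrightarrow> wcomb V w E \<phi> (cscale r f) = r * wcomb V w E \<phi> f"
  "is_comb f \<Longrightarrow> wcomb V w E \<phi> (csq f) = wcomb V w E \<phi> f ^ 2"
  by (auto simp: is_comb_def wcomb_cadd wcomb_cdiff wcomb_cscale csq_def wcomb_cmul power2_eq_square)

definition root_wt :: "('p \<Rightarrow> real) \<Rightarrow> ('p \<Rightarrow> 'p \<Rightarrow> bool) \<Rightarrow> 'p \<Rightarrow> 'p \<Rightarrow> real" where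
  "root_wt w E r p = w p * of_bool (E r p)"

lemma wcomb_rooted_K2:
  assumes "\<And>p q. E p q \<longleftrightarrow> E q p"
  shows "wcomb V w E \<phi> (rooted_K2 l) = sum (root_wt w E (\<phi> l)) V"
proof -
  let ?H = "PG {0, 1} {{0, 1}} (\<lambda>v. if v = 0 then Some l else None)"
  have U: "unlabeled ?H = {1}" by (auto simp: unlabeled_def)
  have hom: "is_hom E ?H \<xi> = of_bool (E (\<xi> 0) (\<xi> 1))" for \<xi>
    unfolding is_hom_def using assms by (intro arg_cong[where f = of_bool]) (auto simp: doubleton_eq_iff)
  show ?thesis
    unfolding rooted_K2_def wcomb_ind wdens_def U by (simp add: hom label_ext_def root_wt_def del: One_nat_def)
qed

lemma wcomb_rooted_K3:
  assumes "\<And>p q. E p q \<longleftrightarrow> E q p"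
  shows "wcomb V w E \<phi> (rooted_K3 l) = edge_form V E (root_wt w E (\<phi> l)) (root_wt w E (\<phi> l))"
proof -
  let ?H = "PG {0, 1, 2} {{0, 1}, {0, 2}, {1, 2}} (\<lambda>v. if v = 0 then Some l else None)"
  have U: "unlabeled ?H = {1, 2}" by (auto simp: unlabeled_def)
  have hom: "is_hom E ?H \<xi> = of_bool (E (\<xi> 0) (\<xi> 1)) * (of_bool (E (\<xi> 0) (\<xi> 2)) * of_bool (E (\<xi> 1) (\<xi> 2)))" for \<xi>
    unfolding is_hom_def of_bool_conj[symmetric] using assms
    by (intro arg_cong[where f = of_bool]) (auto simp: doubleton_eq_iff)
  show ?thesis
    unfolding rooted_K3_def wcomb_ind wdens_def U
    by (simp add: wavg_insert hom label_ext_def root_wt_def edge_form_def sum_distrib_left mult_ac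
      del: One_nat_def)
qed

lemma wcomb_rooted_K4:
  assumes "\<And>p q. E p q \<longleftrightarrow> E q p"
  shows "wcomb V w E \<phi> (rooted_K4 l) =
    tri_form V E (root_wt w E (\<phi> l)) (root_wt w E (\<phi> l)) (root_wt w E (\<phi> l))"
proof -
  let ?H = "PG {0, 1, 2, 3} {{0, 1}, {0, 2}, {0, 3}, {1, 2}, {1, 3}, {2, 3}} (\<lambda>v. if v = 0 then Some l else None)"
  have U: "unlabeled ?H = {1, 2, 3}" by (auto simp: unlabeled_def)
  have hom: "is_hom E ?H \<xi> = of_bool (E (\<xi> 0) (\<xi> 1)) * (of_bool (E (\<xi> 0) (\<xi> 2)) * (of_bool (E (\<xi> 0) (\<xi> 3)) *
      (of_bool (E (\<xi> 1) (\<xi> 2)) * (of_bool (E (\<xi> 2) (\<xi> 3)) * of_bool (E (\<xi> 1) (\<xi> 3))))))" for \<xi>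
    unfolding is_hom_def of_bool_conj[symmetric] using assms
    by (intro arg_cong[where f = of_bool]) (auto simp: doubleton_eq_iff)
  show ?thesis
    unfolding rooted_K4_def wcomb_ind wdens_def U
    by (simp add: wavg_insert hom label_ext_def root_wt_def tri_form_eq sum_distrib_left mult_ac
      del: One_nat_def)
qed

definition root_poly :: "'p set \<Rightarrow> ('p \<Rightarrow> real) \<Rightarrow> ('p \<Rightarrow> 'p \<Rightarrow> bool) \<Rightarrow> 'p \<Rightarrow> 'p \<Rightarrow> real" where
  "root_poly V w E r s = (let x = root_wt w E r; y = root_wt w E s in
     witness_poly (sum x V) (edge_form V E x x) (tri_form V E x x x) (sum y V) (edge_form V E y y) (tri_form V E y y y))"

lemma wcomb_rooted_witness:
  assumes "\<And>p q. E p q \<longleftrightarrow> E q p"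
  shows "wcomb V w E \<phi> rooted_witness = root_poly V w E (\<phi> 1) (\<phi> 2)"
proof -
  have p4: "(x ^ 2) ^ 2 = x ^ 4" and p3: "x * x ^ 2 = x ^ 3" for x :: real
    by (simp_all add: power2_eq_square power3_eq_cube power4_eq_xxxx)
  show ?thesis
    unfolding rooted_witness_def gap_comb_def diff_comb_def goodman_comb_def nonadj_comb_def root_poly_def witness_poly_def Let_def
    by (simp add: is_comb_ops wcomb_ops wcomb_cmul wcomb_rooted_K2[OF assms] wcomb_rooted_K3[OF assms]
        wcomb_rooted_K4[OF assms] p4 p3 del: power_mult_distrib)
qed

lemma wcomb_witness:
  assumes "\<And>p q. E p q \<longleftrightarrow> E q p" "sum w V = 1"
  shows "wcomb V w E \<phi> witness = (\<Sum>r\<in>V. w r * (\<Sum>s\<in>V. w s * root_poly V w E r s))"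
proof -
  let ?L = "{1, 2} \<union> (\<Union>H\<in>supp rooted_witness. labels H)"
  have fin: "finite ?L"
    using is_comb_rooted_witness by (auto simp: is_comb_def finite_labels)
  have "wcomb V w E \<phi> witness = wavg V w ?L (\<lambda>\<phi>. wcomb V w E \<phi> rooted_witness) \<phi>"
    unfolding witness_def using is_comb_rooted_witness fin assms(2) by (intro wcomb_cunl) auto
  also have "\<dots> = wavg V w {1, 2} (\<lambda>\<phi>. root_poly V w E (\<phi> 1) (\<phi> 2)) \<phi>"
    unfolding wcomb_rooted_witness[where E = E, OF assms(1)]
    by (rule wavg_superset) (use fin assms(2) in auto)
  also have "\<dots> = (\<Sum>r\<in>V. w r * (\<Sum>s\<in>V. w s * root_poly V w E r s))"
    by (simp add: wavg_insert)
  finally show ?thesis .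
qed

section \<open>Membership and positivity of the witness\<close>

lemma inA_witness: "inA {} witness"
  unfolding witness_def by (rule inA_cunl_empty[OF is_comb_rooted_witness])

text \<open>Only |d| < 1 needs an argument. Near 0 the polynomial is at least -d^2; towards -1 and 1
  it is at least -(1 - d^2)^2, and 1 - |d| is at most the distance of d to any nonzero
  integer.\<close>

lemma integer_shift_bound:
  fixes d :: real and j :: int
  shows "0 \<le> d ^ 2 * (d ^ 2 - 1) ^ 3 + 4 * (d - real_of_int j) ^ 2"
proof (cases "\<bar>d\<bar> < 1")
  case False
  then have "1 \<le> d ^ 2" by (metis abs_le_square_iff abs_one not_le one_power2)
  then show ?thesis by simp
next
  case True
  then have d1: "d ^ 2 < 1" by (simp add: abs_square_less_1)
  let ?q = "1 - d ^ 2"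
  have q: "0 \<le> ?q" "?q \<le> 1" using d1 by auto
  have cube: "(d ^ 2 - 1) ^ 3 = - (?q ^ 3)"
    by (metis minus_diff_eq power_minus_odd odd_numeral)
  have "d ^ 2 * ?q ^ 3 \<le> 4 * (d - real_of_int j) ^ 2"
  proof (cases "j = 0")
    case True
    have "?q ^ 3 \<le> 1" using q by (intro power_le_one)
    then have "d ^ 2 * ?q ^ 3 \<le> d ^ 2" by (simp add: mult_left_le)
    also have "\<dots> \<le> 4 * (d - real_of_int j) ^ 2" using True by simp
    finally show ?thesis .
  next
    case False
    then have "1 \<le> \<bar>real_of_int j\<bar>" by linarith
    then have "1 - \<bar>d\<bar> \<le> \<bar>d - real_of_int j\<bar>" by linarith
    then have dist: "(1 - \<bar>d\<bar>) ^ 2 \<le> (d - real_of_int j) ^ 2"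
      using True by (metis abs_ge_zero abs_of_nonneg diff_ge_0_iff_ge less_imp_le power2_abs power_mono)
    \<comment> \<open>The cube leaves a full square of 1 - |d| to compare with; the constant 4
      bounds (1 + |d|)^2.\<close>
    have "d ^ 2 * ?q ^ 3 \<le> 1 * ?q ^ 2"
      using d1 q power_decreasing[of 2 3 ?q] by (intro mult_mono) auto
    also have "\<dots> = ((1 - \<bar>d\<bar>) * (1 + \<bar>d\<bar>)) ^ 2"
      by (simp add: algebra_simps flip: power2_eq_square)
    also have "\<dots> = (1 - \<bar>d\<bar>) ^ 2 * (1 + \<bar>d\<bar>) ^ 2"
      by (rule power_mult_distrib)
    also have "\<dots> \<le> (1 - \<bar>d\<bar>) ^ 2 * 2 ^ 2"
      using True by (intro mult_left_mono power_mono) auto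
    also have "\<dots> \<le> (d - real_of_int j) ^ 2 * 2 ^ 2"
      using dist by (rule mult_right_mono) simp
    finally show ?thesis by simp
  qed
  then show ?thesis by (simp add: cube)
qed

text \<open>Division by the positive factor (F1 F2)^8 turns the claim into the bound for d = b - a
  and the integer k2 - k1. A root without neighbours makes the whole expression zero.\<close>

lemma witness_poly_nonneg:
  assumes "A1 = 0 \<Longrightarrow> e1 = 0" "A2 = 0 \<Longrightarrow> e2 = 0"
    and 1: "A1 \<noteq> 0 \<Longrightarrow> 0 < A1 ^ 2 - e1 \<and> (\<exists>k::nat. (A1 ^ 2 / (A1 ^ 2 - e1) - real k) ^ 2 \<le>
        4 * ((T1 * A1 - 2 * e1 ^ 2 + e1 * A1 ^ 2) * A1 ^ 4 / (A1 ^ 2 - e1) ^ 4))"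
    and 2: "A2 \<noteq> 0 \<Longrightarrow> 0 < A2 ^ 2 - e2 \<and> (\<exists>k::nat. (A2 ^ 2 / (A2 ^ 2 - e2) - real k) ^ 2 \<le>
        4 * ((T2 * A2 - 2 * e2 ^ 2 + e2 * A2 ^ 2) * A2 ^ 4 / (A2 ^ 2 - e2) ^ 4))"
  shows "0 \<le> witness_poly A1 e1 T1 A2 e2 T2"
proof (cases "A1 = 0 \<or> A2 = 0")
  case True
  then show ?thesis using assms(1,2) by (auto simp: witness_poly_def)
next
  case False
  define F1 where "F1 = A1 ^ 2 - e1"
  define F2 where "F2 = A2 ^ 2 - e2"
  define S1 where "S1 = T1 * A1 - 2 * e1 ^ 2 + e1 * A1 ^ 2"
  define S2 where "S2 = T2 * A2 - 2 * e2 ^ 2 + e2 * A2 ^ 2"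
  define a where "a = A1 ^ 2 / F1"
  define b where "b = A2 ^ 2 / F2"
  obtain k1 k2 :: nat where F: "0 < F1" "0 < F2"
    and k: "(a - real k1) ^ 2 \<le> 4 * (S1 * A1 ^ 4 / F1 ^ 4)" "(b - real k2) ^ 2 \<le> 4 * (S2 * A2 ^ 4 / F2 ^ 4)"
    using False 1 2 unfolding a_def b_def F1_def F2_def S1_def S2_def by blast
  define D where "D = F1 * A2 ^ 2 - F2 * A1 ^ 2"
  define d where "d = b - a"
  have D: "D = d * (F1 * F2)"
    using F by (simp add: D_def d_def a_def b_def field_simps)
  have "(d - real_of_int (int k2 - int k1)) ^ 2 \<le> 2 * ((a - real k1) ^ 2 + (b - real k2) ^ 2)"
    using sum_squares_ge_zero[of "(b - real k2) + (a - real k1)" 0]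
    by (simp add: d_def power2_eq_square algebra_simps)
  \<comment> \<open>The 32 of the witness is 4 from the bound for \<open>d\<close>, times 2 from (x
    + y)^2 \<le> 2 (x^2 + y^2), times 4 from the Goodman gap.\<close>
  moreover have "0 \<le> P + 32 * (t + t')" if "q \<le> 2 * (r + s)" "0 \<le> P + 4 * q" "r \<le> 4 * t" "s \<le> 4 * t'"
    for P :: real and q :: real and r :: real and s :: real and t :: real and t' :: real
    using that by argo
  ultimately have "0 \<le> d ^ 2 * (d ^ 2 - 1) ^ 3 + 32 * (S1 * A1 ^ 4 / F1 ^ 4 + S2 * A2 ^ 4 / F2 ^ 4)"
    using integer_shift_bound[of d "int k2 - int k1"] k by blast
  then have "0 \<le> (F1 * F2) ^ 8 * (d ^ 2 * (d ^ 2 - 1) ^ 3 + 32 * (S1 * A1 ^ 4 / F1 ^ 4 + S2 * A2 ^ 4 / F2 ^ 4))"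
    using F by (intro mult_nonneg_nonneg) auto
  also have "\<dots> = D ^ 2 * (D ^ 2 - (F1 * F2) ^ 2) ^ 3
        + 32 * ((F1 * F2) ^ 4 * (S1 * (A1 ^ 4 * F2 ^ 4) + S2 * (A2 ^ 4 * F1 ^ 4)))"
  proof -
    have "(F1 * F2) ^ 8 * (d ^ 2 * (d ^ 2 - 1) ^ 3) = D ^ 2 * (D ^ 2 - (F1 * F2) ^ 2) ^ 3"
    proof -
      have "D ^ 2 - (F1 * F2) ^ 2 = (F1 * F2) ^ 2 * (d ^ 2 - 1)"
        by (simp add: D power_mult_distrib algebra_simps)
      then have "D ^ 2 * (D ^ 2 - (F1 * F2) ^ 2) ^ 3 = (d ^ 2 * (F1 * F2) ^ 2) * (((F1 * F2) ^ 2) ^ 3 * (d ^ 2 - 1) ^ 3)"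
        by (simp only: D power_mult_distrib)
      also have "\<dots> = ((F1 * F2) ^ 2 * ((F1 * F2) ^ 2) ^ 3) * (d ^ 2 * (d ^ 2 - 1) ^ 3)"
        by (simp only: mult_ac)
      also have "(F1 * F2) ^ 2 * ((F1 * F2) ^ 2) ^ 3 = (F1 * F2) ^ 8"
        by (simp flip: power_mult power_add)
      finally show ?thesis by simp
    qed
    moreover have "(F1 * F2) ^ 8 * (S1 * A1 ^ 4 / F1 ^ 4 + S2 * A2 ^ 4 / F2 ^ 4)
       = (F1 * F2) ^ 4 * (S1 * (A1 ^ 4 * F2 ^ 4) + S2 * (A2 ^ 4 * F1 ^ 4))"
    proof -
      have "(F1 * F2) ^ 8 = (F1 * F2) ^ 4 * (F1 ^ 4 * F2 ^ 4)"
        using power_add[of "F1 * F2" 4 4] by (simp add: power_mult_distrib)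
      then show ?thesis using F by (simp add: field_simps)
    qed
    moreover have "c * (X + 32 * Y) = X' + 32 * Y'" if "c * X = X'" "c * Y = Y'" for c X Y X' Y' :: real
      unfolding that[symmetric] by (simp add: distrib_left)
    ultimately show ?thesis by blast
  qed
  finally show ?thesis
    unfolding witness_poly_def Let_def D_def F1_def F2_def S1_def S2_def .
qed

text \<open>Goodman's gap for the neighbourhood of the root, normalized to total weight 1; dividing
  z^2 (1 - k z)^2 by z^4 turns it into the squared distance of 1 / z to k.\<close>

lemma root_gap:
  fixes r :: 'p
  assumes "finite V" "\<And>p q. E p q \<longleftrightarrow> E q p" "\<And>p. \<not> E p p" "\<And>p. p \<in> V \<Longrightarrow> 0 < w p"
  defines "x \<equiv> root_wt w E r"
  defines "A \<equiv> sum x V" and "e \<equiv> edge_form V E x x" and "T \<equiv> tri_form V E x x x"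
  shows "A = 0 \<Longrightarrow> e = 0"
    and "A \<noteq> 0 \<Longrightarrow> 0 < A ^ 2 - e \<and> (\<exists>k::nat. (A ^ 2 / (A ^ 2 - e) - real k) ^ 2 \<le>
        4 * ((T * A - 2 * e ^ 2 + e * A ^ 2) * A ^ 4 / (A ^ 2 - e) ^ 4))"
proof -
  have x: "0 \<le> x p" if "p \<in> V" for p
    using assms(4)[OF that] by (simp add: x_def root_wt_def)
  show "e = 0" if "A = 0"
  proof -
    have "x p = 0" if "p \<in> V" for p
      using \<open>A = 0\<close> sum_nonneg_eq_0_iff[OF assms(1), of x] x that by (simp add: A_def)
    then show ?thesis by (simp add: e_def edge_form_def)
  qed
  assume "A \<noteq> 0"
  then have A: "A > 0"
    using sum_nonneg[of V x] x by (simp add: A_def order_less_le)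
  define y where "y p = x p / A" for p
  have y: "0 \<le> y p" if "p \<in> V" for p using x[OF that] A by (simp add: y_def)
  have y1: "sum y V = 1" using A by (simp add: y_def[abs_def] A_def flip: sum_divide_distrib)
  have e: "edge_form V E y y = e / A ^ 2"
    unfolding edge_form_def e_def y_def sum_divide_distrib sum_distrib_left by (simp add: power2_eq_square mult_ac)
  have T: "tri_form V E y y y = T / A ^ 3"
    unfolding tri_form_eq T_def y_def sum_divide_distrib by (simp add: power3_eq_cube mult_ac)
  define z where "z = 1 - e / A ^ 2"
  have z: "z = (A ^ 2 - e) / A ^ 2" using A by (simp add: z_def diff_divide_distrib)
  \<comment> \<open>A point of positive weight is not adjacent to itself, so the edge density stays
    strictly below 1.\<close>
  have pos: "0 < z"
  proof -
    obtain p where p: "p \<in> V" "x p \<noteq> 0"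
      using \<open>A \<noteq> 0\<close> by (auto simp: A_def dest: sum.not_neutral_contains_not_neutral)
    have "edge_form V E y y < 1"
    proof -
      have le: "y p * (\<Sum>q\<in>V. y q * of_bool (E p q)) \<le> y p * 1" if "p \<in> V" for p
      proof (intro mult_left_mono y that)
        have "(\<Sum>q\<in>V. y q * of_bool (E p q)) \<le> sum y V"
          using y by (intro sum_mono) auto
        then show "(\<Sum>q\<in>V. y q * of_bool (E p q)) \<le> 1" using y1 by simp
      qed
      have "(\<Sum>q\<in>V. y q * of_bool (E p q)) < sum y V"
        using y p x[OF p(1)] A assms(1,3) by (intro sum_strict_mono_ex1) (auto simp: y_def intro!: bexI[of _ p])
      then have "y p * (\<Sum>q\<in>V. y q * of_bool (E p q)) < y p * 1"
        using p x[OF p(1)] A y1 by (intro mult_strict_left_mono) (auto simp: y_def)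
      then have "edge_form V E y y < (\<Sum>p\<in>V. y p * 1)"
        unfolding edge_form_def using le p(1) assms(1) by (intro sum_strict_mono_ex1) auto
      then show ?thesis using y1 by simp
    qed
    then show ?thesis by (simp add: e z_def)
  qed
  then have Fpos: "0 < A ^ 2 - e" using A by (simp add: z zero_less_divide_iff)
  obtain k :: nat where k: "z ^ 2 * (1 - real k * z) ^ 2 \<le> 4 * (T / A ^ 3 - (1 - z) * (1 - 2 * z))"
    using goodman_gap[where V = V and E = E and y = y, OF assms(1-3) y y1] pos unfolding e T z_def by blast
  have "(A ^ 2 / (A ^ 2 - e) - real k) ^ 2 = (z ^ 2 * (1 - real k * z) ^ 2) / z ^ 4"
  proof -
    have "A ^ 2 / (A ^ 2 - e) - real k = (1 - real k * z) / z"
    proof -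
      have "A ^ 2 / (A ^ 2 - e) = 1 / z" by (simp add: z)
      then show ?thesis using pos by (simp add: diff_divide_distrib)
    qed
    then have "(A ^ 2 / (A ^ 2 - e) - real k) ^ 2 = (1 - real k * z) ^ 2 / z ^ 2"
      by (simp only: power_divide)
    also have "\<dots> = (z ^ 2 * (1 - real k * z) ^ 2) / (z ^ 2 * z ^ 2)"
      using pos by (intro mult_divide_mult_cancel_left[symmetric]) simp
    also have "z ^ 2 * z ^ 2 = z ^ 4" by (simp flip: power_add)
    finally show ?thesis .
  qed
  also have "\<dots> \<le> 4 * (T / A ^ 3 - (1 - z) * (1 - 2 * z)) / z ^ 4"
    using k pos by (intro divide_right_mono) auto
  also have "T / A ^ 3 - (1 - z) * (1 - 2 * z) = (T * A - 2 * e ^ 2 + e * A ^ 2) / A ^ 4"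
    using A by (simp add: z_def field_simps power2_eq_square power3_eq_cube power4_eq_xxxx)
  also have "4 * ((T * A - 2 * e ^ 2 + e * A ^ 2) / A ^ 4) / z ^ 4 =
      4 * ((T * A - 2 * e ^ 2 + e * A ^ 2) * A ^ 4 / (A ^ 2 - e) ^ 4)"
    using A Fpos by (simp add: z power_divide field_simps)
  finally show "0 < A ^ 2 - e \<and> (\<exists>k::nat. (A ^ 2 / (A ^ 2 - e) - real k) ^ 2 \<le>
        4 * ((T * A - 2 * e ^ 2 + e * A ^ 2) * A ^ 4 / (A ^ 2 - e) ^ 4))"
    using Fpos by blast
qed

lemma root_poly_nonneg:
  assumes "finite V" "\<And>p q. E p q \<longleftrightarrow> E q p" "\<And>p. \<not> E p p" "\<And>p. p \<in> V \<Longrightarrow> 0 < w p"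
  shows "0 \<le> root_poly V w E r s"
proof -
  note gap = root_gap[where V = V and E = E and w = w, OF assms]
  show ?thesis
    unfolding root_poly_def Let_def by (rule witness_poly_nonneg[OF gap(1) gap(1) gap(2) gap(2)])
qed

lemma positive_witness: "positive {} witness"
  unfolding positive_def
proof (intro allI impI)
  fix G and \<phi> :: "nat \<Rightarrow> nat"
  assume G: "wfgraph G"
  let ?V = "gverts G" and ?w = "\<lambda>_::nat. 1 / real (card (gverts G))" and ?E = "\<lambda>x y. {x, y} \<in> gedges G"
  have V: "finite ?V" "?V \<noteq> {}" using G by (auto simp: wfgraph_def)
  have sym: "?E p q \<longleftrightarrow> ?E q p" for p q by (simp add: insert_commute)
  have irrefl: "\<not> ?E p p" for p
  proof
    assume "{p, p} \<in> gedges G"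
    then obtain u v where "{p, p} = {u, v}" "u \<noteq> v" using G unfolding wfgraph_def by meson
    then show False by (auto simp: doubleton_eq_iff)
  qed
  have w: "0 < ?w p" for p using V by (simp add: card_gt_0_iff)
  have "sum ?w ?V = 1" using V by simp
  then have "tcomb witness G \<phi> = (\<Sum>r\<in>?V. ?w r * (\<Sum>s\<in>?V. ?w s * root_poly ?V ?w ?E r s))"
    unfolding tcomb_eq_wcomb[OF inA_witness G] by (intro wcomb_witness sym)
  also have "0 \<le> \<dots>"
    using w less_imp_le[OF w] by (intro sum_nonneg mult_nonneg_nonneg root_poly_nonneg[OF V(1) sym irrefl]) auto
  finally show "0 \<le> tcomb witness G \<phi>" .
qed

section \<open>Evaluation at two cliques\<close>

lemma poly3_power: "poly3 P \<Longrightarrow> poly3 (\<lambda>u v e. P u v e ^ k)"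
  by (induction k) (auto intro: poly3.intros)

text \<open>Two roots in cliques of weight 1/2 and sizes 1 / u and 1 / v. With k = (1 - u) (1 - v) /
  16 one has F1 F2 = k u v and D = k (u - v), so for nonzero u and v this is (F1 F2)^8 d^2 (d^2 -
  1)^3 with d = 1 / v - 1 / u.\<close>

definition clique_value :: "real \<Rightarrow> real \<Rightarrow> real" where
  "clique_value u v = ((1 - u) * (1 - v) * (1 / 16)) ^ 8 * ((u - v) ^ 2 * ((u - v) ^ 2 - (u * v) ^ 2) ^ 3)"

text \<open>Cliques attain Goodman's bound, so both correction terms vanish (fact \<open>S\<close>),
  and they do so identically in real \<open>u\<close> and \<open>v\<close>.\<close>

lemma witness_poly_clique:
  "witness_poly ((1 - u) / 2) ((1 - u) * (1 - 2 * u) / 4) ((1 - u) * (1 - 2 * u) * (1 - 3 * u) / 8)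
     ((1 - v) / 2) ((1 - v) * (1 - 2 * v) / 4) ((1 - v) * (1 - 2 * v) * (1 - 3 * v) / 8) = clique_value u v"
proof -
  have F: "((1 - t) / 2) ^ 2 - (1 - t) * (1 - 2 * t) / 4 = (1 - t) * t / 4" for t :: real
    by (simp add: power2_eq_square field_simps)
  have S: "(1 - t) * (1 - 2 * t) * (1 - 3 * t) / 8 * ((1 - t) / 2) - 2 * ((1 - t) * (1 - 2 * t) / 4) ^ 2
      + (1 - t) * (1 - 2 * t) / 4 * ((1 - t) / 2) ^ 2 = 0" for t :: real
    by (simp add: power2_eq_square field_simps)
  let ?k = "(1 - u) * (1 - v) * (1 / 16)"
  have D: "(1 - u) * u / 4 * ((1 - v) / 2) ^ 2 - (1 - v) * v / 4 * ((1 - u) / 2) ^ 2 = ?k * (u - v)"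
    by (simp add: power2_eq_square field_simps)
  have FF: "(1 - u) * u / 4 * ((1 - v) * v / 4) = ?k * (u * v)"
    by simp
  have "(k * p) ^ 2 * ((k * p) ^ 2 - (k * q) ^ 2) ^ 3 + 32 * ((k * q) ^ 4 * (0 * x + 0 * y)) =
      k ^ 8 * (p ^ 2 * (p ^ 2 - q ^ 2) ^ 3)" for k p q x y :: real
  proof -
    have "(k * p) ^ 2 - (k * q) ^ 2 = k ^ 2 * (p ^ 2 - q ^ 2)"
      by (simp add: power_mult_distrib right_diff_distrib)
    then show ?thesis by (simp add: power_mult_distrib flip: power_mult power_add)
  qed
  then show ?thesis
    unfolding witness_poly_def Let_def F S D FF clique_value_def .
qed

text \<open>The sizes differ by d = 1/2, that is, u - v = u v / 2.\<close>

lemma clique_value_neg: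
  assumes "1 < M"
  shows "clique_value (1 / M) (1 / (M + 1 / 2)) < 0"
proof -
  define u where "u = 1 / M"
  define v where "v = 1 / (M + 1 / 2)"
  have uv: "0 < u" "u < 1" "0 < v" "v < 1" using assms by (auto simp: u_def v_def)
  have "u - v = u * v * (1 / 2)" using assms by (simp add: u_def v_def field_simps)
  then have "(u - v) ^ 2 = (u * v) ^ 2 * (1 / 4)" by (simp only: power_mult_distrib) (simp add: power2_eq_square)
  moreover have "s * (s - t) ^ 3 = - (t * (1 / 4) * (t * (3 / 4)) ^ 3)" if "s = t * (1 / 4)" for s t :: real
    unfolding that by (simp add: power3_eq_cube)
  ultimately have "(u - v) ^ 2 * ((u - v) ^ 2 - (u * v) ^ 2) ^ 3 = - ((u * v) ^ 2 * (1 / 4) * ((u * v) ^ 2 * (3 / 4)) ^ 3)"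
    by blast
  then have "clique_value u v = - (((1 - u) * (1 - v) * (1 / 16)) ^ 8 * ((u * v) ^ 2 * (1 / 4) * ((u * v) ^ 2 * (3 / 4)) ^ 3))"
    by (simp only: clique_value_def mult_minus_right)
  moreover have "0 < ((1 - u) * (1 - v) * (1 / 16)) ^ 8 * ((u * v) ^ 2 * (1 / 4) * ((u * v) ^ 2 * (3 / 4)) ^ 3)"
    using uv by (intro mult_pos_pos zero_less_power) auto
  ultimately show ?thesis unfolding u_def v_def by linarith
qed

lemma sum_clique_part:
  fixes c :: real
  assumes "finite X" "X \<subseteq> {..<a}"
  shows "(\<Sum>i<a. if i \<in> X then 0 else c) = (real a - real (card X)) * c"
proof -
  have "(\<Sum>i<a. if i \<in> X then 0 else c) = (\<Sum>i\<in>{..<a} - X. c)"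
    by (rule sum.mono_neutral_cong_right) (use assms in auto)
  then show ?thesis
    using assms card_mono[of "{..<a}" X] by (simp add: card_Diff_subset of_nat_diff)
qed

context mixture
begin

lemma mixE_sym: "(\<And>x y. E0 x y \<Longrightarrow> E0 y x) \<Longrightarrow> mixE p q \<longleftrightarrow> mixE q p"
  by (auto simp: mixE_def)

text \<open>Without the fixed graph the neighbourhood of a root is its clique minus the root, each
  point having weight u / 2. Every further vertex excludes one more point, hence the factors 1 - u,
  1 - 2 u and 1 - 3 u.\<close>

lemma root_forms:
  fixes s c a b :: nat
  defines "n \<equiv> if s = 0 then a else b"
  assumes "s < 2" "c < n"
  defines "x \<equiv> root_wt (mixw a b 0) mixE (s, c)" and "u \<equiv> 1 / real n"
  shows "sum x (mixV a b) = (1 - u) / 2"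
    and "edge_form (mixV a b) mixE x x = (1 - u) * (1 - 2 * u) / 4"
    and "tri_form (mixV a b) mixE x x x = (1 - u) * (1 - 2 * u) * (1 - 3 * u) / 8"
proof -
  have x0: "x (s, i) = (if i \<in> {c} then 0 else u / 2)" for i
    using assms(2) by (auto simp: x_def root_wt_def mixw_def mixE_def u_def n_def)
  have x1: "x (t, i) = 0" if "t \<noteq> s" for t i
    using that by (simp add: x_def root_wt_def mixE_def assms(2))
  have ua: "real n * u = 1" using assms(3) by (simp add: u_def)
  have S: "(\<Sum>p\<in>mixV a b. x p * f p) = (\<Sum>i<n. x (s, i) * f (s, i))" for f
    using assms(2) by (cases "s = 0") (simp_all add: sum_mixV x1 n_def less_2_cases_iff)
  have cnt: "(real n - k) * (u / 2) = (1 - k * u) / 2" for k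
    using ua by (simp add: algebra_simps)
  have s1: "(\<Sum>i<n. if i \<in> X then 0 else u / 2) = (1 - real (card X) * u) / 2" if "X \<subseteq> {..<n}" for X
    using sum_clique_part[of X n "u / 2"] finite_subset[OF that] that cnt by simp
  have "sum x (mixV a b) = (\<Sum>i<n. if i \<in> {c} then 0 else u / 2)"
    using S[of "\<lambda>_. 1"] by (simp add: x0)
  then show A: "sum x (mixV a b) = (1 - u) / 2"
    using s1[of "{c}"] assms(3) by simp
  have inner: "(\<Sum>q\<in>mixV a b. x q * of_bool (mixE (s, i) q)) = (1 - 2 * u) / 2" if "i < n" "i \<noteq> c" for i
  proof -
    have "(\<Sum>q\<in>mixV a b. x q * of_bool (mixE (s, i) q)) = (\<Sum>j<n. if j \<in> {c, i} then 0 else u / 2)"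
      unfolding S by (intro sum.cong refl) (auto simp: x0 mixE_def assms(2))
    then show ?thesis using s1[of "{c, i}"] that assms(3) by (simp add: card_insert_if)
  qed
  have "edge_form (mixV a b) mixE x x = (\<Sum>i<n. (if i \<in> {c} then 0 else u / 2) * ((1 - 2 * u) / 2))"
    unfolding edge_form_def S[of "\<lambda>p. \<Sum>q\<in>mixV a b. x q * of_bool (mixE p q)"] by (intro sum.cong refl) (auto simp: x0 inner)
  also have "\<dots> = (1 - u) / 2 * ((1 - 2 * u) / 2)"
    unfolding sum_distrib_right[symmetric] using s1[of "{c}"] assms(3) by simp
  finally show "edge_form (mixV a b) mixE x x = (1 - u) * (1 - 2 * u) / 4" by simp
  have inner2: "(\<Sum>r\<in>mixV a b. x r * of_bool (mixE (s, j) r \<and> mixE (s, i) r)) = (1 - 3 * u) / 2"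
    if "i < n" "i \<noteq> c" "j < n" "j \<noteq> c" "i \<noteq> j" for i j
  proof -
    have "(\<Sum>r\<in>mixV a b. x r * of_bool (mixE (s, j) r \<and> mixE (s, i) r)) = (\<Sum>k<n. if k \<in> {c, i, j} then 0 else u / 2)"
      unfolding S by (intro sum.cong refl) (auto simp: x0 mixE_def assms(2))
    then show ?thesis using s1[of "{c, i, j}"] that assms(3) by (simp add: card_insert_if)
  qed
  have inner1: "(\<Sum>q\<in>mixV a b. x q * of_bool (mixE (s, i) q) * (\<Sum>r\<in>mixV a b. x r * of_bool (mixE q r \<and> mixE (s, i) r)))
      = (1 - 2 * u) / 2 * ((1 - 3 * u) / 2)" if "i < n" "i \<noteq> c" for i
  proof -
    have "(\<Sum>q\<in>mixV a b. x q * of_bool (mixE (s, i) q) * (\<Sum>r\<in>mixV a b. x r * of_bool (mixE q r \<and> mixE (s, i) r)))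
       = (\<Sum>j<n. (if j \<in> {c, i} then 0 else u / 2) * ((1 - 3 * u) / 2))"
      unfolding mult.assoc S[of "\<lambda>q. of_bool (mixE (s, i) q) * (\<Sum>r\<in>mixV a b. x r * of_bool (mixE q r \<and> mixE (s, i) r))"] by (intro sum.cong refl) (use that in \<open>auto simp: x0 mixE_def[of "(s, i)" "(s, _)"] assms(2) inner2\<close>)
    also have "\<dots> = (1 - 2 * u) / 2 * ((1 - 3 * u) / 2)"
      unfolding sum_distrib_right[symmetric] using s1[of "{c, i}"] that assms(3) by (simp add: card_insert_if)
    finally show ?thesis .
  qed
  have "tri_form (mixV a b) mixE x x x = (\<Sum>i<n. (if i \<in> {c} then 0 else u / 2) * ((1 - 2 * u) / 2 * ((1 - 3 * u) / 2)))"
    unfolding tri_form_def S[of "\<lambda>p. \<Sum>q\<in>mixV a b. x q * of_bool (mixE p q) *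
      (\<Sum>r\<in>mixV a b. x r * of_bool (mixE q r \<and> mixE p r))"] by (intro sum.cong refl) (auto simp: x0 inner1)
  also have "\<dots> = (1 - u) / 2 * ((1 - 2 * u) / 2 * ((1 - 3 * u) / 2))"
    unfolding sum_distrib_right[symmetric] using s1[of "{c}"] assms(3) by simp
  finally show "tri_form (mixV a b) mixE x x x = (1 - u) * (1 - 2 * u) * (1 - 3 * u) / 8" by simp
qed

text \<open>Two roots in the same clique have d = 0 and contribute nothing; the two mixed orders
  have probability 1/4 each.\<close>

lemma mixcomb_witness_0:
  assumes "\<And>x y. E0 x y \<Longrightarrow> E0 y x" "a \<ge> 1" "b \<ge> 1"
  shows "mixcomb a b 0 \<phi> witness = clique_value (1 / real a) (1 / real b) / 2"
proof -
  let ?V = "mixV a b" and ?w = "mixw a b 0"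
  define n where "n s = (if s = 0 then a else b)" for s :: nat
  have val: "root_poly ?V ?w mixE (s, c) (s', c') = clique_value (1 / real (n s)) (1 / real (n s'))"
    if "s < 2" "c < n s" "s' < 2" "c' < n s'" for s c s' c'
    unfolding root_poly_def Let_def n_def root_forms[OF that(1) that(2)[unfolded n_def]]
      root_forms[OF that(3) that(4)[unfolded n_def]] witness_poly_clique ..
  have S: "(\<Sum>p\<in>?V. ?w p * f p) = (\<Sum>c<n 0. f (0, c)) / (2 * real (n 0)) + (\<Sum>c<n 1. f (1, c)) / (2 * real (n 1))" for f
    by (simp add: sum_mixV mixw_def n_def sum_divide_distrib)
  have vv: "clique_value u u = 0" for u by (simp add: clique_value_def)
  have comm: "clique_value u v = clique_value v u" for u v
    by (simp add: clique_value_def mult.commute power2_commute)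
  have pos: "real (n 0) \<noteq> 0" "real (n 1) \<noteq> 0" using assms by (auto simp: n_def)
  have inner: "(\<Sum>p\<in>?V. ?w p * root_poly ?V ?w mixE (s, c) p) = clique_value (1 / real (n 0)) (1 / real (n 1)) / 2"
    if "s < 2" "c < n s" for s c
  proof -
    have "(\<Sum>p\<in>?V. ?w p * root_poly ?V ?w mixE (s, c) p) =
        clique_value (1 / real (n s)) (1 / real (n 0)) / 2 + clique_value (1 / real (n s)) (1 / real (n 1)) / 2"
      unfolding S using that pos by (simp add: val)
    moreover have "s = 0 \<or> s = 1" using that(1) by auto
    ultimately show ?thesis using comm vv by auto
  qed
  have "mixcomb a b 0 \<phi> witness = (\<Sum>r\<in>?V. ?w r * (\<Sum>s\<in>?V. ?w s * root_poly ?V ?w mixE r s))"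
    using mixE_sym[OF assms(1)] sum_mixw[OF assms(2,3)] by (intro wcomb_witness) auto
  also have "\<dots> = clique_value (1 / real (n 0)) (1 / real (n 1)) / 2"
    unfolding S[of "\<lambda>r. \<Sum>s\<in>?V. ?w s * root_poly ?V ?w mixE r s"] using pos by (simp add: inner)
  finally show ?thesis by (simp add: n_def)
qed

lemma mixcomb_1:
  assumes "is_comb f"
  shows "mixcomb a b 1 (\<lambda>l. (2, \<phi> l)) f = wcomb V0 (\<lambda>_. 1 / real (card V0)) E0 \<phi> f"
  unfolding wcomb_def
proof (intro sum.cong refl arg_cong2[where f = "(*)"])
  fix H assume "H \<in> supp f"
  then have wf: "wfpg H" using assms by (simp add: is_comb_def)
  have hom: "is_hom mixE H (Pair 2 \<circ> \<eta>) = is_hom E0 H \<eta>" for \<eta>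
    by (simp add: is_hom_def mixE_def)
  have "mixdens a b 1 (\<lambda>l. (2, \<phi> l)) H =
      wavg (mixV a b) (mixw a b 1) (unlabeled H) (is_hom mixE H) (Pair 2 \<circ> label_ext H \<phi>)"
    by (rule wdens_cong_ext[OF wf]) (simp add: label_ext_def)
  also have "\<dots> = wavg V0 (\<lambda>_. 1 / real (card V0)) (unlabeled H) (\<lambda>\<eta>. is_hom mixE H (Pair 2 \<circ> \<eta>)) (label_ext H \<phi>)"
    by (rule wavg_embed) (auto simp: finite_unlabeled[OF wf] mixV_def finite_V0 mixw_def inj_on_def)
  finally show "mixdens a b 1 (\<lambda>l. (2, \<phi> l)) H = wdens V0 (\<lambda>_. 1 / real (card V0)) E0 \<phi> H"
    by (simp add: hom wdens_def)
qed

end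

theorem theorem2p4:
  shows "\<exists>x. inA {} x \<and> positive {} x \<and>
           \<not> (\<exists>g h. inA {} g \<and> inA {} h \<and> sos g \<and> sos h \<and> \<not> aeq g czero
                     \<and> aeq (cmul g x) h)"
proof (intro exI[of _ witness] conjI inA_witness positive_witness notI)
  assume "\<exists>g h. inA {} g \<and> inA {} h \<and> sos g \<and> sos h \<and> \<not> aeq g czero \<and> aeq (cmul g witness) h"
  then obtain g h where gh: "inA {} g" "inA {} h" "sos g" "sos h" "\<not> aeq g czero" "aeq (cmul g witness) h"
    by (elim exE conjE)
  obtain V0 :: "nat set" and E0 where V0: "finite V0" "V0 \<noteq> {}" and sym: "\<And>x y. E0 x y \<Longrightarrow> E0 y x"
    and nz: "\<And>\<phi>. wcomb V0 (\<lambda>_. 1 / real (card V0)) E0 \<phi> g \<noteq> 0"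
    using nonzero_density[OF gh(1,5)] by metis
  interpret mixture V0 E0 using V0 by unfold_locales
  \<comment> \<open>A constant placement in the fixed part, of the shape to which
    \<open>mixcomb_1\<close> applies.\<close>
  define \<phi> :: "nat \<Rightarrow> nat \<times> nat" where "\<phi> = (\<lambda>_. (2, 0))"
  define \<gamma> where "\<gamma> = wcomb V0 (\<lambda>_. 1 / real (card V0)) E0 (\<lambda>_. 0) g"
  obtain Qg ng Ng where Qg: "poly3 Qg"
    "\<And>a b e. a \<ge> ng \<Longrightarrow> b \<ge> ng \<Longrightarrow> mixcomb a b e \<phi> g = Qg (1 / real a) (1 / real b) e"
    "\<And>u v e. 0 \<le> u \<Longrightarrow> real Ng * u \<le> 1 \<Longrightarrow> 0 \<le> v \<Longrightarrow> real Ng * v \<le> 1 \<Longrightarrow> 0 \<le> e \<Longrightarrow> e \<le> 1 \<Longrightarrow> 0 \<le> Qg u v e"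
    using mixcomb_sos_poly[OF gh(3,1)] by metis
  obtain Qh nh Nh where Qh: "poly3 Qh"
    "\<And>a b e. a \<ge> nh \<Longrightarrow> b \<ge> nh \<Longrightarrow> mixcomb a b e \<phi> h = Qh (1 / real a) (1 / real b) e"
    "\<And>u v e. 0 \<le> u \<Longrightarrow> real Nh * u \<le> 1 \<Longrightarrow> 0 \<le> v \<Longrightarrow> real Nh * v \<le> 1 \<Longrightarrow> 0 \<le> e \<Longrightarrow> e \<le> 1 \<Longrightarrow> 0 \<le> Qh u v e"
    using mixcomb_sos_poly[OF gh(4,2)] by metis
  obtain Qx nx where Qx: "poly3 Qx"
    "\<And>a b e. a \<ge> nx \<Longrightarrow> b \<ge> nx \<Longrightarrow> mixcomb a b e \<phi> witness = Qx (1 / real a) (1 / real b) e"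
    using mixcomb_poly[OF inA_witness] by metis
  \<comment> \<open>The summand 1 makes both cliques nonempty, so that the mixture has total weight
    1.\<close>
  define n where "n = ng + nh + nx + 1"
  have comb: "is_comb g" "is_comb h" "is_comb witness" using gh(1,2) inA_witness by (auto simp: inA_def)
  have "Qg u v e * Qx u v e - Qh u v e = 0" for u v e
  proof (rule poly3_eq_0_if_grid[of "\<lambda>u v e. Qg u v e * Qx u v e - Qh u v e" n])
    show "poly3 (\<lambda>u v e. Qg u v e * Qx u v e - Qh u v e)"
      by (intro poly3_diff poly3.mult Qg(1) Qx(1) Qh(1))
    show "\<forall>a\<ge>n. \<forall>b\<ge>n. Qg (1 / real a) (1 / real b) e * Qx (1 / real a) (1 / real b) e - Qh (1 / real a) (1 / real b) e = 0"
    proof (intro allI impI)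
      fix a b assume ab: "n \<le> a" "n \<le> b"
      have "mixcomb a b e \<phi> (cmul g witness) = mixcomb a b e \<phi> h"
        using gh(6) comb is_comb_cmul[OF comb(1,3)] sum_mixw[of a b e] ab
        by (intro wcomb_aeq) (auto simp: is_comb_def n_def)
      then show "Qg (1 / real a) (1 / real b) e * Qx (1 / real a) (1 / real b) e - Qh (1 / real a) (1 / real b) e = 0"
        unfolding wcomb_cmul[OF comb(1,3)]
        using Qg(2)[of a b e] Qh(2)[of a b e] Qx(2)[of a b e] ab by (simp add: n_def)
    qed
  qed
  then have prod: "Qg u v e * Qx u v e = Qh u v e" for u v e by simp
  have "Qx u v 0 - clique_value u v * (1 / 2) = 0" for u v
  proof (rule poly3_eq_0_if_grid[of "\<lambda>u v e. Qx u v e - clique_value u v * (1 / 2)" n])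
    show "poly3 (\<lambda>u v e. Qx u v e - clique_value u v * (1 / 2))"
      unfolding clique_value_def by (intro poly3_diff poly3.mult poly3_power Qx(1) poly3.intros(1-4))
    show "\<forall>a\<ge>n. \<forall>b\<ge>n. Qx (1 / real a) (1 / real b) 0 - clique_value (1 / real a) (1 / real b) * (1 / 2) = 0"
    proof (intro allI impI)
      fix a b assume "n \<le> a" "n \<le> b"
      then show "Qx (1 / real a) (1 / real b) 0 - clique_value (1 / real a) (1 / real b) * (1 / 2) = 0"
        using Qx(2)[of a b 0] mixcomb_witness_0[where a = a and b = b and \<phi> = \<phi>, OF sym] by (simp add: n_def)
    qed
  qed
  then have Qx0: "Qx u v 0 = clique_value u v * (1 / 2)" for u v by simp
  have "Qg u v 1 - \<gamma> = 0" for u v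
  proof (rule poly3_eq_0_if_grid[of "\<lambda>u v e. Qg u v e - \<gamma>" n])
    show "poly3 (\<lambda>u v e. Qg u v e - \<gamma>)" by (intro poly3_diff Qg(1) poly3.const)
    show "\<forall>a\<ge>n. \<forall>b\<ge>n. Qg (1 / real a) (1 / real b) 1 - \<gamma> = 0"
    proof (intro allI impI)
      fix a b assume "n \<le> a" "n \<le> b"
      then show "Qg (1 / real a) (1 / real b) 1 - \<gamma> = 0"
        using Qg(2)[of a b 1] mixcomb_1[OF comb(1), of a b "\<lambda>_. 0"] by (simp add: n_def \<phi>_def \<gamma>_def)
    qed
  qed
  then have Qg1: "Qg u v 1 = \<gamma>" for u v by simp
  \<comment> \<open>Beyond the bounds of both certificates, so \<open>Qg\<close> and
    \<open>Qh\<close> are nonnegative at the sizes M and M + 1/2; the summand 2 ensures M >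
    1.\<close>
  define M where "M = real (Ng + Nh + 2)"
  define u where "u = 1 / M"
  define v where "v = 1 / (M + 1 / 2)"
  have uv: "0 \<le> u" "real Ng * u \<le> 1" "real Nh * u \<le> 1" "0 \<le> v" "real Ng * v \<le> 1" "real Nh * v \<le> 1"
    by (auto simp: u_def v_def M_def field_simps)
  have neg: "Qx u v 0 < 0"
    using clique_value_neg[of M] by (simp add: Qx0 u_def v_def M_def)
  obtain px where px: "\<And>e. poly px e = Qx u v e" using poly3_slice3[OF Qx(1)] by metis
  obtain pg where pg: "\<And>e. poly pg e = Qg u v e" using poly3_slice3[OF Qg(1)] by metis
  \<comment> \<open>At e = 1 only the fixed graph is left, where \<open>g\<close> does not
    vanish.\<close>
  have "pg \<noteq> 0" using pg[of 1] Qg1[of u v] nz[of "\<lambda>_. 0"] by (auto simp: \<gamma>_def)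
  then have fin: "finite {e. poly pg e = 0}" by (rule poly_roots_finite)
  have "((\<lambda>e. poly px e) \<longlongrightarrow> poly px 0) (at_right 0)"
    by (intro tendsto_intros)
  then have "eventually (\<lambda>e. poly px e < 0) (at_right 0)"
    using neg by (intro order_tendstoD(2)[of _ "poly px 0"]) (auto simp: px)
  then obtain \<delta> where \<delta>: "0 < \<delta>" "\<And>e. 0 < e \<Longrightarrow> e < \<delta> \<Longrightarrow> poly px e < 0"
    unfolding eventually_at_right[OF zero_less_one] by auto
  \<comment> \<open>The finitely many roots of \<open>pg\<close> cannot exhaust the interval on
    which the witness stays negative.\<close>
  have "infinite {0<..<min \<delta> 1}" using \<delta>(1) by (intro infinite_Ioo) auto
  then obtain e where e: "e \<in> {0<..<min \<delta> 1}" "e \<notin> {e. poly pg e = 0}"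
    using fin finite_subset[of "{0<..<min \<delta> 1}"] by blast
  have "0 \<le> Qg u v e" "0 \<le> Qh u v e"
    using e(1) uv by (auto intro!: Qg(3) Qh(3))
  moreover have "Qg u v e \<noteq> 0" using e(2) pg by simp
  moreover have "Qx u v e < 0" using \<delta>(2)[of e] e(1) px by simp
  ultimately show False
    using prod[of u v e] by (metis less_eq_real_def mult_pos_neg not_le)
qed

end
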